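(* Let $n\in\{2,3\}$ and let $f:\mathbb{S}^{n+1}\to\mathbb{S}^n$ be a Lipschitz continuous map that is not homotopic to a constant map. Then there is a set $A\subset\mathbb{S}^{n+1}$ of positive measure such that $f$ is differentiable at every point of $A$, $\operatorname{rank} df=n$ at every point of $A$, and $f(A)$ is dense in $\mathbb{S}^n$.
   Context: $\mathbb{S}^\ell$ denotes the unit sphere in $\mathbb{R}^{\ell+1}$. Measure on $\mathbb{S}^{n+1}$ is the standard $(n+1)$-dimensional surface (Riemannian/Hausdorff) measure. The rank of $df$ at a point $x$ of differentiability is the rank of the linear map $df_x:T_x\mathbb{S}^{n+1}\to T_{f(x)}\mathbb{S}^n$. *)

theory Defs
  imports "HOL-Analysis.Analysis"
begin

section \<open>Hausdorff measure\<close>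

text \<open>
  The factor is the volume of a Euclidean ball of diameter \<open>diameter U\<close>; it normalises the
  \<open>d\<close>-dimensional Hausdorff measure to agree with \<open>d\<close>-dimensional surface area.  The empty set is
  singled out because of \<open>0 ^ 0 = 1\<close>.
\<close>

definition hausdorff_weight :: "nat \<Rightarrow> 'a::metric_space set \<Rightarrow> ennreal" where
  "hausdorff_weight d U =
     (if U = {} then 0 else ennreal (unit_ball_vol (real d) * (diameter U / 2) ^ d))"

text \<open>Boundedness is required since \<^const>\<open>diameter\<close> is meaningless on unbounded sets.\<close>

definition hausdorff_content :: "nat \<Rightarrow> real \<Rightarrow> 'a::metric_space set \<Rightarrow> ennreal" where
  "hausdorff_content d \<delta> A =
     (INF U\<in>{U :: nat \<Rightarrow> 'a set. (\<forall>i. bounded (U i) \<and> diameter (U i) \<le> \<delta>) \<and> A \<subseteq> (\<Union>i. U i)}.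
        \<Sum>i. hausdorff_weight d (U i))"

definition hausdorff_outer_measure :: "nat \<Rightarrow> 'a::metric_space set \<Rightarrow> ennreal" where
  "hausdorff_outer_measure d A = (SUP \<delta>\<in>{0<..}. hausdorff_content d \<delta> A)"

text \<open>The measurable sets are those satisfying Caratheodory's condition.\<close>

definition hausdorff_measure :: "nat \<Rightarrow> 'a::metric_space measure" where
  "hausdorff_measure d =
     measure_of UNIV (lambda_system UNIV UNIV (hausdorff_outer_measure d))
       (hausdorff_outer_measure d)"

lemma hausdorff_content_eq_outer_measure:
  fixes A :: "'a::metric_space set" and d :: nat and \<delta> :: real
  assumes "\<delta> > 0"
  defines "w \<equiv> \<lambda>U :: 'a set. if bounded U \<and> diameter U \<le> \<delta> then hausdorff_weight d U else \<infinity>"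
  shows "hausdorff_content d \<delta> A = outer_measure UNIV w A"
    and "positive UNIV w" and "increasing UNIV w"
proof -
  interpret sigma_algebra "UNIV :: 'a set" UNIV
    using sigma_algebra_Pow[of "UNIV :: 'a set"] by simp
  show pos: "positive UNIV w"
    using assms by (auto simp: positive_def hausdorff_weight_def)
  show inc: "increasing UNIV w"
    unfolding increasing_def
  proof (intro ballI impI)
    fix U V :: "'a set" assume UV: "U \<subseteq> V"
    show "w U \<le> w V"
    proof (cases "bounded V \<and> diameter V \<le> \<delta> \<and> U \<noteq> {}")
      case True
      then have "bounded U" "diameter U \<le> diameter V"
        using UV bounded_subset diameter_subset by blast+
      moreover have "unit_ball_vol (real d) * (diameter U / 2) ^ d
          \<le> unit_ball_vol (real d) * (diameter V / 2) ^ d"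
        using calculation by (intro mult_left_mono power_mono) (auto simp: diameter_ge_0)
      ultimately show ?thesis
        using True UV by (auto simp: w_def hausdorff_weight_def intro!: ennreal_leI)
    next
      case False
      then show ?thesis
        using assms by (auto simp: w_def hausdorff_weight_def)
    qed
  qed
  show "hausdorff_content d \<delta> A = outer_measure UNIV w A"
  proof (rule antisym)
    show "outer_measure UNIV w A \<le> hausdorff_content d \<delta> A"
      unfolding hausdorff_content_def
    proof (rule INF_greatest)
      fix U :: "nat \<Rightarrow> 'a set"
      assume "U \<in> {U. (\<forall>i. bounded (U i) \<and> diameter (U i) \<le> \<delta>) \<and> A \<subseteq> (\<Union>i. U i)}"
      then show "outer_measure UNIV w A \<le> (\<Sum>i. hausdorff_weight d (U i))"
        using outer_measure_le[OF pos inc, of U A] by (simp add: w_def)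
    qed
    show "hausdorff_content d \<delta> A \<le> outer_measure UNIV w A"
      unfolding outer_measure_def
    proof (rule INF_greatest)
      fix U :: "nat \<Rightarrow> 'a set"
      assume U: "U \<in> {U. range U \<subseteq> UNIV \<and> disjoint_family U \<and> A \<subseteq> (\<Union>i. U i)}"
      show "hausdorff_content d \<delta> A \<le> (\<Sum>i. w (U i))"
      proof (cases "\<forall>i. bounded (U i) \<and> diameter (U i) \<le> \<delta>")
        case True
        then have "hausdorff_content d \<delta> A \<le> (\<Sum>i. hausdorff_weight d (U i))"
          unfolding hausdorff_content_def using U by (intro INF_lower) auto
        then show ?thesis
          using True by (simp add: w_def)
      next
        case False
        then obtain j where "\<not> (bounded (U j) \<and> diameter (U j) \<le> \<delta>)"
          by blast
        then have "w (U j) = \<infinity>"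
          by (simp only: w_def if_False)
        moreover have "w (U j) \<le> (\<Sum>i. w (U i))"
          using sum_le_suminf[of "\<lambda>i. w (U i)" "{j}"] by simp
        ultimately show ?thesis
          by (simp add: top_unique)
      qed
    qed
  qed
qed

lemma outer_measure_space_hausdorff:
  "outer_measure_space UNIV (hausdorff_outer_measure d :: 'a::metric_space set \<Rightarrow> ennreal)"
proof -
  interpret sigma_algebra "UNIV :: 'a set" UNIV
    using sigma_algebra_Pow[of "UNIV :: 'a set"] by simp
  have oms: "outer_measure_space UNIV (hausdorff_content d \<delta> :: 'a set \<Rightarrow> ennreal)"
    if "\<delta> > 0" for \<delta>
  proof -
    have "hausdorff_content d \<delta> = outer_measure UNIV
        (\<lambda>U :: 'a set. if bounded U \<and> diameter U \<le> \<delta> then hausdorff_weight d U else \<infinity>)"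
      by (rule ext) (rule hausdorff_content_eq_outer_measure(1)[OF that])
    then show ?thesis
      using outer_measure_space_outer_measure[OF hausdorff_content_eq_outer_measure(2,3)[OF that]]
      by simp
  qed
  have 1: "hausdorff_content d \<delta> ({} :: 'a set) = 0" if "\<delta> > 0" for \<delta>
    using oms[OF that] by (simp add: outer_measure_space_def positive_def)
  have 2: "hausdorff_content d \<delta> A \<le> hausdorff_content d \<delta> B"
    if "\<delta> > 0" "A \<subseteq> B" for \<delta> and A B :: "'a set"
    using oms[OF that(1)] that(2) by (auto simp: outer_measure_space_def increasing_def)
  have 3: "hausdorff_content d \<delta> (\<Union>i. A i) \<le> (\<Sum>i. hausdorff_content d \<delta> (A i))"
    if "\<delta> > 0" "disjoint_family A" for \<delta> and A :: "nat \<Rightarrow> 'a set"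
    using oms[OF that(1)] that(2)
    by (simp add: outer_measure_space_def countably_subadditive_def)
  have "positive UNIV (hausdorff_outer_measure d :: 'a set \<Rightarrow> ennreal)"
    unfolding positive_def hausdorff_outer_measure_def
    using 1 by (simp add: image_constant_conv cong: SUP_cong_simp)
  moreover have "increasing UNIV (hausdorff_outer_measure d :: 'a set \<Rightarrow> ennreal)"
    unfolding increasing_def hausdorff_outer_measure_def
    by (intro ballI impI SUP_mono) (metis 2 greaterThan_iff)
  moreover have "hausdorff_outer_measure d (\<Union>i. A i) \<le> (\<Sum>i. hausdorff_outer_measure d (A i))"
    if "disjoint_family A" for A :: "nat \<Rightarrow> 'a set"
    unfolding hausdorff_outer_measure_def[of d "\<Union>i. A i"]
  proof (rule SUP_least)
    fix \<delta> :: real assume \<delta>: "\<delta> \<in> {0<..}"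
    then have "hausdorff_content d \<delta> (\<Union>i. A i) \<le> (\<Sum>i. hausdorff_content d \<delta> (A i))"
      by (intro 3 that) simp
    also have "\<dots> \<le> (\<Sum>i. hausdorff_outer_measure d (A i))"
      unfolding hausdorff_outer_measure_def using \<delta> by (intro suminf_le SUP_upper) auto
    finally show "hausdorff_content d \<delta> (\<Union>i. A i) \<le> (\<Sum>i. hausdorff_outer_measure d (A i))" .
  qed
  ultimately show ?thesis
    by (auto simp: outer_measure_space_def countably_subadditive_def)
qed

lemma measure_space_hausdorff:
  "measure_space UNIV
     (lambda_system UNIV UNIV (hausdorff_outer_measure d :: 'a::metric_space set \<Rightarrow> ennreal))
     (hausdorff_outer_measure d)"
  using sigma_algebra.caratheodory_lemma[OF sigma_algebra_Pow[of "UNIV :: 'a set"],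
      of "hausdorff_outer_measure d"] outer_measure_space_hausdorff[of d] by simp

lemma space_hausdorff_measure [simp]: "space (hausdorff_measure d) = UNIV"
  by (simp add: hausdorff_measure_def)

lemma sets_hausdorff_measure:
  "sets (hausdorff_measure d :: 'a::metric_space measure) =
     lambda_system UNIV UNIV (hausdorff_outer_measure d)"
  using measure_space_hausdorff[where 'a='a and d=d]
  unfolding hausdorff_measure_def measure_space_def
  by (intro sigma_algebra.sets_measure_of_eq) blast

lemma emeasure_hausdorff_measure:
  "A \<in> sets (hausdorff_measure d :: 'a::metric_space measure) \<Longrightarrow>
     emeasure (hausdorff_measure d) A = hausdorff_outer_measure d A"
  using measure_space_hausdorff[where 'a='a and d=d]
  unfolding sets_hausdorff_measure unfolding hausdorff_measure_def
  by (intro emeasure_measure_of_sigma) (auto simp: measure_space_def)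


section \<open>Differential of a map on the unit sphere\<close>

definition tangent_space_sphere :: "'a::euclidean_space \<Rightarrow> 'a set" where
  "tangent_space_sphere x = {v. x \<bullet> v = 0}"

text \<open>
  Maps on the unit sphere are maps of the ambient space of which only the values on the sphere
  matter; differentiability at \<open>x\<close> is \<^const>\<open>differentiable\<close> along the filter
  \<open>at x within sphere 0 1\<close>.  Such a derivative is determined only on the tangent space at \<open>x\<close>, and
  its restriction to the tangent space is the differential of the map.
\<close>

definition rank_on_sphere :: "('a::euclidean_space \<Rightarrow> 'b::euclidean_space) \<Rightarrow> 'a \<Rightarrow> nat" where
  "rank_on_sphere f x =
     dim (frechet_derivative f (at x within sphere 0 1) ` tangent_space_sphere x)"

lemma has_derivative_within_sphere_unique:
  fixes f :: "'a::euclidean_space \<Rightarrow> 'b::euclidean_space"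
  assumes x: "x \<in> sphere 0 1" and v: "v \<in> tangent_space_sphere x"
    and f': "(f has_derivative f') (at x within sphere 0 1)"
    and f'': "(f has_derivative f'') (at x within sphere 0 1)"
  shows "f' v = f'' v"
proof -
  have main: "f' v = f'' v" if n: "norm v = 1" and v: "x \<bullet> v = 0" for v
  proof -
    define c where "c = (\<lambda>t :: real. cos t *\<^sub>R x + sin t *\<^sub>R v)"
    have xx: "x \<bullet> x = 1" and vv: "v \<bullet> v = 1"
      using x n by (simp_all add: norm_eq_1)
    have c: "c t \<in> sphere 0 1" for t
      using sin_cos_squared_add[of t] xx vv v
      by (simp add: c_def norm_eq_1 inner_simps inner_commute[of v x] power2_eq_square)
    have c': "(c has_derivative (\<lambda>h. h *\<^sub>R v)) (at 0)"
      unfolding c_def by (auto intro!: derivative_eq_intros)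
    have c0: "c 0 = x"
      by (simp add: c_def)
    have D: "((f \<circ> c) has_derivative (g \<circ> (\<lambda>h. h *\<^sub>R v))) (at 0)"
      if "(f has_derivative g) (at x within sphere 0 1)" for g
    proof (rule diff_chain_within[OF c'])
      show "(f has_derivative g) (at (c 0) within range c)"
        using that c unfolding c0 by (blast intro: has_derivative_subset)
    qed
    show ?thesis
      using fun_cong[OF has_derivative_unique[OF D[OF f'] D[OF f'']], of 1] by simp
  qed
  have lin: "linear f'" "linear f''"
    using f' f'' has_derivative_linear by blast+
  show ?thesis
  proof (cases "v = 0")
    case False
    then have "f' (v /\<^sub>R norm v) = f'' (v /\<^sub>R norm v)"
      using v by (intro main) (auto simp: tangent_space_sphere_def)
    then show ?thesis
      using False lin by (simp add: linear_scale)
  qed (simp add: lin linear_0)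
qed

lemma rank_on_sphere_eq:
  fixes f :: "'a::euclidean_space \<Rightarrow> 'b::euclidean_space"
  assumes "x \<in> sphere 0 1" "(f has_derivative f') (at x within sphere 0 1)"
  shows "rank_on_sphere f x = dim (f' ` tangent_space_sphere x)"
proof -
  have "(f has_derivative frechet_derivative f (at x within sphere 0 1)) (at x within sphere 0 1)"
    using assms(2) frechet_derivative_works differentiable_def by blast
  then have "frechet_derivative f (at x within sphere 0 1) ` tangent_space_sphere x =
      f' ` tangent_space_sphere x"
    using has_derivative_within_sphere_unique[OF assms(1) _ _ assms(2)] by (intro image_cong) auto
  then show ?thesis
    by (simp add: rank_on_sphere_def)
qed

end

theory Submission
  imports Defs
begin

text \<open>
  Fix a small cap of the target and suppose that the points over it where the differential has rank
  \<open>n\<close> form a null set.  In a chart of the domain, and after composing with a linear projection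
  \<open>\<real>\<^sup>n\<^sup>+\<^sup>1 \<rightarrow> \<real>\<^sup>n\<close>
  whose fold lies over the cap, \<open>f\<close> becomes a Lipschitz map \<open>h\<close> to \<open>\<real>\<^sup>n\<close> that is degenerate almost everywhere
  over an open set \<open>V\<close>.  By an Eilenberg type estimate almost every fibre over \<open>V\<close> then has null projections to the
  coordinate axes, so it is missed by the walls of arbitrarily fine partitions of a cube into boxes.
  Off the interiors of the boxes meeting the fibre of \<open>w\<close>, the direction of \<open>h - w\<close> lifts to the line (\<open>n = 2\<close>) or
  through the Hopf map to the three-sphere (\<open>n = 3\<close>), because walls are glued along convex sets.
  For \<open>n = 2\<close> any extension of the lift moves \<open>h\<close> off \<open>w\<close>.  For \<open>n = 3\<close> the lift
  has rank at most three, so its image is null in \<open>\<complex>\<^sup>2\<close> and misses a point near the origin from which it can be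
  pushed away.  In both cases \<open>f\<close> is homotopic to a map that is not onto, hence to a constant.
\<close>

section \<open>Rademacher's theorem\<close>

text \<open>The two dimensions differ by what happens at the frontier of a box. In the chart a box
  has dimension n + 1, and h - w maps its frontier, an n-sphere, into n-space without the origin,
  which is an (n-1)-sphere up to homotopy. For n = 2 such a map is inessential. For n = 3 it can
  have a nonzero Hopf invariant, so the direction of h - w need not extend over a box. The Hopf lift
  replaces this by extending a map into pairs of complex numbers off one point, and degeneracy is
  used a second time to find a missed point. The target is projected linearly instead of being
  charted so that h is defined and Lipschitz on the whole chart. The price is that two sheets of the
  sphere lie over each value; near the fold both are close to the centre of the cap. Degeneracy is
  expressed by difference quotients, which makes it a Borel condition. The regular points are
  finally thinned out to compact sets, whose images on the sphere are closed and hence measurable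
  for the Hausdorff measure.\<close>

text \<open>Let \<open>m\<close> be the infimum of the measures of bounded open supersets. Adding
  the null remainder to \<open>W\<close> and using outer regularity gives such a superset of nearly
  the same measure, so \<open>m \<le> c * m\<close>.\<close>

lemma negligible_open_contraction:
  fixes S :: "'a::euclidean_space set"
  assumes "bounded S" "0 \<le> c" "c < 1"
    and contr: "\<And>U. open U \<Longrightarrow> bounded U \<Longrightarrow> S \<subseteq> U \<Longrightarrow>
      \<exists>W. W \<in> lmeasurable \<and> measure lebesgue W \<le> c * measure lebesgue U \<and> negligible (S - W)"
  shows "negligible S"
proof -
  define m where "m = (INF U\<in>{U. open U \<and> bounded U \<and> S \<subseteq> U}. measure lebesgue U)"
  obtain B where B: "S \<subseteq> ball 0 B"
    using assms(1) bounded_subset_ballD by blast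
  have ne: "{U. open U \<and> bounded U \<and> S \<subseteq> U} \<noteq> {}"
    using B bounded_ball open_ball by blast
  have bdd: "bdd_below (measure lebesgue ` {U. open U \<and> bounded U \<and> S \<subseteq> U})"
    by (auto intro!: bdd_belowI[where m=0])
  have m0: "0 \<le> m"
    unfolding m_def using ne by (intro cINF_greatest) auto
  have step: "m \<le> c * measure lebesgue U" if U: "open U" "bounded U" "S \<subseteq> U" for U
  proof (rule field_le_epsilon)
    fix e :: real assume e: "0 < e"
    obtain W where W: "W \<in> lmeasurable" "measure lebesgue W \<le> c * measure lebesgue U" "negligible (S - W)"
      using contr[OF U] by blast
    have neg: "negligible (S - W)" by (rule W)
    have WS: "(W \<union> (S - W)) \<in> lmeasurable"
      using W(1) neg negligible_imp_measurable by blast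
    have mWS: "measure lebesgue (W \<union> (S - W)) = measure lebesgue W"
      using W(1) neg measure_Un_null_set[of W lebesgue "S - W"]
      by (simp only: negligible_iff_null_sets fmeasurableD)
    obtain T where T: "open T" "W \<union> (S - W) \<subseteq> T" "T - (W \<union> (S - W)) \<in> lmeasurable"
       "emeasure lebesgue (T - (W \<union> (S - W))) < ennreal e"
      using sets_lebesgue_outer_open[OF fmeasurableD[OF WS] e] by metis
    have Te: "measure lebesgue (T - (W \<union> (S - W))) \<le> e"
      using T(4) e by (simp add: measure_def enn2real_leI)
    \<comment> \<open>Outer regularity may give an unbounded \<open>T\<close>; cutting it with a
      ball around \<open>S\<close> makes it a competitor for the infimum.\<close>
    define T' where "T' = T \<inter> ball 0 B"
    have T': "open T'" "bounded T'" "S \<subseteq> T'"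
      using T B by (auto simp: T'_def)
    then have "m \<le> measure lebesgue T'"
      unfolding m_def by (intro cINF_lower bdd) auto
    also have "\<dots> \<le> measure lebesgue ((W \<union> (S - W)) \<union> (T - (W \<union> (S - W))))"
    proof (rule measure_mono_fmeasurable)
      show "T' \<in> sets lebesgue"
        using T' by (simp add: lmeasurable_open fmeasurableD)
      show "(W \<union> (S - W)) \<union> (T - (W \<union> (S - W))) \<in> lmeasurable"
        using T(3) WS by blast
    qed (auto simp: T'_def)
    also have "\<dots> \<le> measure lebesgue (W \<union> (S - W)) + measure lebesgue (T - (W \<union> (S - W)))"
      using T(3) WS by (intro measure_Un_le) (auto intro: fmeasurableD)
    also have "\<dots> \<le> c * measure lebesgue U + e"
      using Te mWS W(2) by linarith
    finally show "m \<le> c * measure lebesgue U + e" .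
  qed
  have "m \<le> c * m"
  proof (cases "c = 0")
    case True
    have "m \<le> c * measure lebesgue (ball (0::'a) B)"
      by (intro step) (use B in auto)
    then show ?thesis using True by simp
  next
    case False
    then have "m / c \<le> m"
      using step assms(2) ne unfolding m_def[of ]
      by (intro cINF_greatest) (auto simp: field_simps m_def)
    then show ?thesis using False assms(2) by (simp add: field_simps)
  qed
  then have "m = 0"
    using assms(3) m0 by (smt (verit, best) mult_le_cancel_right1)
  show ?thesis
    unfolding negligible_outer_le
  proof (intro allI impI)
    fix e :: real assume "0 < e"
    then obtain U where "open U" "bounded U" "S \<subseteq> U" "measure lebesgue U < e"
      using \<open>m = 0\<close> cINF_less_iff[OF ne bdd, of e] unfolding m_def by auto
    then show "\<exists>T. S \<subseteq> T \<and> T \<in> lmeasurable \<and> measure lebesgue T \<le> e"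
      using lmeasurable_open by (metis less_imp_le)
  qed
qed

text \<open>Inside an open superset, disjoint Vitali balls cover almost all of \<open>S\<close>.
  Removing from each ball its hole loses no point of \<open>S\<close> but shrinks the volume by the
  factor \<open>1 - \<eta> ^ n\<close>, so the contraction lemma applies.\<close>

lemma negligible_porous:
  fixes S :: "'a::euclidean_space set"
  assumes "bounded S" "0 < \<eta>"
    and por: "\<And>x d. x \<in> S \<Longrightarrow> 0 < d \<Longrightarrow> \<exists>z r a. 0 < r \<and> r < d \<and> x \<in> cball z r \<and>
        cball a (\<eta> * r) \<subseteq> cball z r \<and> cball a (\<eta> * r) \<inter> S = {}"
  shows "negligible S"
proof -
  define n where "n = DIM('a)"
  \<comment> \<open>A hole of relative radius above 1 cannot fit into its ball; the value 0 keeps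
    \<open>c\<close> nonnegative in that case.\<close>
  define c where "c = (if \<eta> \<le> 1 then 1 - \<eta> ^ n else 0)"
  have c: "0 \<le> c" "c < 1"
    using assms(2) by (auto simp: c_def power_le_one)
  show ?thesis
  proof (rule negligible_open_contraction[OF assms(1) c])
    fix U :: "'a set" assume U: "open U" "bounded U" "S \<subseteq> U"
    define K where "K = {(z, r). 0 < r \<and> cball z r \<subseteq> U \<and>
       (\<exists>a. cball a (\<eta> * r) \<subseteq> cball z r \<and> cball a (\<eta> * r) \<inter> S = {})}"
    have "\<exists>i. i \<in> K \<and> x \<in> cball (fst i) (snd i) \<and> snd i < d" if x: "x \<in> S" "0 < d" for x d
    proof -
      obtain e where e: "0 < e" "cball x e \<subseteq> U"
        using U x open_contains_cball by blast
      \<comment> \<open>A ball of radius \<open>r\<close> that contains \<open>x\<close> reaches at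
        most \<open>2 * r\<close> away from \<open>x\<close>, hence the bound
        \<open>e / 2\<close>.\<close>
      obtain z r a where zr: "0 < r" "r < min d (e/2)" "x \<in> cball z r"
        "cball a (\<eta> * r) \<subseteq> cball z r" "cball a (\<eta> * r) \<inter> S = {}"
        using por[OF x(1), of "min d (e/2)"] e x(2) by auto
      have "cball z r \<subseteq> cball x e"
      proof
        fix y assume "y \<in> cball z r"
        then show "y \<in> cball x e"
          using zr dist_triangle[of x y z] by (auto simp: dist_commute)
      qed
      then have "(z, r) \<in> K"
        using zr e by (auto simp: K_def)
      then show ?thesis using zr by force
    qed
    note cov = this
    have Kpos: "0 < snd i" if "i \<in> K" for i
      using that by (auto simp: K_def)
    obtain C where C: "countable C" "C \<subseteq> K"
      "pairwise (\<lambda>i j. disjnt (cball (fst i) (snd i)) (cball (fst j) (snd j))) C"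
      "negligible (S - (\<Union>i\<in>C. cball (fst i) (snd i)))"
      by (rule Vitali_covering_theorem_cballs[OF Kpos cov]) blast+
    have "\<exists>a. cball a (\<eta> * snd i) \<subseteq> cball (fst i) (snd i) \<and> cball a (\<eta> * snd i) \<inter> S = {}"
      if "i \<in> C" for i
      using subsetD[OF C(2) that] unfolding K_def by (cases i) auto
    then obtain a where a: "\<And>i. i \<in> C \<Longrightarrow> cball (a i) (\<eta> * snd i) \<subseteq> cball (fst i) (snd i)"
       "\<And>i. i \<in> C \<Longrightarrow> cball (a i) (\<eta> * snd i) \<inter> S = {}"
      by metis
    define D where "D i = cball (fst i) (snd i) - cball (a i) (\<eta> * snd i)" for i
    have pos: "0 < snd i" if "i \<in> C" for i
      using that C(2) by (auto simp: K_def)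
    have Dm: "D i \<in> lmeasurable" for i
      by (simp add: D_def fmeasurable.Diff)
    have mD: "measure lebesgue (D i) \<le> c * measure lebesgue (cball (fst i) (snd i))" if i: "i \<in> C" for i
    proof -
      have "measure lebesgue (D i) = measure lebesgue (cball (fst i) (snd i)) - measure lebesgue (cball (a i) (\<eta> * snd i))"
        unfolding D_def using a(1)[OF i] by (intro measurable_measure_Diff) (auto simp: fmeasurableD)
      also have "measure lebesgue (cball (a i) (\<eta> * snd i)) = \<eta> ^ n * measure lebesgue (cball (fst i) (snd i))"
        using pos[OF i] assms(2) content_ball_conv_unit_ball[of "\<eta> * snd i" "a i"] content_ball_conv_unit_ball[of "snd i" "fst i"]
        by (simp add: content_cball_conv_ball power_mult_distrib n_def)
      finally have eq: "measure lebesgue (D i) = (1 - \<eta> ^ n) * measure lebesgue (cball (fst i) (snd i))"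
        by (simp add: algebra_simps)
      show ?thesis
      proof (cases "\<eta> \<le> 1")
        case True then show ?thesis using eq by (simp add: c_def)
      next
        case False
        then have "(1 - \<eta> ^ n) * measure lebesgue (cball (fst i) (snd i)) \<le> 0"
          by (intro mult_nonpos_nonneg) (auto simp: one_le_power)
        then show ?thesis using False eq by (simp add: c_def)
      qed
    qed
    have bound: "measure lebesgue (\<Union>i\<in>I. D i) \<le> c * measure lebesgue U" if "I \<subseteq> C" "finite I" for I
    proof -
      have "measure lebesgue (\<Union>i\<in>I. D i) \<le> (\<Sum>i\<in>I. measure lebesgue (D i))"
        using that Dm by (intro measure_UNION_le) (auto simp: fmeasurableD)
      also have "\<dots> \<le> (\<Sum>i\<in>I. c * measure lebesgue (cball (fst i) (snd i)))"
        using that mD by (intro sum_mono) auto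
      also have "\<dots> = c * (\<Sum>i\<in>I. measure lebesgue (cball (fst i) (snd i)))"
        by (simp add: sum_distrib_left)
      also have "(\<Sum>i\<in>I. measure lebesgue (cball (fst i) (snd i))) = measure lebesgue (\<Union>i\<in>I. cball (fst i) (snd i))"
      proof (rule measure_negligible_finite_Union_image[symmetric, OF that(2)])
        show "pairwise (\<lambda>x y. negligible (cball (fst x) (snd x) \<inter> cball (fst y) (snd y))) I"
          by (rule pairwise_mono[OF C(3) _ that(1)]) (simp add: disjnt_def)
      qed simp
      also have "\<dots> \<le> measure lebesgue U"
      proof (rule measure_mono_fmeasurable)
        have "cball (fst i) (snd i) \<subseteq> U" if "i \<in> C" for i
          using subsetD[OF C(2) that] unfolding K_def by auto
        then show "(\<Union>i\<in>I. cball (fst i) (snd i)) \<subseteq> U"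
          using that(1) by blast
        show "(\<Union>i\<in>I. cball (fst i) (snd i)) \<in> sets lebesgue"
          using that(2) by (intro sets.finite_UN) auto
      qed (use U in \<open>simp add: lmeasurable_open\<close>)
      finally show ?thesis using c by (simp add: mult_left_mono)
    qed
    have "(\<Union>i\<in>C. D i) \<in> lmeasurable" "measure lebesgue (\<Union>i\<in>C. D i) \<le> c * measure lebesgue U"
      using fmeasurable_UN_bound[OF C(1), of D] measure_UN_bound[OF C(1), of D] Dm bound by blast+
    moreover have "S - (\<Union>i\<in>C. D i) = S - (\<Union>i\<in>C. cball (fst i) (snd i))"
      using a(2) by (auto simp: D_def)
    ultimately show "\<exists>W. W \<in> lmeasurable \<and> measure lebesgue W \<le> c * measure lebesgue U \<and> negligible (S - W)"
      using C(4) by (intro exI[of _ "\<Union>i\<in>C. D i"]) simp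
  qed
qed

text \<open>Cover an open set around the exceptional set first by intervals of slope at most \<open>a\<close>, then cover these by
  intervals of slope at least \<open>b\<close>: comparing the increments of \<open>\<phi>\<close>, the second cover is smaller by the factor
  \<open>a / b\<close>.\<close>

lemma negligible_slope_oscillation:
  fixes \<phi> :: "real \<Rightarrow> real"
  assumes mono: "mono \<phi>" and cont: "continuous_on UNIV \<phi>" and ab: "0 \<le> a" "a < b"
  defines "slopes t d \<equiv> {(\<phi> v - \<phi> u) / (v - u) | u v. u < v \<and> u \<le> t \<and> t \<le> v \<and> v - u < d}"
  shows "negligible {t. \<bar>t\<bar> < M \<and> (\<forall>d>0. (\<exists>s\<in>slopes t d. s \<le> a) \<and> (\<exists>s\<in>slopes t d. b \<le> s))}"
    (is "negligible ?E")
proof (rule negligible_open_contraction[where c = "a / b"])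
  show "bounded ?E"
    by (rule bounded_subset[of "ball 0 M"]) (auto simp: dist_real_def)
  show "0 \<le> a / b" "a / b < 1"
    using ab by auto
  \<comment> \<open>The Stieltjes measure turns increments over intervals into measures, which can
    be summed over countable disjoint covers and compared by inclusion.\<close>
  define \<mu> where "\<mu> = interval_measure \<phi>"
  have incr: "\<phi> u \<le> \<phi> v" if "u \<le> v" for u v
    using mono that by (auto dest: monoD)
  have mu: "emeasure \<mu> (cball c r) = ennreal (\<phi> (c + r) - \<phi> (c - r))" if "0 < r" for c r
    unfolding \<mu>_def cball_eq_atLeastAtMost
    using that incr by (intro emeasure_interval_measure_Icc continuous_on_subset[OF cont]) auto
  have sets_mu: "sets \<mu> = sets borel"
    by (simp add: \<mu>_def)
  have cover: "\<exists>C. countable C \<and> C \<subseteq> {(c, r). 0 < r \<and> cball c r \<subseteq> U \<and> P ((\<phi> (c + r) - \<phi> (c - r)) / (2 * r))} \<and>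
      pairwise (\<lambda>i j. disjnt (cball (fst i) (snd i)) (cball (fst j) (snd j))) C \<and>
      negligible (S - (\<Union>i\<in>C. cball (fst i) (snd i)))"
    if U: "open U" "S \<subseteq> U" and P: "\<And>t d. t \<in> S \<Longrightarrow> 0 < d \<Longrightarrow> \<exists>s\<in>slopes t d. P s" for U S :: "real set" and P
  proof -
    define K where "K = {(c, r). 0 < r \<and> cball c r \<subseteq> U \<and> P ((\<phi> (c + r) - \<phi> (c - r)) / (2 * r))}"
    have Kpos: "0 < snd i" if "i \<in> K" for i
      using that by (auto simp: K_def)
    have cov: "\<exists>i. i \<in> K \<and> t \<in> cball (fst i) (snd i) \<and> snd i < d" if t: "t \<in> S" "0 < d" for t d
    proof -
      obtain e where e: "0 < e" "ball t e \<subseteq> U"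
        using U t open_contains_ball by blast
      have "0 < min d e" using t e by simp
      then obtain u v where uv: "u < v" "u \<le> t" "t \<le> v" "v - u < min d e" "P ((\<phi> v - \<phi> u) / (v - u))"
        using P[OF t(1), of "min d e"] unfolding slopes_def by auto
      define c r where "c = (u + v) / 2" and "r = (v - u) / 2"
      have cr: "c + r = v" "c - r = u" "2 * r = v - u"
        by (auto simp: c_def r_def field_simps)
      have "cball c r \<subseteq> U"
        using e(2) uv unfolding cball_eq_atLeastAtMost cr ball_eq_greaterThanLessThan
        by (auto simp: subset_iff)
      then have "(c, r) \<in> K"
        using uv unfolding K_def by (auto simp: cr) (simp add: r_def)
      moreover have "t \<in> cball c r" "r < d"
        using uv unfolding cball_eq_atLeastAtMost cr by (auto simp: r_def)
      ultimately show ?thesis by force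
    qed
    obtain C where "countable C" "C \<subseteq> K"
      "pairwise (\<lambda>i j. disjnt (cball (fst i) (snd i)) (cball (fst j) (snd j))) C"
      "negligible (S - (\<Union>i\<in>C. cball (fst i) (snd i)))"
      by (rule Vitali_covering_theorem_cballs[OF Kpos cov]) blast+
    then show ?thesis unfolding K_def by blast
  qed
  fix U :: "real set" assume U: "open U" "bounded U" "?E \<subseteq> U"
  define P1 where "P1 = (\<lambda>s::real. s \<le> a)"
  define P2 where "P2 = (\<lambda>s::real. b \<le> s)"
  obtain C1 where C1: "countable C1" "C1 \<subseteq> {(c, r). 0 < r \<and> cball c r \<subseteq> U \<and> P1 ((\<phi> (c + r) - \<phi> (c - r)) / (2 * r))}"
      "pairwise (\<lambda>i j. disjnt (cball (fst i) (snd i)) (cball (fst j) (snd j))) C1"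
      "negligible (?E - (\<Union>i\<in>C1. cball (fst i) (snd i)))"
    using cover[OF U(1,3), of P1] unfolding P1_def by blast
  \<comment> \<open>Open balls, because the second cover has to be taken inside an open set. The
    spheres lost are countably many pairs of endpoints.\<close>
  define V where "V = (\<Union>i\<in>C1. ball (fst i) (snd i))"
  obtain C2 where C2: "countable C2" "C2 \<subseteq> {(c, r). 0 < r \<and> cball c r \<subseteq> V \<and> P2 ((\<phi> (c + r) - \<phi> (c - r)) / (2 * r))}"
      "pairwise (\<lambda>i j. disjnt (cball (fst i) (snd i)) (cball (fst j) (snd j))) C2"
      "negligible (?E \<inter> V - (\<Union>i\<in>C2. cball (fst i) (snd i)))"
    using cover[of V "?E \<inter> V" P2] unfolding P2_def V_def by blast
  define W1 W2 where "W1 = (\<Union>i\<in>C1. cball (fst i) (snd i))" and "W2 = (\<Union>i\<in>C2. cball (fst i) (snd i))"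
  have C1D: "0 < snd i" "cball (fst i) (snd i) \<subseteq> U" "\<phi> (fst i + snd i) - \<phi> (fst i - snd i) \<le> a * (2 * snd i)" if "i \<in> C1" for i
    using subsetD[OF C1(2) that] by (auto simp: P1_def field_simps)
  have C2D: "0 < snd i" "cball (fst i) (snd i) \<subseteq> V" "b * (2 * snd i) \<le> \<phi> (fst i + snd i) - \<phi> (fst i - snd i)" if "i \<in> C2" for i
    using subsetD[OF C2(2) that] by (auto simp: P2_def field_simps)
  have dis: "disjoint_family_on (\<lambda>i. cball (fst i) (snd i)) C1" "disjoint_family_on (\<lambda>i. cball (fst i) (snd i)) C2"
    using C1(3) C2(3) by (auto simp: disjoint_family_on_def pairwise_def disjnt_def)
  have W2V: "W2 \<subseteq> V"
    unfolding W2_def by (rule UN_least) (rule C2D(2))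
  have W1U: "W1 \<subseteq> U"
    unfolding W1_def by (rule UN_least) (rule C1D(2))
  have VW1: "V \<subseteq> W1"
    unfolding V_def W1_def by (intro UN_mono ball_subset_cball) auto
  have meas: "W1 \<in> sets borel" "W2 \<in> sets borel"
    unfolding W1_def W2_def using C1(1) C2(1) by (auto intro!: sets.countable_UN'')
  have lb: "emeasure lborel (cball c r) = ennreal (2 * r)" if "0 < r" for c r :: real
    using that unfolding cball_eq_atLeastAtMost by simp
  \<comment> \<open>The chain is b |W2| \<le> \<mu>(W2) \<le> \<mu>(W1) \<le> a |W1| \<le> a |U|:
    steep intervals inside, flat ones outside.\<close>
  have "ennreal b * emeasure lborel W2 = ennreal b * (\<integral>\<^sup>+i. emeasure lborel (cball (fst i) (snd i)) \<partial>count_space C2)"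
    unfolding W2_def by (subst emeasure_UN_countable[OF _ C2(1) dis(2)]) auto
  also have "\<dots> = (\<integral>\<^sup>+i. ennreal b * emeasure lborel (cball (fst i) (snd i)) \<partial>count_space C2)"
    by (simp add: nn_integral_cmult)
  also have "\<dots> \<le> (\<integral>\<^sup>+i. emeasure \<mu> (cball (fst i) (snd i)) \<partial>count_space C2)"
  proof (rule nn_integral_mono)
    fix i assume "i \<in> space (count_space C2)"
    then have i: "i \<in> C2" by simp
    have "ennreal b * ennreal (2 * snd i) = ennreal (b * (2 * snd i))"
      using ab C2D(1)[OF i] by (simp add: ennreal_mult)
    also have "\<dots> \<le> ennreal (\<phi> (fst i + snd i) - \<phi> (fst i - snd i))"
      using C2D(3)[OF i] by (rule ennreal_leI)
    finally show "ennreal b * emeasure lborel (cball (fst i) (snd i)) \<le> emeasure \<mu> (cball (fst i) (snd i))"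
      by (simp add: mu[OF C2D(1)[OF i]] lb[OF C2D(1)[OF i]])
  qed
  also have "\<dots> = emeasure \<mu> W2"
    unfolding W2_def by (subst emeasure_UN_countable[OF _ C2(1) dis(2)]) (auto simp: sets_mu)
  also have "\<dots> \<le> emeasure \<mu> W1"
    using W2V VW1 meas by (intro emeasure_mono) (auto simp: sets_mu)
  also have "\<dots> = (\<integral>\<^sup>+i. emeasure \<mu> (cball (fst i) (snd i)) \<partial>count_space C1)"
    unfolding W1_def by (subst emeasure_UN_countable[OF _ C1(1) dis(1)]) (auto simp: sets_mu)
  also have "\<dots> \<le> (\<integral>\<^sup>+i. ennreal a * emeasure lborel (cball (fst i) (snd i)) \<partial>count_space C1)"
  proof (rule nn_integral_mono)
    fix i assume "i \<in> space (count_space C1)"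
    then have i: "i \<in> C1" by simp
    have "ennreal (\<phi> (fst i + snd i) - \<phi> (fst i - snd i)) \<le> ennreal (a * (2 * snd i))"
      using C1D(3)[OF i] by (rule ennreal_leI)
    also have "\<dots> = ennreal a * ennreal (2 * snd i)"
      using ab C1D(1)[OF i] by (simp add: ennreal_mult)
    finally show "emeasure \<mu> (cball (fst i) (snd i)) \<le> ennreal a * emeasure lborel (cball (fst i) (snd i))"
      by (simp add: mu[OF C1D(1)[OF i]] lb[OF C1D(1)[OF i]])
  qed
  also have "\<dots> = ennreal a * emeasure lborel W1"
    unfolding W1_def by (subst emeasure_UN_countable[OF _ C1(1) dis(1)]) (auto simp: nn_integral_cmult)
  also have "\<dots> \<le> ennreal a * emeasure lborel U"
    using W1U U(1) by (intro mult_left_mono emeasure_mono) auto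
  finally have main: "ennreal b * emeasure lborel W2 \<le> ennreal a * emeasure lborel U" .
  have Um: "U \<in> lmeasurable" using U by (simp add: lmeasurable_open)
  have W2m: "W2 \<in> lmeasurable"
    by (rule fmeasurableI2[OF Um]) (use W2V VW1 W1U meas in auto)
  have "measure lebesgue W2 \<le> a / b * measure lebesgue U"
  proof -
    have "ennreal (measure lebesgue W2) = emeasure lborel W2" "ennreal (measure lebesgue U) = emeasure lborel U"
      using W2m Um meas U(1) emeasure_eq_measure2[of W2 lebesgue] emeasure_eq_measure2[of U lebesgue]
      by (simp_all add: emeasure_completion)
    then have "ennreal (b * measure lebesgue W2) \<le> ennreal (a * measure lebesgue U)"
      using main ab by (simp add: ennreal_mult)
    then have "b * measure lebesgue W2 \<le> a * measure lebesgue U"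
      using ab by (simp add: ennreal_le_iff)
    then show ?thesis using ab by (simp add: field_simps)
  qed
  moreover have "negligible (?E - W2)"
  proof (rule negligible_subset)
    have "W1 \<subseteq> V \<union> (\<Union>i\<in>C1. sphere (fst i) (snd i))"
      unfolding W1_def V_def UN_Un_distrib[symmetric] by (intro UN_mono) auto
    then show "?E - W2 \<subseteq> ((?E - W1) \<union> (\<Union>i\<in>C1. sphere (fst i) (snd i))) \<union> (?E \<inter> V - W2)"
      by blast
    have "negligible (\<Union>i\<in>C1. sphere (fst i) (snd i))"
      using C1(1) by (intro negligible_countable_Union) (auto simp only: negligible_sphere)
    then show "negligible (((?E - W1) \<union> (\<Union>i\<in>C1. sphere (fst i) (snd i))) \<union> (?E \<inter> V - W2))"
      using C1(4) C2(4) unfolding W1_def W2_def by (intro negligible_Un)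
  qed
  ultimately show "\<exists>W. W \<in> lmeasurable \<and> measure lebesgue W \<le> a / b * measure lebesgue U \<and> negligible (?E - W)"
    using W2m by blast
qed

section \<open>Lipschitz functions of one real variable\<close>

text \<open>Slopes are taken over short intervals containing \<open>t\<close>. If their lower and
  upper limits differed, two rationals would separate them and \<open>t\<close> would lie in one of
  countably many null sets.\<close>

lemma lipschitz_mono_real_differentiable_ae:
  fixes \<phi> :: "real \<Rightarrow> real"
  assumes mono: "mono \<phi>" and lip: "L-lipschitz_on UNIV \<phi>"
  shows "negligible {t. \<not> \<phi> differentiable at t}"
proof -
  define slopes where "slopes t d = {(\<phi> v - \<phi> u) / (v - u) | u v. u < v \<and> u \<le> t \<and> t \<le> v \<and> v - u < d}" for t d
  define E where "E a b M = {t. \<bar>t\<bar> < M \<and> (\<forall>d>0. (\<exists>s\<in>slopes t d. s \<le> a) \<and> (\<exists>s\<in>slopes t d. b \<le> s))}" for a b M :: real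
  have cont: "continuous_on UNIV \<phi>"
    using lip lipschitz_on_continuous_on by blast
  have E: "negligible (E a b M)" if "0 \<le> a" "a < b" for a b M
    using negligible_slope_oscillation[OF mono cont that, of M] unfolding E_def slopes_def .
  define I where "I = {(a, b, M). a \<in> \<rat> \<and> b \<in> \<rat> \<and> (M::real) \<in> \<nat> \<and> 0 \<le> a \<and> a < (b::real)}"
  have "countable ((\<rat>::real set) \<times> (\<rat>::real set) \<times> (\<nat>::real set))"
    by (intro countable_SIGMA countable_rat) (auto simp: Nats_def)
  then have "countable I"
    by (rule countable_subset[rotated]) (auto simp: I_def)
  then have negl: "negligible (\<Union>i\<in>I. case i of (a, b, M) \<Rightarrow> E a b M)"
    by (intro negligible_countable_Union) (auto simp: I_def E)
  have slope_le: "s \<le> L" "0 \<le> s" if "s \<in> slopes t d" for s t d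
  proof -
    obtain u v where uv: "s = (\<phi> v - \<phi> u) / (v - u)" "u < v"
      using \<open>s \<in> slopes t d\<close> unfolding slopes_def by blast
    have "\<phi> u \<le> \<phi> v" using monoD[OF mono, of u v] uv by simp
    then show "0 \<le> s" using uv by simp
    have "\<bar>\<phi> v - \<phi> u\<bar> \<le> L * \<bar>v - u\<bar>"
      using lipschitz_onD[OF lip, of v u] by (simp add: dist_real_def)
    then have "\<phi> v - \<phi> u \<le> L * (v - u)" using uv by simp
    then show "s \<le> L" using uv by (simp add: pos_divide_le_eq)
  qed
  have diff: "\<phi> differentiable at t" if t: "t \<notin> (\<Union>i\<in>I. case i of (a, b, M) \<Rightarrow> E a b M)" for t
  proof -
    \<comment> \<open>Eventual lower bounds of the slopes at \<open>t\<close>. The supremum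
      \<open>D\<close> is the lower derivative, the only candidate for the derivative.\<close>
    define G where "G = {a. \<exists>d>0. \<forall>s\<in>slopes t d. a \<le> s}"
    have G0: "0 \<in> G" unfolding G_def using slope_le(2) zero_less_one by blast
    have sl: "\<exists>s. s \<in> slopes t d" if "0 < d" for d
    proof -
      have "(\<phi> (t + d/2) - \<phi> t) / (t + d/2 - t) \<in> slopes t d"
        unfolding slopes_def by (rule CollectI, rule exI[of _ t], rule exI[of _ "t + d/2"]) (use that in auto)
      then show ?thesis by blast
    qed
    have GL: "a \<le> L" if aG: "a \<in> G" for a
    proof -
      obtain d where d: "0 < d" "\<forall>s\<in>slopes t d. a \<le> s" using aG unfolding G_def by blast
      obtain s where "s \<in> slopes t d" using sl[OF d(1)] by blast
      then show ?thesis using d(2) slope_le(1) order_trans by blast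
    qed
    have bdd: "bdd_above G" using GL by (rule bdd_aboveI)
    define D where "D = Sup G"
    have D0: "0 \<le> D" unfolding D_def by (rule cSup_upper[OF G0 bdd])
    have key: "\<exists>d>0. \<forall>s\<in>slopes t d. \<bar>s - D\<bar> \<le> e" if e: "0 < e" for e
    proof -
      obtain a1 where a1: "a1 \<in> G" "D - e < a1"
        using less_cSup_iff[of G "D - e"] G0 bdd e unfolding D_def by auto
      obtain d1 where d1: "0 < d1" "\<forall>s\<in>slopes t d1. a1 \<le> s"
        using a1 by (auto simp: G_def)
      \<comment> \<open>Both rationals lie above \<open>D\<close>. Slopes eventually above
        \<open>a\<close> would put \<open>a\<close> into \<open>G\<close>, against
        \<open>D < a\<close>; so the slopes fall below \<open>b\<close>, and thus below
        \<open>D + e\<close>.\<close>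
      obtain b where b: "b \<in> \<rat>" "D < b" "b < D + e"
        using Rats_dense_in_real[of D "D + e"] e by auto
      obtain a where ab: "a \<in> \<rat>" "b \<in> \<rat>" "D < a" "a < b" "b < D + e"
        using Rats_dense_in_real[of D b] b by auto
      obtain M where M: "M \<in> \<nat>" "\<bar>t\<bar> < M"
        by (metis reals_Archimedean2 of_nat_in_Nats)
      have "(a, b, M) \<in> I" using ab D0 M by (auto simp: I_def)
      then have "t \<notin> E a b M" using t by blast
      then obtain d2 where d2: "0 < d2" "(\<forall>s\<in>slopes t d2. a < s) \<or> (\<forall>s\<in>slopes t d2. s < b)"
        using M unfolding E_def by (auto simp: not_le)
      have "\<not> (\<forall>s\<in>slopes t d2. a < s)"
      proof
        assume "\<forall>s\<in>slopes t d2. a < s"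
        then have "a \<in> G" using d2 by (auto simp: G_def less_imp_le)
        then have "a \<le> D" unfolding D_def by (rule cSup_upper[OF _ bdd])
        then show False using ab by simp
      qed
      then have d2': "\<forall>s\<in>slopes t d2. s < b" using d2 by blast
      have sub: "slopes t (min d1 d2) \<subseteq> slopes t d1 \<inter> slopes t d2"
        by (auto simp: slopes_def)
      show ?thesis
      proof (intro exI[of _ "min d1 d2"] conjI ballI)
        fix s assume "s \<in> slopes t (min d1 d2)"
        then have "a1 \<le> s" "s < b" using sub d1 d2' by blast+
        then show "\<bar>s - D\<bar> \<le> e" using a1 ab by auto
      qed (use d1 d2 in auto)
    qed
    have "(\<phi> has_derivative (\<lambda>h. D * h)) (at t)"
      unfolding has_derivative_at_alt
    proof (intro conjI allI impI)
      show "bounded_linear (\<lambda>h. D * h)" by (rule bounded_linear_mult_right)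
      fix e :: real assume "0 < e"
      then obtain d where d: "0 < d" "\<forall>s\<in>slopes t d. \<bar>s - D\<bar> \<le> e" using key by blast
      show "\<exists>d>0. \<forall>y. norm (y - t) < d \<longrightarrow> norm (\<phi> y - \<phi> t - D * (y - t)) \<le> e * norm (y - t)"
      proof (intro exI[of _ d] conjI allI impI)
        fix y assume y: "norm (y - t) < d"
        show "norm (\<phi> y - \<phi> t - D * (y - t)) \<le> e * norm (y - t)"
        proof (cases "y = t")
          case False
          have "(\<phi> y - \<phi> t) / (y - t) \<in> slopes t d"
          proof (cases "t < y")
            case True
            then show ?thesis using y unfolding slopes_def by fastforce
          next
            case F: False
            have "(\<phi> y - \<phi> t) / (y - t) = (\<phi> t - \<phi> y) / (t - y)"
              using False by (simp add: field_simps)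
            then show ?thesis using F False y unfolding slopes_def by fastforce
          qed
          then have "\<bar>(\<phi> y - \<phi> t) / (y - t) - D\<bar> \<le> e" using d by blast
          then have "\<bar>(\<phi> y - \<phi> t) / (y - t) - D\<bar> * \<bar>y - t\<bar> \<le> e * \<bar>y - t\<bar>"
            by (intro mult_right_mono) auto
          moreover have "\<bar>(\<phi> y - \<phi> t) / (y - t) - D\<bar> * \<bar>y - t\<bar> = \<bar>\<phi> y - \<phi> t - D * (y - t)\<bar>"
          proof -
            have "(\<phi> y - \<phi> t) / (y - t) * (y - t) = \<phi> y - \<phi> t" using False by simp
            then have "((\<phi> y - \<phi> t) / (y - t) - D) * (y - t) = \<phi> y - \<phi> t - D * (y - t)"
              by (simp only: left_diff_distrib)
            then show ?thesis by (simp only: abs_mult[symmetric])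
          qed
          ultimately show ?thesis by simp
        qed simp
      qed (use d in simp)
    qed
    then show ?thesis unfolding differentiable_def by blast
  qed
  show ?thesis
    by (rule negligible_subset[OF negl]) (use diff in blast)
qed

text \<open>Adding \<open>L * t\<close> makes an \<open>L\<close>-Lipschitz function increasing and
  does not affect differentiability.\<close>

lemma lipschitz_real_differentiable_ae:
  fixes \<phi> :: "real \<Rightarrow> real"
  assumes lip: "L-lipschitz_on UNIV \<phi>"
  shows "negligible {t. \<not> \<phi> differentiable at t}"
proof -
  have L: "\<bar>\<phi> v - \<phi> u\<bar> \<le> L * \<bar>v - u\<bar>" for u v
    using lipschitz_onD[OF lip, of v u] by (simp add: dist_real_def)
  have L0: "0 \<le> L" using lip lipschitz_on_nonneg by blast
  define \<psi> where "\<psi> t = \<phi> t + L * t" for t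
  have "mono \<psi>"
  proof (rule monoI)
    fix u v :: real assume "u \<le> v"
    then show "\<psi> u \<le> \<psi> v" using L[of v u] by (simp add: \<psi>_def algebra_simps)
  qed
  moreover have "(2 * L)-lipschitz_on UNIV \<psi>"
  proof (rule lipschitz_onI)
    fix u v :: real
    have "\<bar>\<psi> u - \<psi> v\<bar> \<le> \<bar>\<phi> u - \<phi> v\<bar> + L * \<bar>u - v\<bar>"
    proof -
      have "\<psi> u - \<psi> v = (\<phi> u - \<phi> v) + L * (u - v)"
        by (simp add: \<psi>_def algebra_simps)
      then have "\<bar>\<psi> u - \<psi> v\<bar> \<le> \<bar>\<phi> u - \<phi> v\<bar> + \<bar>L * (u - v)\<bar>"
        by simp
      then show ?thesis using L0 by (simp add: abs_mult)
    qed
    then show "dist (\<psi> u) (\<psi> v) \<le> 2 * L * dist u v"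
      using L[of u v] by (simp add: dist_real_def)
  qed (use L0 in simp)
  ultimately have "negligible {t. \<not> \<psi> differentiable at t}"
    by (rule lipschitz_mono_real_differentiable_ae)
  moreover have "\<phi> differentiable at t" if "\<psi> differentiable at t" for t
  proof -
    have "(\<lambda>t. \<psi> t - L * t) differentiable at t"
      using that by (intro derivative_intros) auto
    then show ?thesis by (simp add: \<psi>_def[abs_def])
  qed
  ultimately show ?thesis by (auto elim!: negligible_subset)
qed

section \<open>From lines to several variables\<close>

text \<open>Fubini for the pairs (x, t) with \<open>x + t *\<^sub>R v\<close> in \<open>B\<close>:
  the sections at fixed \<open>x\<close> are null, while every section at fixed \<open>t\<close> is
  a translate of \<open>B\<close>. A constant whose integral over the line is 0 must be 0. This way
  no coordinates adapted to \<open>v\<close> enter.\<close>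

lemma negligible_if_null_along_direction:
  fixes B :: "'a::euclidean_space set"
  assumes B: "B \<in> sets borel" and null: "\<And>x. negligible {t::real. x + t *\<^sub>R v \<in> B}"
  shows "negligible B"
proof -
  define P where "P = (\<lambda>z::'a \<times> real. fst z + snd z *\<^sub>R v) -` B"
  have "(\<lambda>z::'a \<times> real. fst z + snd z *\<^sub>R v) \<in> borel_measurable borel"
    by (intro borel_measurable_continuous_onI continuous_intros)
  then have P: "P \<in> sets (lborel \<Otimes>\<^sub>M lborel)"
    using measurable_sets[of _ borel borel B] B unfolding P_def lborel_prod by simp
  have sect: "emeasure lborel (Pair x -` P) = 0" for x
  proof -
    have "Pair x -` P = {t. x + t *\<^sub>R v \<in> B}" by (auto simp: P_def)
    moreover have "Pair x -` P \<in> sets lborel"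
      using P by (rule sets_Pair1)
    ultimately show ?thesis
      using null[of x] by (simp add: negligible_iff_null_sets null_sets_def emeasure_completion)
  qed
  have "emeasure lborel {x. x + t *\<^sub>R v \<in> B} = emeasure lborel B" for t :: real
  proof -
    have "emeasure lborel B = emeasure (distr lborel borel ((+) (t *\<^sub>R v))) B"
      by (simp add: lborel_distr_plus)
    also have "\<dots> = emeasure lborel ((+) (t *\<^sub>R v) -` B \<inter> space lborel)"
      using B by (intro emeasure_distr) auto
    also have "(+) (t *\<^sub>R v) -` B \<inter> space lborel = {x. x + t *\<^sub>R v \<in> B}"
      by (auto simp: add.commute)
    finally show ?thesis by simp
  qed
  then have sect2: "emeasure lborel ((\<lambda>x. (x, t)) -` P) = emeasure lborel B" for t
    by (simp add: P_def vimage_def)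
  have "0 = emeasure (lborel \<Otimes>\<^sub>M lborel) P"
    using lborel.emeasure_pair_measure_alt[OF P] by (simp add: sect)
  also have "\<dots> = (\<integral>\<^sup>+t. emeasure lborel B \<partial>(lborel::real measure))"
    using lborel_pair.emeasure_pair_measure_alt2[OF P] by (simp add: sect2)
  also have "\<dots> = emeasure lborel B * \<infinity>"
    by simp
  finally have "emeasure lborel B = 0"
    by (metis ennreal_mult_eq_top_iff infinity_ennreal_def zero_neq_one ennreal_zero_neq_top)
  then show ?thesis
    using B by (simp add: negligible_iff_null_sets null_sets_def emeasure_completion)
qed

text \<open>On each line parallel to \<open>v\<close> the one-variable theorem applies. What has to
  be added is that the exceptional set is Borel, as Fubini requires.\<close>

lemma lipschitz_directional_derivative_ae:
  fixes f :: "'a::euclidean_space \<Rightarrow> real"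
  assumes lip: "L-lipschitz_on UNIV f"
  shows "negligible {x. \<not> (\<lambda>t. f (x + t *\<^sub>R v)) differentiable at 0}"
proof -
  have contf: "continuous_on UNIV f"
    using lip lipschitz_on_continuous_on by blast
  define q where "q x t = (f (x + t *\<^sub>R v) - f x) / t" for x t
  \<comment> \<open>Cauchy criterion for the difference quotients with tolerance 1 / (j + 1) at
    scale 1 / (k + 1). It does not mention the limit, and intersecting over uncountably many
    \<open>s\<close> and \<open>t\<close> is harmless because each condition is closed.\<close>
  define G where "G j k = (\<Inter>s\<in>{s. 0 < \<bar>s\<bar> \<and> \<bar>s\<bar> < 1 / real (Suc k)}. \<Inter>t\<in>{t. 0 < \<bar>t\<bar> \<and> \<bar>t\<bar> < 1 / real (Suc k)}.
      {x. \<bar>q x s - q x t\<bar> \<le> 1 / real (Suc j)})" for j k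
  have "closed {x. \<bar>q x s - q x t\<bar> \<le> c}" if "s \<noteq> 0" "t \<noteq> 0" for s t c
    unfolding q_def using that
    by (intro closed_Collect_le continuous_intros continuous_on_compose2[OF contf]) auto
  then have "closed (G j k)" for j k
    unfolding G_def by (intro closed_INT ballI) auto
  then have "(\<Inter>j. \<Union>k. G j k) \<in> sets borel"
    by (intro sets.countable_INT sets.countable_UN) auto
  then have B: "- (\<Inter>j. \<Union>k. G j k) \<in> sets borel" by (rule borel_comp)
  have G_iff: "x \<in> (\<Inter>j. \<Union>k. G j k) \<longleftrightarrow> (\<lambda>t. f (x + t *\<^sub>R v)) differentiable at 0" for x
  proof
    assume "(\<lambda>t. f (x + t *\<^sub>R v)) differentiable at 0"
    then obtain D where "((\<lambda>t. f (x + t *\<^sub>R v)) has_real_derivative D) (at 0)"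
      by (auto simp: real_differentiable_def)
    then have lim: "(q x \<longlongrightarrow> D) (at 0)"
      by (simp add: DERIV_def q_def[abs_def])
    show "x \<in> (\<Inter>j. \<Union>k. G j k)"
    proof (intro INT_I)
      fix j :: nat
      have "0 < 1 / real (Suc j) / 2" by simp
      then have "\<forall>\<^sub>F t in at 0. dist (q x t) D < 1 / real (Suc j) / 2"
        using tendstoD[OF lim] by blast
      then obtain d where d: "0 < d" "\<And>t. t \<noteq> 0 \<Longrightarrow> dist t 0 < d \<Longrightarrow> dist (q x t) D < 1 / real (Suc j) / 2"
        unfolding eventually_at by blast
      obtain k where k: "1 / real (Suc k) < d"
        using d(1) nat_approx_posE by metis
      have "x \<in> G j k"
        unfolding G_def
      proof (intro INT_I, rule CollectI)
        fix s t assume "s \<in> {s. 0 < \<bar>s\<bar> \<and> \<bar>s\<bar> < 1 / real (Suc k)}" "t \<in> {s. 0 < \<bar>s\<bar> \<and> \<bar>s\<bar> < 1 / real (Suc k)}"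
        then have "dist (q x s) D < 1 / real (Suc j) / 2" "dist (q x t) D < 1 / real (Suc j) / 2"
          using k by (intro d(2); simp)+
        moreover have "\<bar>a - b\<bar> \<le> c" if "\<bar>a - d\<bar> < c / 2" "\<bar>b - d\<bar> < c / 2" for a b c d :: real
          using that by linarith
        ultimately show "\<bar>q x s - q x t\<bar> \<le> 1 / real (Suc j)"
          unfolding dist_real_def by blast
      qed
      then show "x \<in> (\<Union>k. G j k)" by blast
    qed
  next
    assume xG: "x \<in> (\<Inter>j. \<Union>k. G j k)"
    have cau: "\<exists>d>0. \<forall>s t. 0 < \<bar>s\<bar> \<and> \<bar>s\<bar> < d \<and> 0 < \<bar>t\<bar> \<and> \<bar>t\<bar> < d \<longrightarrow> \<bar>q x s - q x t\<bar> \<le> e" if "0 < e" for e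
    proof -
      obtain j where j: "1 / real (Suc j) < e"
        using \<open>0 < e\<close> nat_approx_posE by metis
      obtain k where k: "x \<in> G j k" using xG by blast
      show ?thesis
      proof (intro exI[of _ "1 / real (Suc k)"] conjI allI impI)
        fix s t assume "0 < \<bar>s\<bar> \<and> \<bar>s\<bar> < 1 / real (Suc k) \<and> 0 < \<bar>t\<bar> \<and> \<bar>t\<bar> < 1 / real (Suc k)"
        then have "\<bar>q x s - q x t\<bar> \<le> 1 / real (Suc j)" using k unfolding G_def by blast
        then show "\<bar>q x s - q x t\<bar> \<le> e" using j by linarith
      qed simp
    qed
    \<comment> \<open>The sequence only produces the limit; convergence of the quotient along all
      \<open>t\<close> then follows from \<open>cau\<close>.\<close>
    define X where "X n = q x (1 / real (Suc n))" for n
    have "Cauchy X"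
    proof (rule metric_CauchyI)
      fix e :: real assume "0 < e"
      then obtain d where d: "0 < d" "\<And>s t. 0 < \<bar>s\<bar> \<and> \<bar>s\<bar> < d \<and> 0 < \<bar>t\<bar> \<and> \<bar>t\<bar> < d \<Longrightarrow> \<bar>q x s - q x t\<bar> \<le> e / 2"
        using cau[of "e/2"] by auto
      obtain N where N: "1 / real (Suc N) < d"
        using d(1) nat_approx_posE by metis
      have sm: "\<bar>1 / real (Suc n)\<bar> < d" if "n \<ge> N" for n
      proof -
        have "1 / real (Suc n) \<le> 1 / real (Suc N)" using that by (simp add: frac_le)
        then show ?thesis using N by simp
      qed
      show "\<exists>M. \<forall>m\<ge>M. \<forall>n\<ge>M. dist (X m) (X n) < e"
      proof (intro exI[of _ N] allI impI)
        fix m n assume "N \<le> m" "N \<le> n"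
        then have "\<bar>X m - X n\<bar> \<le> e / 2"
          unfolding X_def using sm by (intro d(2)) auto
        then show "dist (X m) (X n) < e" using \<open>0 < e\<close> by (simp add: dist_real_def)
      qed
    qed
    then obtain D where D: "X \<longlonglongrightarrow> D"
      using real_Cauchy_convergent convergent_def by blast
    have "(q x \<longlongrightarrow> D) (at 0)"
    proof (rule tendstoI)
      fix e :: real assume "0 < e"
      then obtain d where d: "0 < d" "\<And>s t. 0 < \<bar>s\<bar> \<and> \<bar>s\<bar> < d \<and> 0 < \<bar>t\<bar> \<and> \<bar>t\<bar> < d \<Longrightarrow> \<bar>q x s - q x t\<bar> \<le> e / 2"
        using cau[of "e/2"] by auto
      have "\<bar>q x t - D\<bar> \<le> e / 2" if t: "t \<noteq> 0" "\<bar>t\<bar> < d" for t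
      proof (rule LIMSEQ_le_const2)
        show "(\<lambda>n. \<bar>q x t - X n\<bar>) \<longlonglongrightarrow> \<bar>q x t - D\<bar>"
          by (intro tendsto_intros D)
        obtain N where N: "1 / real (Suc N) < d"
          using d(1) nat_approx_posE by metis
        show "\<exists>N. \<forall>n\<ge>N. \<bar>q x t - X n\<bar> \<le> e / 2"
        proof (intro exI[of _ N] allI impI)
          fix n assume "N \<le> n"
          then have "1 / real (Suc n) \<le> 1 / real (Suc N)" by (simp add: frac_le)
          then have "\<bar>1 / real (Suc n)\<bar> < d" using N by simp
          then show "\<bar>q x t - X n\<bar> \<le> e / 2" unfolding X_def using t by (intro d(2)) auto
        qed
      qed
      then have "dist (q x t) D < e" if "t \<noteq> 0" "dist t 0 < d" for t
        using \<open>0 < e\<close> that by (fastforce simp: dist_real_def)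
      then show "\<forall>\<^sub>F t in at 0. dist (q x t) D < e"
        unfolding eventually_at using d(1) by blast
    qed
    then have "((\<lambda>t. f (x + t *\<^sub>R v)) has_real_derivative D) (at 0)"
      by (simp add: DERIV_def q_def[abs_def])
    then show "(\<lambda>t. f (x + t *\<^sub>R v)) differentiable at 0"
      by (auto simp: real_differentiable_def)
  qed
  have "negligible (- (\<Inter>j. \<Union>k. G j k))"
  proof (rule negligible_if_null_along_direction[OF B])
    fix x
    have L0: "0 \<le> L" using lip lipschitz_on_nonneg by blast
    have "(L * norm v)-lipschitz_on UNIV (\<lambda>t. f (x + t *\<^sub>R v))"
    proof (rule lipschitz_onI)
      fix s t :: real
      have "dist (f (x + s *\<^sub>R v)) (f (x + t *\<^sub>R v)) \<le> L * dist (x + s *\<^sub>R v) (x + t *\<^sub>R v)"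
        by (rule lipschitz_onD[OF lip]) auto
      also have "dist (x + s *\<^sub>R v) (x + t *\<^sub>R v) = norm v * dist s t"
        by (simp add: dist_norm flip: scaleR_diff_left)
      finally show "dist (f (x + s *\<^sub>R v)) (f (x + t *\<^sub>R v)) \<le> L * norm v * dist s t" by simp
    qed (use L0 in simp)
    then have "negligible {t. \<not> (\<lambda>t. f (x + t *\<^sub>R v)) differentiable at t}"
      by (rule lipschitz_real_differentiable_ae)
    moreover have "{t. x + t *\<^sub>R v \<in> - (\<Inter>j. \<Union>k. G j k)} \<subseteq> {t. \<not> (\<lambda>t. f (x + t *\<^sub>R v)) differentiable at t}"
    proof (intro subsetI CollectI notI)
      fix t assume t: "t \<in> {t. x + t *\<^sub>R v \<in> - (\<Inter>j. \<Union>k. G j k)}"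
        and d: "(\<lambda>t. f (x + t *\<^sub>R v)) differentiable at t"
      have "((\<lambda>t. f (x + t *\<^sub>R v)) \<circ> (\<lambda>s. t + s)) differentiable at 0"
        by (rule differentiable_chain_at) (use d in \<open>auto intro!: derivative_intros\<close>)
      then have "(\<lambda>s. f ((x + t *\<^sub>R v) + s *\<^sub>R v)) differentiable at 0"
        by (simp add: o_def algebra_simps)
      then show False using t G_iff by blast
    qed
    ultimately show "negligible {t. x + t *\<^sub>R v \<in> - (\<Inter>j. \<Union>k. G j k)}"
      by (rule negligible_subset)
  qed
  moreover have "- (\<Inter>j. \<Union>k. G j k) = {x. \<not> (\<lambda>t. f (x + t *\<^sub>R v)) differentiable at 0}"
    using G_iff by blast
  ultimately show ?thesis by simp
qed

lemma negligible_countable_UN: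
  "countable I \<Longrightarrow> (\<And>i. i \<in> I \<Longrightarrow> negligible (F i)) \<Longrightarrow> negligible (\<Union>i\<in>I. F i)"
  by (rule negligible_countable_Union) auto

text \<open>\<open>S y \<epsilon> k\<close> consists of the points where the partial derivatives are \<open>\<epsilon>\<close>-close to \<open>y\<close> at scales below \<open>1 / (k + 1)\<close>.
  Outside its porous part \<open>Por\<close> there are points of \<open>S y \<epsilon> k\<close> near every corner of a short coordinate path, so the
  increments along the path add up to the linear prediction.\<close>

lemma lipschitz_real_valued_differentiable_ae:
  fixes f :: "'a::euclidean_space \<Rightarrow> real"
  assumes lip: "L-lipschitz_on UNIV f"
  shows "negligible {x. \<not> f differentiable at x}"
proof -
  define n where "n = real DIM('a)"
  have n: "1 \<le> n" by (simp add: n_def)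
  have L: "\<bar>f x - f y\<bar> \<le> L * norm (x - y)" for x y
    using lipschitz_onD[OF lip, of x y] by (simp add: dist_norm)
  have L0: "0 \<le> L" using lip lipschitz_on_nonneg by blast
  define S where "S y \<epsilon> k = {x. \<forall>b\<in>Basis. \<forall>t. \<bar>t\<bar> < 1 / real (Suc k) \<longrightarrow>
      \<bar>f (x + t *\<^sub>R b) - f x - t * (y \<bullet> b)\<bar> \<le> \<epsilon> * \<bar>t\<bar>}" for y :: 'a and \<epsilon> :: real and k :: nat
  \<comment> \<open>The corner of a coordinate path from \<open>x\<close> to \<open>x + u\<close>
    that is reached after the directions in \<open>F\<close>.\<close>
  define w where "w x u F = x + (\<Sum>b\<in>F. (u \<bullet> b) *\<^sub>R b)" for x u :: 'a and F
  define Por where "Por y \<epsilon> k M = {x \<in> S y \<epsilon> k. norm x < M \<and> (\<forall>d>0. \<exists>u F. 0 < norm u \<and> norm u < d \<and>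
      F \<subseteq> Basis \<and> ball (w x u F) (\<epsilon> * norm u) \<inter> S y \<epsilon> k = {})}" for y \<epsilon> k and M :: real
  have wx: "norm (w x u F - x) \<le> n * norm u" if F: "F \<subseteq> Basis" for x u F
  proof -
    have "norm (w x u F - x) \<le> (\<Sum>b\<in>F. norm ((u \<bullet> b) *\<^sub>R b))"
      unfolding w_def by (simp only: add_diff_cancel_left' norm_sum)
    also have "\<dots> \<le> (\<Sum>b\<in>F. norm u)"
      using F by (intro sum_mono) (auto simp: subset_iff Basis_le_norm)
    also have "\<dots> \<le> n * norm u"
      using F by (simp add: n_def mult_right_mono card_mono)
    finally show ?thesis .
  qed
  have porous: "negligible (Por y \<epsilon> k M)" if e: "0 < \<epsilon>" for y \<epsilon> k M
  proof (rule negligible_porous)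
    show "bounded (Por y \<epsilon> k M)"
      by (rule bounded_subset[of "ball 0 M"]) (auto simp: Por_def)
    \<comment> \<open>A corner is at distance at most \<open>n * norm u\<close> from
      \<open>x\<close>, so the ball of radius \<open>(n + \<epsilon>) * norm u\<close> about
      \<open>x\<close> contains the hole. Halving the radius of the open hole makes room for a
      closed one.\<close>
    show "0 < \<epsilon> / 2 / (n + \<epsilon>)" using e n by simp
    fix x and d :: real assume x: "x \<in> Por y \<epsilon> k M" and d: "0 < d"
    then have "0 < d / (n + \<epsilon>)" using e n by simp
    then obtain u F where u: "0 < norm u" "norm u < d / (n + \<epsilon>)" "F \<subseteq> Basis"
        "ball (w x u F) (\<epsilon> * norm u) \<inter> S y \<epsilon> k = {}"
      using x unfolding Por_def by blast
    define r where "r = (n + \<epsilon>) * norm u"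
    have r: "0 < r" "r < d"
      using u e n by (auto simp: r_def pos_less_divide_eq mult.commute)
    have eq: "\<epsilon> / 2 / (n + \<epsilon>) * r = \<epsilon> / 2 * norm u"
    proof -
      have gen: "\<epsilon> / 2 / c * (c * z) = \<epsilon> / 2 * z" if "c \<noteq> 0" for c z
        using that by simp
      have "n + \<epsilon> \<noteq> 0" using e n by simp
      then show ?thesis unfolding r_def by (rule gen)
    qed
    have "cball (w x u F) (\<epsilon> / 2 * norm u) \<subseteq> cball x r"
    proof
      fix z assume "z \<in> cball (w x u F) (\<epsilon> / 2 * norm u)"
      then have "norm (w x u F - z) \<le> \<epsilon> / 2 * norm u" by (simp add: dist_norm)
      moreover have "norm (x - z) \<le> norm (w x u F - x) + norm (w x u F - z)"
        using norm_triangle_ineq4[of "w x u F - z" "w x u F - x"] by simp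
      ultimately have "norm (x - z) \<le> n * norm u + \<epsilon> / 2 * norm u" using wx[OF u(3), of x u] by linarith
      also have "\<dots> \<le> r" using e by (simp add: r_def algebra_simps)
      finally show "z \<in> cball x r" by (simp add: dist_norm)
    qed
    moreover have "cball (w x u F) (\<epsilon> / 2 * norm u) \<subseteq> ball (w x u F) (\<epsilon> * norm u)"
    proof -
      have "\<epsilon> / 2 * norm u < \<epsilon> * norm u" using e u(1) by simp
      then show ?thesis by auto
    qed
    moreover have "Por y \<epsilon> k M \<subseteq> S y \<epsilon> k"
      unfolding Por_def by (rule Collect_restrict)
    ultimately have "cball (w x u F) (\<epsilon> / 2 * norm u) \<subseteq> cball x r"
      "cball (w x u F) (\<epsilon> / 2 * norm u) \<inter> Por y \<epsilon> k M = {}"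
      using u(4) by blast+
    then show "\<exists>z r a. 0 < r \<and> r < d \<and> x \<in> cball z r \<and>
        cball a (\<epsilon> / 2 / (n + \<epsilon>) * r) \<subseteq> cball z r \<and> cball a (\<epsilon> / 2 / (n + \<epsilon>) * r) \<inter> Por y \<epsilon> k M = {}"
      apply (rule_tac exI[of _ x], rule_tac exI[of _ r], rule_tac exI[of _ "w x u F"])
      unfolding eq using r by simp
  qed
  \<comment> \<open>The exceptional sets of all candidate gradients are united, so only countably
    many candidates are allowed; the vector of partial derivatives is approximated by one of
    them.\<close>
  obtain Q :: "'a set" where Q: "countable Q" "\<And>X. open X \<Longrightarrow> X \<noteq> {} \<Longrightarrow> \<exists>d\<in>Q. d \<in> X"
    by (erule countable_dense_setE)
  define e where "e j = 1 / real (Suc j)" for j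
  define N1 where "N1 = (\<Union>y\<in>Q. \<Union>j. \<Union>k. \<Union>M. Por y (e j) k (real M))"
  define N2 where "N2 = (\<Union>b\<in>Basis. {x. \<not> (\<lambda>t. f (x + t *\<^sub>R b)) differentiable at 0})"
  have "negligible N1"
  proof -
    have "negligible (Por y (e j) k (real M))" for y j k M
      by (rule porous) (simp add: e_def)
    then show ?thesis
      unfolding N1_def using Q(1) by (intro negligible_countable_UN) simp_all
  qed
  moreover have "negligible N2"
    unfolding N2_def using lipschitz_directional_derivative_ae[OF lip]
    by (intro negligible_countable_UN countable_finite[OF finite_Basis])
  moreover have "f differentiable at x" if x: "x \<notin> N1 \<union> N2" for x
  proof -
    have "\<forall>b\<in>Basis. \<exists>D. ((\<lambda>t. f (x + t *\<^sub>R b)) has_real_derivative D) (at 0)"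
      using x unfolding N2_def by (auto simp: real_differentiable_def)
    then obtain D where D: "\<And>b. b \<in> Basis \<Longrightarrow> ((\<lambda>t. f (x + t *\<^sub>R b)) has_real_derivative D b) (at 0)"
      by metis
    define g where "g = (\<Sum>b\<in>Basis. D b *\<^sub>R b)"
    have gb: "g \<bullet> b = D b" if "b \<in> Basis" for b
      using that by (simp add: g_def inner_sum_left_Basis)
    have key: "\<exists>d>0. \<forall>u. norm u < d \<longrightarrow> \<bar>f (x + u) - f x - g \<bullet> u\<bar> \<le> (n * (1 + 2 * L) + 1) * e j * norm u" for j
    proof -
      have ej: "0 < e j" by (simp add: e_def)
      obtain y where y: "y \<in> Q" "y \<in> ball g (e j / 2)"
        using Q(2)[of "ball g (e j / 2)"] ej by auto
      have yb: "\<bar>y \<bullet> b - D b\<bar> \<le> e j / 2" if "b \<in> Basis" for b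
      proof -
        have "\<bar>(y - g) \<bullet> b\<bar> \<le> norm (y - g)" using that by (rule Basis_le_norm)
        then show ?thesis using y(2) gb[OF that] by (simp add: inner_diff_left dist_norm norm_minus_commute)
      qed
      have "\<forall>b\<in>Basis. \<forall>\<^sub>F t in at 0. \<bar>f (x + t *\<^sub>R b) - f x - t * D b\<bar> \<le> e j / 2 * \<bar>t\<bar>"
      proof
        fix b :: 'a assume b: "b \<in> Basis"
        have "((\<lambda>t. f (x + t *\<^sub>R b)) has_derivative (\<lambda>t. D b * t)) (at 0)"
          using D[OF b] by (simp add: has_field_derivative_def)
        from this[unfolded has_derivative_at_alt, THEN conjunct2, rule_format, of "e j / 2"] ej
        obtain d where d: "0 < d" "\<forall>t. \<bar>t\<bar> < d \<longrightarrow> \<bar>f (x + t *\<^sub>R b) - f x - D b * t\<bar> \<le> e j / 2 * \<bar>t\<bar>"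
          by auto
        show "\<forall>\<^sub>F t in at 0. \<bar>f (x + t *\<^sub>R b) - f x - t * D b\<bar> \<le> e j / 2 * \<bar>t\<bar>"
          unfolding eventually_at
        proof (intro exI[of _ d] conjI ballI impI)
          fix t :: real assume "t \<noteq> 0 \<and> dist t 0 < d"
          then have "\<bar>t\<bar> < d" by simp
          then show "\<bar>f (x + t *\<^sub>R b) - f x - t * D b\<bar> \<le> e j / 2 * \<bar>t\<bar>"
            using d(2) by (simp add: mult.commute)
        qed (rule d(1))
      qed
      then have "\<forall>\<^sub>F t in at 0. \<forall>b\<in>Basis. \<bar>f (x + t *\<^sub>R b) - f x - t * D b\<bar> \<le> e j / 2 * \<bar>t\<bar>"
        by (intro eventually_ball_finite) auto
      then have "\<exists>d>0. \<forall>t. t \<noteq> 0 \<and> \<bar>t\<bar> < d \<longrightarrow> (\<forall>b\<in>Basis. \<bar>f (x + t *\<^sub>R b) - f x - t * D b\<bar> \<le> e j / 2 * \<bar>t\<bar>)"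
        unfolding eventually_at by simp
      then obtain d where d: "0 < d" "\<And>t b. \<lbrakk>t \<noteq> 0; \<bar>t\<bar> < d; b \<in> Basis\<rbrakk> \<Longrightarrow> \<bar>f (x + t *\<^sub>R b) - f x - t * D b\<bar> \<le> e j / 2 * \<bar>t\<bar>"
        by blast
      obtain k where k: "1 / real (Suc k) < d"
        using d(1) nat_approx_posE by metis
      have xS: "x \<in> S y (e j) k"
        unfolding S_def
      proof (intro CollectI ballI allI impI)
        fix b t assume b: "b \<in> (Basis::'a set)" and t: "\<bar>t\<bar> < 1 / real (Suc k)"
        show "\<bar>f (x + t *\<^sub>R b) - f x - t * (y \<bullet> b)\<bar> \<le> e j * \<bar>t\<bar>"
        proof (cases "t = 0")
          case False
          have "\<bar>f (x + t *\<^sub>R b) - f x - t * D b\<bar> \<le> e j / 2 * \<bar>t\<bar>"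
            using d(2)[of t b] False t k b by linarith
          moreover have "\<bar>t * (y \<bullet> b) - t * D b\<bar> \<le> e j / 2 * \<bar>t\<bar>"
            using mult_right_mono[OF yb[OF b], of "\<bar>t\<bar>"] by (simp add: abs_mult[symmetric] algebra_simps)
          ultimately show ?thesis by linarith
        qed simp
      qed
      obtain M where M: "norm x < real M" using reals_Archimedean2 by blast
      have "\<forall>y\<in>Q. \<forall>j k M. x \<notin> Por y (e j) k (real M)" using x by (simp add: N1_def)
      then have "x \<notin> Por y (e j) k (real M)" using y(1) by blast
      then have "\<not> (\<forall>d>0. \<exists>u F. 0 < norm u \<and> norm u < d \<and> F \<subseteq> Basis \<and> ball (w x u F) (e j * norm u) \<inter> S y (e j) k = {})"
        using xS M by (simp add: Por_def)
      then obtain d' where d': "0 < d'" "\<And>u F. \<lbrakk>0 < norm u; norm u < d'; F \<subseteq> Basis\<rbrakk> \<Longrightarrow>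
          ball (w x u F) (e j * norm u) \<inter> S y (e j) k \<noteq> {}"
        by blast
      \<comment> \<open>The increment along an edge is borrowed from a point \<open>a\<close> of
        \<open>S\<close> near the corner \<open>p\<close>: an error \<open>e j * norm u\<close> at
        \<open>a\<close>, and \<open>L * (e j * norm u)\<close> for moving each end of the edge.
        This is the factor \<open>1 + 2 * L\<close>.\<close>
      have step: "\<bar>f (w x u F) - f x - (\<Sum>b\<in>F. (u \<bullet> b) * (y \<bullet> b))\<bar> \<le> real (card F) * ((1 + 2 * L) * e j * norm u)"
        if u: "0 < norm u" "norm u < d'" "norm u < 1 / real (Suc k)" and "finite F" "F \<subseteq> Basis" for u F
        using that(4,5)
      proof (induction F)
        case empty then show ?case by (simp add: w_def)
      next
        case (insert b F)
        define p where "p = w x u F"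
        define t where "t = u \<bullet> b"
        have b: "b \<in> Basis" using insert by simp
        have pb: "w x u (insert b F) = p + t *\<^sub>R b"
          using insert by (simp add: w_def p_def t_def add_ac)
        obtain a where a: "norm (p - a) < e j * norm u" "a \<in> S y (e j) k"
          using d'(2)[OF u(1,2), of F] insert by (auto simp: p_def dist_norm)
        have tu: "\<bar>t\<bar> \<le> norm u" unfolding t_def by (rule Basis_le_norm[OF b])
        have "\<bar>f (a + t *\<^sub>R b) - f a - t * (y \<bullet> b)\<bar> \<le> e j * \<bar>t\<bar>"
          using a(2) b tu u(3) unfolding S_def by force
        also have "\<dots> \<le> e j * norm u" using tu ej by (intro mult_left_mono) auto
        finally have 1: "\<bar>f (a + t *\<^sub>R b) - f a - t * (y \<bullet> b)\<bar> \<le> e j * norm u" .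
        have Lp: "L * norm (p - a) \<le> L * (e j * norm u)"
          using a(1) L0 by (intro mult_left_mono) auto
        have 2: "\<bar>f p - f a\<bar> \<le> L * (e j * norm u)"
          using L[of p a] Lp by linarith
        have 3: "\<bar>f (p + t *\<^sub>R b) - f (a + t *\<^sub>R b)\<bar> \<le> L * (e j * norm u)"
          using L[of "p + t *\<^sub>R b" "a + t *\<^sub>R b"] Lp by simp
        have IH: "\<bar>f p - f x - (\<Sum>b\<in>F. (u \<bullet> b) * (y \<bullet> b))\<bar> \<le> real (card F) * ((1 + 2 * L) * e j * norm u)"
          unfolding p_def using insert by simp
        have eq: "(\<Sum>b\<in>insert b F. (u \<bullet> b) * (y \<bullet> b)) = t * (y \<bullet> b) + (\<Sum>b\<in>F. (u \<bullet> b) * (y \<bullet> b))"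
          using insert by (simp add: t_def)
        have eq2: "real (card (insert b F)) * ((1 + 2 * L) * e j * norm u) =
            real (card F) * ((1 + 2 * L) * e j * norm u) + (e j * norm u + 2 * (L * (e j * norm u)))"
          using insert by (simp add: algebra_simps)
        show ?case unfolding pb eq eq2 using 1 2 3 IH by linarith
      qed
      show ?thesis
      proof (intro exI[of _ "min d' (1 / real (Suc k))"] conjI allI impI)
        fix u :: 'a assume u: "norm u < min d' (1 / real (Suc k))"
        show "\<bar>f (x + u) - f x - g \<bullet> u\<bar> \<le> (n * (1 + 2 * L) + 1) * e j * norm u"
        proof (cases "u = 0")
          case False
          have "w x u Basis = x + u" by (simp add: w_def euclidean_representation)
          moreover have "(\<Sum>b\<in>Basis. (u \<bullet> b) * (y \<bullet> b)) = y \<bullet> u"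
            by (subst inner_commute[of y u], subst euclidean_inner[of u y]) (rule refl)
          ultimately have "\<bar>f (x + u) - f x - y \<bullet> u\<bar> \<le> n * ((1 + 2 * L) * e j * norm u)"
            using step[of u Basis] u False unfolding n_def by simp
          moreover have "\<bar>y \<bullet> u - g \<bullet> u\<bar> \<le> e j * norm u"
          proof -
            have "\<bar>(y - g) \<bullet> u\<bar> \<le> norm (y - g) * norm u" by (rule Cauchy_Schwarz_ineq2)
            also have "\<dots> \<le> e j * norm u"
              using y(2) ej by (intro mult_right_mono) (auto simp: dist_norm norm_minus_commute)
            finally show ?thesis by (simp add: inner_diff_left)
          qed
          ultimately show ?thesis by (simp add: algebra_simps)
        qed simp
      qed (use d' in simp)
    qed
    have "(f has_derivative (\<lambda>u. g \<bullet> u)) (at x)"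
      unfolding has_derivative_at_alt
    proof (intro conjI allI impI)
      show "bounded_linear (\<lambda>u. g \<bullet> u)" by (rule bounded_linear_inner_right)
      fix \<epsilon> :: real assume eps: "0 < \<epsilon>"
      define c where "c = n * (1 + 2 * L) + 1"
      have c: "0 < c" using n L0 by (simp add: c_def add_nonneg_pos)
      then have "0 < \<epsilon> / c" using eps by simp
      then obtain j where j: "e j < \<epsilon> / c"
        unfolding e_def using nat_approx_posE by metis
      have ce: "c * e j \<le> \<epsilon>" using j c by (simp add: pos_less_divide_eq mult.commute)
      obtain d where d: "0 < d" "\<And>u. norm u < d \<Longrightarrow> \<bar>f (x + u) - f x - g \<bullet> u\<bar> \<le> c * e j * norm u"
        using key[of j] unfolding c_def by blast
      show "\<exists>d>0. \<forall>y. norm (y - x) < d \<longrightarrow> norm (f y - f x - g \<bullet> (y - x)) \<le> \<epsilon> * norm (y - x)"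
      proof (intro exI[of _ d] conjI allI impI)
        fix y assume "norm (y - x) < d"
        then have "\<bar>f (x + (y - x)) - f x - g \<bullet> (y - x)\<bar> \<le> c * e j * norm (y - x)" by (rule d(2))
        also have "\<dots> \<le> \<epsilon> * norm (y - x)" by (intro mult_right_mono ce) auto
        finally show "norm (f y - f x - g \<bullet> (y - x)) \<le> \<epsilon> * norm (y - x)" by simp
      qed (rule d(1))
    qed
    then show ?thesis unfolding differentiable_def by blast
  qed
  ultimately have *: "negligible (N1 \<union> N2)" "\<And>x. x \<notin> N1 \<union> N2 \<Longrightarrow> f differentiable at x"
    by (simp_all only: negligible_Un)
  show ?thesis
    by (rule negligible_subset[OF *(1)]) (use *(2) in blast)
qed

theorem rademacher:
  fixes f :: "'a::euclidean_space \<Rightarrow> 'b::euclidean_space"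
  assumes lip: "L-lipschitz_on UNIV f"
  shows "negligible {x. \<not> f differentiable at x}"
proof -
  have "L-lipschitz_on UNIV (\<lambda>x. f x \<bullet> b)" if b: "b \<in> Basis" for b
  proof (rule lipschitz_onI)
    fix x y
    have "\<bar>(f x - f y) \<bullet> b\<bar> \<le> norm (f x - f y)" using b by (rule Basis_le_norm)
    also have "\<dots> \<le> L * dist x y" using lipschitz_onD[OF lip, of x y] by (simp add: dist_norm)
    finally show "dist (f x \<bullet> b) (f y \<bullet> b) \<le> L * dist x y" by (simp add: dist_real_def inner_diff_left)
  qed (use lip lipschitz_on_nonneg in blast)
  then have "negligible (\<Union>b\<in>Basis. {x. \<not> (\<lambda>x. f x \<bullet> b) differentiable at x})"
    by (intro negligible_countable_UN countable_finite[OF finite_Basis]) (rule lipschitz_real_valued_differentiable_ae)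
  moreover have "{x. \<not> f differentiable at x} \<subseteq> (\<Union>b\<in>Basis. {x. \<not> (\<lambda>x. f x \<bullet> b) differentiable at x})"
  proof
    fix x assume "x \<in> {x. \<not> f differentiable at x}"
    then have "\<not> (\<forall>b\<in>Basis. (\<lambda>x. f x \<bullet> b) differentiable at x)"
      using differentiable_componentwise_within[of f x UNIV] by (metis mem_Collect_eq)
    then show "x \<in> (\<Union>b\<in>Basis. {x. \<not> (\<lambda>x. f x \<bullet> b) differentiable at x})"
      by (simp only: UN_iff mem_Collect_eq) blast
  qed
  ultimately show ?thesis by (rule negligible_subset)
qed

section \<open>Lifting through the Hopf map\<close>

text \<open>The Hopf map without normalisation. It is quadratic on all pairs of complex numbers and
  squares norms, so that closeness of a value to the origin can be read off from its lift.\<close>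

definition hopf :: "complex \<times> complex \<Rightarrow> complex \<times> real" where
  "hopf p = (2 * fst p * cnj (snd p), (cmod (fst p))\<^sup>2 - (cmod (snd p))\<^sup>2)"

lemma norm_hopf: "norm (hopf p) = (norm p)\<^sup>2"
proof -
  obtain z w where p: "p = (z, w)" by (metis surj_pair)
  have "(norm (hopf p))\<^sup>2 = (cmod (2 * z * cnj w))\<^sup>2 + ((cmod z)\<^sup>2 - (cmod w)\<^sup>2)\<^sup>2"
    unfolding p hopf_def by (simp add: norm_Pair del: norm_mult)
  also have "\<dots> = ((cmod z)\<^sup>2 + (cmod w)\<^sup>2)\<^sup>2"
    by (simp add: norm_mult power_mult_distrib power2_eq_square algebra_simps)
  also have "(cmod z)\<^sup>2 + (cmod w)\<^sup>2 = (norm p)\<^sup>2"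
    unfolding p by (simp add: norm_Pair)
  finally show ?thesis by (metis norm_ge_zero power2_eq_imp_eq zero_le_power2)
qed

lemma hopf_eq_0_iff [simp]: "hopf p = 0 \<longleftrightarrow> p = 0"
  using norm_hopf[of p] by (metis norm_eq_zero power_eq_0_iff power_zero_numeral)

lemma hopf_rotate:
  assumes "cmod l = 1"
  shows "hopf (l * fst p, l * snd p) = hopf p"
proof -
  have "l * cnj l = 1" using assms by (simp add: complex_norm_square[symmetric])
  then have "2 * (l * fst p) * cnj (l * snd p) = 2 * fst p * cnj (snd p)"
  proof -
    have "2 * (l * fst p) * cnj (l * snd p) = (l * cnj l) * (2 * fst p * cnj (snd p))"
      by (simp add: mult_ac)
    then show ?thesis using \<open>l * cnj l = 1\<close> by simp
  qed
  then show ?thesis using assms by (simp add: hopf_def norm_mult)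
qed

lemma hopf_scaleR: "hopf (t *\<^sub>R p) = t\<^sup>2 *\<^sub>R hopf p"
  by (simp add: hopf_def scaleR_conv_of_real[where 'a=complex] power2_eq_square norm_mult algebra_simps)

text \<open>The Hermitian product of \<open>p'\<close> and \<open>p\<close>, normalised to be the
  phase between two points of one Hopf fibre.\<close>

definition hopf_phase :: "complex \<times> complex \<Rightarrow> complex \<times> complex \<Rightarrow> complex" where
  "hopf_phase p p' = (fst p' * cnj (fst p) + snd p' * cnj (snd p)) / of_real ((norm p)\<^sup>2)"

text \<open>Equal Hopf values give equal moduli of both coordinates and equal mixed products
  \<open>z * cnj w\<close>; substituting these into the Hermitian product returns
  \<open>p'\<close>.\<close>

lemma hopf_phase:
  assumes eq: "hopf p' = hopf p" and "p \<noteq> 0"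
  shows "p' = (hopf_phase p p' * fst p, hopf_phase p p' * snd p)" "cmod (hopf_phase p p') = 1"
proof -
  obtain z w where p: "p = (z, w)" by (metis surj_pair)
  obtain z' w' where p': "p' = (z', w')" by (metis surj_pair)
  have S: "(norm p)\<^sup>2 = (cmod z)\<^sup>2 + (cmod w)\<^sup>2" unfolding p by (simp add: norm_Pair)
  have S': "(norm p')\<^sup>2 = (cmod z')\<^sup>2 + (cmod w')\<^sup>2" unfolding p' by (simp add: norm_Pair)
  have S0: "(norm p)\<^sup>2 \<noteq> 0" using assms(2) by simp
  have "(norm p')\<^sup>2 = (norm p)\<^sup>2" using eq norm_hopf by metis
  moreover have "(cmod z')\<^sup>2 - (cmod w')\<^sup>2 = (cmod z)\<^sup>2 - (cmod w)\<^sup>2" and zw: "z' * cnj w' = z * cnj w"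
    using eq by (auto simp: hopf_def p p')
  ultimately have zz: "(cmod z')\<^sup>2 = (cmod z)\<^sup>2" "(cmod w')\<^sup>2 = (cmod w)\<^sup>2"
    unfolding S S' by linarith+
  have zz': "z' * cnj z' = z * cnj z" "w' * cnj w' = w * cnj w"
    using zz by (simp_all flip: complex_norm_square)
  have wz: "w' * cnj z' = w * cnj z" using arg_cong[OF zw, of cnj] by (simp add: mult.commute)
  have Sc: "of_real ((norm p)\<^sup>2) = z * cnj z + w * cnj w"
    unfolding S of_real_add complex_norm_square ..
  have "(z' * cnj z + w' * cnj w) * z = z' * (z * cnj z) + w' * (z * cnj w)"
    by (simp add: algebra_simps)
  also have "\<dots> = z' * (z * cnj z + w * cnj w)"
    unfolding zw[symmetric] zz'(2)[symmetric] by (simp add: algebra_simps)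
  finally have 1: "hopf_phase p p' * z = z'"
    using S0 unfolding hopf_phase_def Sc[symmetric] p p' by (simp add: divide_simps)
  have "(z' * cnj z + w' * cnj w) * w = z' * (w * cnj z) + w' * (w * cnj w)"
    by (simp add: algebra_simps)
  also have "\<dots> = w' * (z * cnj z + w * cnj w)"
    unfolding wz[symmetric] zz'(1)[symmetric] by (simp add: algebra_simps)
  finally have 2: "hopf_phase p p' * w = w'"
    using S0 unfolding hopf_phase_def Sc[symmetric] p p' by (simp add: divide_simps)
  show "p' = (hopf_phase p p' * fst p, hopf_phase p p' * snd p)"
    using 1 2 by (simp add: p p')
  have "(norm p')\<^sup>2 = (cmod (hopf_phase p p'))\<^sup>2 * (norm p)\<^sup>2"
    unfolding S S' 1[symmetric] 2[symmetric] by (simp add: norm_mult power_mult_distrib algebra_simps p p')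
  then have "(cmod (hopf_phase p p'))\<^sup>2 = 1"
    using \<open>(norm p')\<^sup>2 = (norm p)\<^sup>2\<close> S0 by simp
  then show "cmod (hopf_phase p p') = 1" by (metis abs_norm_cancel power2_eq_1_iff abs_neg_one abs_one)
qed

text \<open>Up to the factor \<open>2 * norm v\<close> this is the orthogonal projection onto the complex line that
  \<^const>\<open>hopf\<close> maps to the ray through \<open>v\<close>.\<close>

definition hopf_proj :: "complex \<times> real \<Rightarrow> complex \<times> complex \<Rightarrow> complex \<times> complex" where
  "hopf_proj v p = (of_real (norm v + snd v) * fst p + fst v * snd p,
                    cnj (fst v) * fst p + of_real (norm v - snd v) * snd p)"

text \<open>The Hermitian product of \<open>p\<close> with \<open>hopf_proj v p\<close>. For nonzero
  \<open>v\<close> it vanishes exactly when \<open>p\<close> is orthogonal to the line over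
  \<open>v\<close>, the case in which \<open>p\<close> cannot single out a lift.\<close>

definition hopf_weight :: "complex \<times> real \<Rightarrow> complex \<times> complex \<Rightarrow> real" where
  "hopf_weight v p = norm v * (p \<bullet> p) + v \<bullet> hopf p"

text \<open>The point nearest to the guide \<open>p\<close> on the circle of lifts of
  \<open>v\<close>. Choosing it by projection keeps it continuous and differentiable in
  \<open>v\<close> and \<open>p\<close> where the weight is positive.\<close>

definition hopf_lift :: "complex \<times> real \<Rightarrow> complex \<times> complex \<Rightarrow> complex \<times> complex" where
  "hopf_lift v p = (1 / sqrt (2 * hopf_weight v p)) *\<^sub>R hopf_proj v p"

text \<open>\<open>hopf_proj v\<close> is \<open>norm v\<close> plus the traceless Hermitian matrix
  that belongs to \<open>v\<close>, whose square is the scalar \<open>(norm v)\<^sup>2\<close>. Its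
  values are eigenvectors for \<open>norm v\<close>, and these have Hopf values along
  \<open>v\<close>; the computation determines the factor.\<close>

lemma hopf_hopf_proj: "hopf (hopf_proj v p) = (2 * hopf_weight v p) *\<^sub>R v"
proof -
  obtain \<zeta> s where v: "v = (\<zeta>, s)" by (metis surj_pair)
  obtain z w where p: "p = (z, w)" by (metis surj_pair)
  define r where "r = norm v"
  have rr: "r\<^sup>2 = (cmod \<zeta>)\<^sup>2 + s\<^sup>2" unfolding r_def v by (simp add: norm_Pair)
  have rrc: "(of_real r)\<^sup>2 - (of_real s)\<^sup>2 = \<zeta> * cnj \<zeta>"
    using arg_cong[OF rr, of complex_of_real] by (simp add: complex_norm_square[symmetric])
  define W where "W = hopf_weight v p"
  define t where "t = Re (cnj \<zeta> * (z * cnj w))"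
  have Wt: "W = (r + s) * (cmod z)\<^sup>2 + (r - s) * (cmod w)\<^sup>2 + 2 * t"
  proof -
    have pp: "p \<bullet> p = (cmod z)\<^sup>2 + (cmod w)\<^sup>2"
      by (simp add: p power2_norm_eq_inner)
    have "v \<bullet> hopf p = s * ((cmod z)\<^sup>2 - (cmod w)\<^sup>2) + 2 * t"
      unfolding v p hopf_def t_def by (simp add: inner_complex_def algebra_simps)
    then show ?thesis unfolding W_def hopf_weight_def r_def[symmetric] pp
      by (simp add: algebra_simps)
  qed
  have tc: "complex_of_real (2 * t) = cnj \<zeta> * (z * cnj w) + \<zeta> * (cnj z * w)"
    unfolding t_def by (simp add: complex_eq_iff algebra_simps)
  have Wc: "complex_of_real W = of_real (r + s) * (z * cnj z) + of_real (r - s) * (w * cnj w)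
      + (cnj \<zeta> * (z * cnj w) + \<zeta> * (cnj z * w))"
    unfolding Wt of_real_add of_real_mult tc[symmetric] complex_norm_square[symmetric] by simp
  define a where "a = of_real (r + s) * z + \<zeta> * w"
  define b where "b = cnj \<zeta> * z + of_real (r - s) * w"
  have ab: "hopf_proj v p = (a, b)" by (simp add: hopf_proj_def a_def b_def v p r_def)
  have "a * cnj b = of_real (r + s) * \<zeta> * (z * cnj z) + ((of_real r)\<^sup>2 - (of_real s)\<^sup>2) * (z * cnj w)
      + \<zeta> * \<zeta> * (cnj z * w) + \<zeta> * of_real (r - s) * (w * cnj w)"
    unfolding a_def b_def by (simp add: power2_eq_square algebra_simps)
  also have "\<dots> = \<zeta> * of_real W"
    unfolding rrc Wc by (simp add: algebra_simps)
  finally have 1: "2 * a * cnj b = of_real (2 * W) * \<zeta>" by simp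
  have n2: "(cmod x)\<^sup>2 = Re (x * cnj x)" for x by (simp add: complex_norm_square[symmetric])
  have "a * cnj a - b * cnj b = ((of_real (r + s))\<^sup>2 - \<zeta> * cnj \<zeta>) * (z * cnj z)
     + (\<zeta> * cnj \<zeta> - (of_real (r - s))\<^sup>2) * (w * cnj w)
     + 2 * of_real s * (cnj \<zeta> * (z * cnj w) + \<zeta> * (cnj z * w))"
    unfolding a_def b_def by (simp add: power2_eq_square algebra_simps)
  also have "\<dots> = 2 * of_real s * of_real W"
    unfolding rrc[symmetric] Wc by (simp add: power2_eq_square algebra_simps)
  finally have "Re (a * cnj a - b * cnj b) = Re (of_real (2 * s * W))" by simp
  then have 2: "(cmod a)\<^sup>2 - (cmod b)\<^sup>2 = 2 * W * s" unfolding n2 by simp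
  show ?thesis
    unfolding ab hopf_def W_def[symmetric] using 1 2
    by (simp add: scaleR_conv_of_real v)
qed

lemma hopf_hopf_lift:
  assumes "0 < hopf_weight v p"
  shows "hopf (hopf_lift v p) = v"
  using assms unfolding hopf_lift_def hopf_scaleR hopf_hopf_proj by (simp add: power_divide)

text \<open>A displacement shorter than \<open>norm u\<close> keeps the angle with \<open>u\<close>
  acute, so a lift of \<open>u\<close> can still guide a lift of \<open>v\<close>. This is the step
  size for continuing lifts.\<close>

lemma hopf_weight_pos:
  assumes "hopf p = u" "norm (v - u) < norm u"
  shows "0 < hopf_weight v p"
proof -
  have "(norm (v - u))\<^sup>2 < (norm u)\<^sup>2" using assms(2) by (simp add: power_strict_mono)
  moreover have "(norm (v - u))\<^sup>2 = (norm v)\<^sup>2 + (norm u)\<^sup>2 - 2 * (v \<bullet> u)"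
    by (simp add: power2_norm_eq_inner inner_diff_left inner_diff_right inner_commute)
  ultimately have "0 < v \<bullet> u" by (smt (verit) zero_le_power2)
  then show ?thesis
    unfolding hopf_weight_def assms(1) by (simp add: add_nonneg_pos)
qed

text \<open>The weights of the two coordinate vectors add up to \<open>2 * norm v\<close>, so one of
  them can be the guide.\<close>

lemma surj_hopf: "\<exists>p. hopf p = v"
proof (cases "v = 0")
  case False
  have "hopf_weight v (1, 0) = norm v + snd v" "hopf_weight v (0, 1) = norm v - snd v"
    by (simp_all add: hopf_weight_def hopf_def inner_prod_def)
  then have "0 < hopf_weight v (1, 0) \<or> 0 < hopf_weight v (0, 1)"
    using False by (smt (verit) zero_less_norm_iff)
  then show ?thesis using hopf_hopf_lift by blast
qed (auto intro: exI[of _ 0])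

lemma continuous_on_hopf [continuous_intros]:
  "continuous_on S F \<Longrightarrow> continuous_on S (\<lambda>x. hopf (F x))"
  unfolding hopf_def by (intro continuous_intros)

lemma continuous_on_hopf_lift:
  assumes "continuous_on S v" "continuous_on S F" "\<And>x. x \<in> S \<Longrightarrow> 0 < hopf_weight (v x) (F x)"
  shows "continuous_on S (\<lambda>x. hopf_lift (v x) (F x))"
proof -
  have "sqrt (2 * hopf_weight (v x) (F x)) \<noteq> 0" if "x \<in> S" for x
    using assms(3)[OF that] by simp
  then show ?thesis
    unfolding hopf_lift_def hopf_proj_def
    by (intro continuous_intros assms(1,2)) (auto simp: hopf_weight_def intro!: continuous_intros assms(1,2))
qed

section \<open>Sets over which nonvanishing maps lift\<close>

definition hopf_liftable :: "'a::topological_space set \<Rightarrow> bool" where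
  "hopf_liftable S \<longleftrightarrow> (\<forall>v. continuous_on S v \<and> (\<forall>x\<in>S. v x \<noteq> 0) \<longrightarrow>
     (\<exists>F. continuous_on S F \<and> (\<forall>x\<in>S. hopf (F x) = v x)))"

text \<open>On the intersection the two lifts differ by a continuous phase. There it has a
  continuous real argument, which Tietze extends over \<open>T\<close>; rotating the lift on
  \<open>T\<close> by it makes the lifts agree.\<close>

lemma hopf_liftable_Un:
  fixes S T :: "'a::euclidean_space set"
  assumes "closed S" "closed T" "hopf_liftable S" "hopf_liftable T" "Borsukian (S \<inter> T)"
  shows "hopf_liftable (S \<union> T)"
  unfolding hopf_liftable_def
proof (intro allI impI)
  fix v :: "'a \<Rightarrow> complex \<times> real" assume v: "continuous_on (S \<union> T) v \<and> (\<forall>x\<in>S \<union> T. v x \<noteq> 0)"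
  then have "continuous_on S v" "continuous_on T v" using continuous_on_subset by blast+
  then obtain FS FT where FS: "continuous_on S FS" "\<And>x. x \<in> S \<Longrightarrow> hopf (FS x) = v x"
    and FT: "continuous_on T FT" "\<And>x. x \<in> T \<Longrightarrow> hopf (FT x) = v x"
    using assms(3,4) v unfolding hopf_liftable_def by (metis UnI1 UnI2)
  define l where "l x = hopf_phase (FT x) (FS x)" for x
  have FT0: "FT x \<noteq> 0" if "x \<in> T" for x
    using FT(2)[OF that] v that by (metis UnI2 hopf_eq_0_iff)
  have FSl: "FS x = (l x * fst (FT x), l x * snd (FT x))" "cmod (l x) = 1" if "x \<in> S \<inter> T" for x
    using hopf_phase[of "FS x" "FT x"] FS(2)[of x] FT(2)[of x] FT0[of x] that unfolding l_def by auto
  have cST: "continuous_on (S \<inter> T) FS" "continuous_on (S \<inter> T) FT"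
    using FS(1) FT(1) continuous_on_subset by blast+
  have "continuous_on (S \<inter> T) l"
    unfolding l_def hopf_phase_def by (intro continuous_intros cST) (use FT0 in auto)
  then obtain g where g: "continuous_on (S \<inter> T) (complex_of_real \<circ> g)" "\<And>x. x \<in> S \<inter> T \<Longrightarrow> l x = exp (\<i> * of_real (g x))"
    using assms(5) FSl(2) unfolding Borsukian_continuous_logarithm_circle_real by (auto simp: Pi_iff)
  have "continuous_on (S \<inter> T) (\<lambda>x. Re ((complex_of_real \<circ> g) x))" by (intro continuous_intros g(1))
  then have cg: "continuous_on (S \<inter> T) g" by simp
  have "closedin (top_of_set T) (S \<inter> T)" using closedin_closed_Int[OF assms(1), of T] by (simp add: Int_commute)
  then obtain G where G: "continuous_on T G" "\<And>x. x \<in> S \<inter> T \<Longrightarrow> G x = g x"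
    using Tietze_unbounded[OF cg] by blast
  define F where "F x = (if x \<in> S then FS x else (exp (\<i> * of_real (G x)) * fst (FT x), exp (\<i> * of_real (G x)) * snd (FT x)))" for x
  have "continuous_on (S \<union> T) F"
    unfolding F_def
  proof (rule continuous_on_cases[OF assms(1,2) FS(1)])
    show "continuous_on T (\<lambda>x. (exp (\<i> * of_real (G x)) * fst (FT x), exp (\<i> * of_real (G x)) * snd (FT x)))"
      by (intro continuous_intros G FT)
    show "\<forall>x. x \<in> S \<and> x \<notin> S \<or> x \<in> T \<and> x \<in> S \<longrightarrow>
        FS x = (exp (\<i> * of_real (G x)) * fst (FT x), exp (\<i> * of_real (G x)) * snd (FT x))"
      using FSl(1) g(2) G(2) by (metis IntI)
  qed
  moreover have "hopf (F x) = v x" if "x \<in> S \<union> T" for x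
    using that FS(2) FT(2) hopf_rotate[of "exp (\<i> * of_real (G x))" "FT x"] by (auto simp: F_def)
  ultimately show "\<exists>F. continuous_on (S \<union> T) F \<and> (\<forall>x\<in>S \<union> T. hopf (F x) = v x)" by blast
qed

text \<open>Time is cut into steps in which \<open>H\<close> moves by less than its smallest norm
  \<open>m\<close>; the lift at one time then guides the lift at the next.\<close>

lemma hopf_lift_homotopy:
  fixes H :: "real \<times> 'a::euclidean_space \<Rightarrow> complex \<times> real"
  assumes "compact X" and H: "continuous_on ({0..1} \<times> X) H" "\<And>t x. t \<in> {0..1} \<Longrightarrow> x \<in> X \<Longrightarrow> H (t, x) \<noteq> 0"
    and F0: "continuous_on X F0" "\<And>x. x \<in> X \<Longrightarrow> hopf (F0 x) = H (0, x)"
  shows "\<exists>F. continuous_on X F \<and> (\<forall>x\<in>X. hopf (F x) = H (1, x))"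
proof (cases "X = {}")
  case False
  have comp: "compact ({0..1::real} \<times> X)" using assms(1) by (simp add: compact_Times)
  have ne: "{0..1::real} \<times> X \<noteq> {}" using False by simp
  have "continuous_on ({0..1} \<times> X) (\<lambda>y. norm (H y))" by (intro continuous_intros H(1))
  then obtain y0 where y0: "y0 \<in> {0..1} \<times> X" "\<And>y. y \<in> {0..1} \<times> X \<Longrightarrow> norm (H y0) \<le> norm (H y)"
    using continuous_attains_inf[OF comp ne] by blast
  define m where "m = norm (H y0)"
  have m: "0 < m" using y0(1) H(2) by (auto simp: m_def)
  obtain \<delta> where \<delta>: "0 < \<delta>" "\<And>y y'. y \<in> {0..1} \<times> X \<Longrightarrow> y' \<in> {0..1} \<times> X \<Longrightarrow> dist y' y < \<delta> \<Longrightarrow> dist (H y') (H y) < m"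
    using compact_uniformly_continuous[OF H(1) comp] m unfolding uniformly_continuous_on_def by metis
  obtain n where n: "1 / real (Suc n) < \<delta>" using nat_approx_posE[OF \<delta>(1)] by blast
  define N where "N = Suc n"
  have "k \<le> N \<Longrightarrow> \<exists>F. continuous_on X F \<and> (\<forall>x\<in>X. hopf (F x) = H (real k / real N, x))" for k
  proof (induction k)
    case 0
    then show ?case using F0 by auto
  next
    case (Suc k)
    then obtain F where F: "continuous_on X F" "\<And>x. x \<in> X \<Longrightarrow> hopf (F x) = H (real k / real N, x)" by auto
    define v where "v x = H (real (Suc k) / real N, x)" for x
    have in01: "real k / real N \<in> {0..1}" "real (Suc k) / real N \<in> {0..1}"
      using Suc.prems by (auto simp: N_def divide_simps)
    have cv: "continuous_on X v"
      unfolding v_def using in01 by (intro continuous_on_compose2[OF H(1)] continuous_intros) auto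
    have pos: "0 < hopf_weight (v x) (F x)" if x: "x \<in> X" for x
    proof (rule hopf_weight_pos[OF F(2)[OF x]])
      have "dist (real (Suc k) / real N, x) (real k / real N, x) = 1 / real N"
      proof -
        have "real (Suc k) / real N - real k / real N = 1 / real N" by (simp add: diff_divide_distrib[symmetric])
        then show ?thesis by (simp add: dist_prod_def dist_real_def)
      qed
      then have "dist (v x) (H (real k / real N, x)) < m"
        unfolding v_def using in01 x n by (intro \<delta>(2)) (auto simp: N_def)
      also have "m \<le> norm (H (real k / real N, x))" unfolding m_def using in01 x by (intro y0(2)) auto
      finally show "norm (v x - H (real k / real N, x)) < norm (H (real k / real N, x))" by (simp add: dist_norm)
    qed
    have "continuous_on X (\<lambda>x. hopf_lift (v x) (F x))"
      by (rule continuous_on_hopf_lift[OF cv F(1) pos])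
    moreover have "\<forall>x\<in>X. hopf (hopf_lift (v x) (F x)) = H (real (Suc k) / real N, x)"
      using hopf_hopf_lift[OF pos] unfolding v_def by blast
    ultimately show ?case by blast
  qed
  from this[of N] show ?thesis by (simp add: N_def)
qed auto

text \<open>Contracting \<open>X\<close> to \<open>x0\<close> gives a homotopy from a constant,
  which lifts, to \<open>v\<close>.\<close>

lemma hopf_liftable_convex:
  fixes X :: "'a::euclidean_space set"
  assumes "convex X" "compact X"
  shows "hopf_liftable X"
  unfolding hopf_liftable_def
proof (intro allI impI)
  fix v :: "'a \<Rightarrow> complex \<times> real" assume v: "continuous_on X v \<and> (\<forall>x\<in>X. v x \<noteq> 0)"
  show "\<exists>F. continuous_on X F \<and> (\<forall>x\<in>X. hopf (F x) = v x)"
  proof (cases "X = {}")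
    case False
    then obtain x0 where x0: "x0 \<in> X" by blast
    have inX: "x0 + t *\<^sub>R (x - x0) \<in> X" if "t \<in> {0..1}" "x \<in> X" for t x
      using convexD[OF assms(1) x0 that(2), of "1 - t" t] that(1) by (simp add: algebra_simps)
    obtain p where p: "hopf p = v x0" using surj_hopf by blast
    define H where "H y = v (x0 + fst y *\<^sub>R (snd y - x0))" for y
    have "\<exists>F. continuous_on X F \<and> (\<forall>x\<in>X. hopf (F x) = H (1, x))"
    proof (rule hopf_lift_homotopy[OF assms(2)])
      show "continuous_on ({0..1} \<times> X) H"
        unfolding H_def
      proof (rule continuous_on_compose2[of X v])
        show "(\<lambda>y. x0 + fst y *\<^sub>R (snd y - x0)) ` ({0..1} \<times> X) \<subseteq> X" using inX by auto
        show "continuous_on ({0..1} \<times> X) (\<lambda>y. x0 + fst y *\<^sub>R (snd y - x0))"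
          by (intro continuous_intros)
      qed (use v in blast)
      show "H (t, x) \<noteq> 0" if "t \<in> {0..1}" "x \<in> X" for t x
        using v inX[OF that] by (simp add: H_def)
      show "continuous_on X (\<lambda>x. p)" by simp
    qed (simp add: H_def p)
    then show ?thesis by (simp add: H_def)
  qed auto
qed

lemma homeomorphic_hopf_liftable:
  assumes "S homeomorphic T" "hopf_liftable S"
  shows "hopf_liftable T"
  unfolding hopf_liftable_def
proof (intro allI impI)
  fix v assume v: "continuous_on T v \<and> (\<forall>x\<in>T. v x \<noteq> (0 :: complex \<times> real))"
  obtain f g where fg: "homeomorphism S T f g" using assms(1) homeomorphic_def by blast
  have cf: "continuous_on S f" "f ` S = T" and cg: "continuous_on T g" "g ` T = S" and f: "\<And>y. y \<in> T \<Longrightarrow> f (g y) = y"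
    using fg by (auto simp: homeomorphism_def)
  have "continuous_on S (\<lambda>x. v (f x))"
    by (rule continuous_on_compose2[of T v]) (use v cf in auto)
  moreover have "\<forall>x\<in>S. v (f x) \<noteq> 0" using v cf by blast
  ultimately obtain F where F: "continuous_on S F" "\<And>x. x \<in> S \<Longrightarrow> hopf (F x) = v (f x)"
    using assms(2)[unfolded hopf_liftable_def, rule_format, of "\<lambda>x. v (f x)"] by blast
  have "continuous_on T (\<lambda>y. F (g y))" by (rule continuous_on_compose2[OF F(1) cg(1)]) (use cg in auto)
  moreover have "\<forall>y\<in>T. hopf (F (g y)) = v y" using F(2) cg f by (metis image_eqI)
  ultimately show "\<exists>F. continuous_on T F \<and> (\<forall>x\<in>T. hopf (F x) = v x)" by blast
qed

text \<open>The closed hemispheres are balls, and they meet in an equator of dimension at least 2,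
  on which phases have no winding. With a three-dimensional \<open>'c\<close> this covers the
  frontier of a four-dimensional box.\<close>

lemma hopf_liftable_sphere:
  assumes "3 \<le> DIM('c)"
  shows "hopf_liftable (sphere (0 :: 'c::euclidean_space \<times> real) 1)"
proof -
  define S where "S \<sigma> = {z :: 'c \<times> real. norm z = 1 \<and> 0 \<le> \<sigma> * snd z}" for \<sigma> :: real
  have n1: "norm z = 1 \<longleftrightarrow> (norm (fst z))\<^sup>2 + (snd z)\<^sup>2 = 1" for z :: "'c \<times> real"
    by (simp add: norm_prod_def)
  have hom: "S \<sigma> homeomorphic cball (0::'c) 1" if \<sigma>: "\<sigma> = 1 \<or> \<sigma> = -1" for \<sigma>
    unfolding homeomorphic_def homeomorphism_def
  proof (intro exI[of _ fst] exI[of _ "\<lambda>p. (p, \<sigma> * sqrt (1 - (norm p)\<^sup>2))"] conjI ballI)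
    have inv: "(p, \<sigma> * sqrt (1 - (norm p)\<^sup>2)) \<in> S \<sigma>" if "norm p \<le> 1" for p :: 'c
      using \<sigma> that power_le_one[of "norm p" 2] by (auto simp: S_def n1 power_mult_distrib)
    have le: "norm (fst z) \<le> 1" if "z \<in> S \<sigma>" for z
      using that norm_fst_le[of "fst z" "snd z"] by (simp add: S_def)
    show bck: "(fst z, \<sigma> * sqrt (1 - (norm (fst z))\<^sup>2)) = z" if "z \<in> S \<sigma>" for z
    proof -
      have "1 - (norm (fst z))\<^sup>2 = (snd z)\<^sup>2" "0 \<le> \<sigma> * snd z" using that by (auto simp: S_def n1)
      then have "\<sigma> * sqrt (1 - (norm (fst z))\<^sup>2) = snd z" using \<sigma> by auto
      then show ?thesis by (metis prod.collapse)
    qed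
    show "fst ` S \<sigma> = cball 0 1"
      using inv le by (force simp: image_iff)
    show "(\<lambda>p. (p, \<sigma> * sqrt (1 - (norm p)\<^sup>2))) ` cball 0 1 = S \<sigma>"
      using inv le bck by (force simp: image_iff)
  qed (auto intro!: continuous_intros)
  have lift: "hopf_liftable (S \<sigma>)" if "\<sigma> = 1 \<or> \<sigma> = -1" for \<sigma>
    using hom[OF that] homeomorphic_hopf_liftable hopf_liftable_convex[of "cball (0::'c) 1"] homeomorphic_sym by (metis compact_cball convex_cball)
  have "S 1 \<inter> S (-1) = (\<lambda>p. (p, 0)) ` sphere (0::'c) 1"
  proof (intro equalityI subsetI)
    fix z assume z: "z \<in> S 1 \<inter> S (-1)"
    then have "snd z = 0" "(norm (fst z))\<^sup>2 = 1" by (auto simp: S_def n1)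
    then have "norm (fst z) = 1" by (intro power2_eq_imp_eq[of _ 1]) simp_all
    then show "z \<in> (\<lambda>p. (p, 0)) ` sphere (0::'c) 1"
      using \<open>snd z = 0\<close> by (intro image_eqI[of _ _ "fst z"]) (auto simp: prod_eq_iff)
  qed (auto simp: S_def norm_Pair)
  moreover have "linear (\<lambda>p::'c. (p, 0::real))" "inj (\<lambda>p::'c. (p, 0::real))"
    by (auto simp: linear_iff inj_on_def)
  ultimately have "Borsukian (S 1 \<inter> S (-1))"
    using Borsukian_sphere[OF assms, of 0 1] Borsukian_injective_linear_image by metis
  moreover have "closed (S \<sigma>)" for \<sigma>
    unfolding S_def by (intro closed_Collect_conj closed_Collect_eq closed_Collect_le continuous_intros)
  ultimately have "hopf_liftable (S 1 \<union> S (-1))"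
    by (intro hopf_liftable_Un lift) auto
  moreover have "S 1 \<union> S (-1) = sphere 0 1"
    by (auto simp: S_def)
  ultimately show ?thesis by simp
qed

lemma homeomorphic_frontier_cbox_sphere:
  fixes a b :: "'a::euclidean_space" and c :: "'b::euclidean_space"
  assumes "DIM('a) = DIM('b)" "box a b \<noteq> {}"
  shows "frontier (cbox a b) homeomorphic sphere c 1"
proof -
  have ne: "interior (cbox a b) \<noteq> {}" using assms(2) by (simp add: interior_cbox)
  have "rel_frontier (cbox a b) homeomorphic rel_frontier (cball c 1)"
    using assms(1) ne
    by (intro homeomorphic_rel_frontiers_convex_bounded_sets) (auto simp: aff_dim_nonempty_interior aff_dim_cball)
  moreover have "rel_frontier (cbox a b) = frontier (cbox a b)"
    using ne by (simp add: rel_frontier_def rel_interior_nonempty_interior frontier_def)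
  moreover have "rel_frontier (cball c 1) = sphere c 1"
    by (simp add: rel_frontier_cball)
  ultimately show ?thesis by simp
qed

section \<open>Degenerate points and fibres\<close>

text \<open>Derivative-free form of the condition that the differential takes values in the
  hyperplane orthogonal to \<open>\<nu>\<close>. With tolerance and scale fixed it is a closed
  condition.\<close>

definition flat_set :: "('a::euclidean_space \<Rightarrow> 'b::euclidean_space) \<Rightarrow> real \<Rightarrow> real \<Rightarrow> 'a set" where
  "flat_set h \<epsilon> \<delta> = {x. \<exists>\<nu>. norm \<nu> = 1 \<and>
     (\<forall>y. norm (y - x) < \<delta> \<longrightarrow> \<bar>\<nu> \<bullet> (h y - h x)\<bar> \<le> \<epsilon> * norm (y - x))}"

text \<open>Stated for all points, differentiable or not, and therefore visibly Borel.\<close>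

definition degenerate_set :: "('a::euclidean_space \<Rightarrow> 'b::euclidean_space) \<Rightarrow> 'a set" where
  "degenerate_set h = (\<Inter>j. \<Union>k. flat_set h (1 / real (Suc j)) (1 / real (Suc k)))"

text \<open>By compactness the unit normals subconverge. Since the scale condition is strict, a
  point satisfying it at the limit satisfies it for all large indices.\<close>

lemma closed_flat_set:
  assumes h: "continuous_on UNIV h"
  shows "closed (flat_set h \<epsilon> \<delta>)"
  unfolding closed_sequential_limits
proof (intro allI impI)
  fix X x assume X: "(\<forall>n. X n \<in> flat_set h \<epsilon> \<delta>) \<and> X \<longlonglongrightarrow> x"
  then have "\<forall>n. \<exists>\<nu>. norm \<nu> = 1 \<and> (\<forall>y. norm (y - X n) < \<delta> \<longrightarrow> \<bar>\<nu> \<bullet> (h y - h (X n))\<bar> \<le> \<epsilon> * norm (y - X n))"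
    unfolding flat_set_def by blast
  then obtain \<nu> where \<nu>: "\<And>n. norm (\<nu> n) = 1"
    "\<And>n y. norm (y - X n) < \<delta> \<Longrightarrow> \<bar>\<nu> n \<bullet> (h y - h (X n))\<bar> \<le> \<epsilon> * norm (y - X n)"
    by metis
  obtain l r where l: "l \<in> sphere 0 1" and r: "strict_mono r" "(\<nu> \<circ> r) \<longlonglongrightarrow> l"
    using compact_sphere[of 0 1] \<nu>(1) unfolding compact_def by (metis mem_sphere_0)
  have Xr: "(X \<circ> r) \<longlonglongrightarrow> x"
    using X r(1) LIMSEQ_subseq_LIMSEQ by blast
  have hX: "(\<lambda>n. h ((X \<circ> r) n)) \<longlonglongrightarrow> h x"
    using continuous_on_tendsto_compose[OF h Xr] by simp
  have "\<bar>l \<bullet> (h y - h x)\<bar> \<le> \<epsilon> * norm (y - x)" if y: "norm (y - x) < \<delta>" for y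
  proof (rule tendsto_le[OF sequentially_bot])
    show "(\<lambda>n. \<epsilon> * norm (y - (X \<circ> r) n)) \<longlonglongrightarrow> \<epsilon> * norm (y - x)"
      by (intro tendsto_intros Xr)
    show "(\<lambda>n. \<bar>(\<nu> \<circ> r) n \<bullet> (h y - h ((X \<circ> r) n))\<bar>) \<longlonglongrightarrow> \<bar>l \<bullet> (h y - h x)\<bar>"
      by (intro tendsto_intros r hX)
    have "(\<lambda>n. norm (y - (X \<circ> r) n)) \<longlonglongrightarrow> norm (y - x)"
      by (intro tendsto_intros Xr)
    then have "\<forall>\<^sub>F n in sequentially. norm (y - (X \<circ> r) n) < \<delta>"
      using y by (rule order_tendstoD(2))
    then show "\<forall>\<^sub>F n in sequentially. \<bar>(\<nu> \<circ> r) n \<bullet> (h y - h ((X \<circ> r) n))\<bar> \<le> \<epsilon> * norm (y - (X \<circ> r) n)"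
      by eventually_elim (simp add: \<nu>(2))
  qed
  then show "x \<in> flat_set h \<epsilon> \<delta>"
    using l unfolding flat_set_def by auto
qed

lemma borel_degenerate_set:
  assumes "continuous_on UNIV h"
  shows "degenerate_set h \<in> sets borel"
  unfolding degenerate_set_def
  by (intro sets.countable_INT sets.countable_UN) (auto simp: closed_flat_set[OF assms])

lemma flat_set_mono: "\<delta>' \<le> \<delta> \<Longrightarrow> flat_set h \<epsilon> \<delta> \<subseteq> flat_set h \<epsilon> \<delta>'"
  unfolding flat_set_def by fastforce

text \<open>If the differential has a right inverse of bound \<open>K\<close>, moving along a
  preimage of \<open>\<nu>\<close> makes \<open>h\<close> grow in the direction \<open>\<nu>\<close>
  at a rate of about 1 / K, against flatness. If it is not onto, a unit normal to its range serves
  for every tolerance.\<close>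

lemma degenerate_set_iff:
  assumes D: "(h has_derivative D) (at x)"
  shows "x \<in> degenerate_set h \<longleftrightarrow> range D \<noteq> UNIV"
proof
  have lin: "linear D" using D by (rule has_derivative_linear)
  show "range D \<noteq> UNIV" if x: "x \<in> degenerate_set h"
  proof
    assume surj: "range D = UNIV"
    obtain g where g: "linear g" "D \<circ> g = id"
      using linear_surjective_right_inverse[OF lin] surj by auto
    obtain K where K: "0 < K" "\<And>v. norm (g v) \<le> K * norm v"
      using linear_bounded_pos[OF g(1)] by blast
    \<comment> \<open>Tolerance below 1 / (2 K) and linearisation error 1 / (4 K) add up to less
      than 3 / (4 K), short of the rate 1 / K.\<close>
    obtain j where j: "1 / real (Suc j) < 1 / (2 * K)"
      using nat_approx_posE[of "1 / (2 * K)"] K(1) by auto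
    obtain k where "x \<in> flat_set h (1 / real (Suc j)) (1 / real (Suc k))"
      using x unfolding degenerate_set_def by blast
    then obtain \<nu> where \<nu>: "norm \<nu> = 1"
      "\<And>y. norm (y - x) < 1 / real (Suc k) \<Longrightarrow> \<bar>\<nu> \<bullet> (h y - h x)\<bar> \<le> 1 / real (Suc j) * norm (y - x)"
      unfolding flat_set_def by blast
    define u where "u = g \<nu>"
    have Du: "D u = \<nu>" using g(2) by (metis comp_apply id_apply u_def)
    have uK: "norm u \<le> K" using K(2)[of \<nu>] \<nu>(1) by (simp add: u_def)
    have u0: "0 < norm u" using Du \<nu>(1) linear_0[OF lin] by fastforce
    define e where "e = 1 / (4 * K)"
    have e: "0 < e" using K(1) by (simp add: e_def)
    obtain d where d: "0 < d" "\<And>y. norm (y - x) < d \<Longrightarrow> norm (h y - h x - D (y - x)) \<le> e * norm (y - x)"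
      using D[unfolded has_derivative_at_alt] e by blast
    define t where "t = min d (1 / real (Suc k)) / (2 * norm u)"
    have t: "0 < t" using d u0 by (simp add: t_def)
    have tu: "norm (t *\<^sub>R u) < min d (1 / real (Suc k))"
    proof -
      have m: "0 < min d (1 / real (Suc k))" using d(1) by simp
      have "norm (t *\<^sub>R u) = t * norm u" using t by simp
      also have "\<dots> = min d (1 / real (Suc k)) / 2" using u0 by (simp add: t_def)
      finally have "norm (t *\<^sub>R u) = min d (1 / real (Suc k)) / 2" .
      moreover have half: "z / 2 < z" if "0 < z" for z :: real using that by simp
      have "min d (1 / real (Suc k)) / 2 < min d (1 / real (Suc k))" by (rule half[OF m])
      ultimately show ?thesis by (simp only:)
    qed
    have 1: "\<bar>\<nu> \<bullet> (h (x + t *\<^sub>R u) - h x)\<bar> \<le> 1 / real (Suc j) * norm (t *\<^sub>R u)"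
      using \<nu>(2)[of "x + t *\<^sub>R u"] tu by simp
    have 2: "norm (h (x + t *\<^sub>R u) - h x - t *\<^sub>R \<nu>) \<le> e * norm (t *\<^sub>R u)"
      using d(2)[of "x + t *\<^sub>R u"] tu Du lin by (simp add: linear_scale)
    have "\<bar>\<nu> \<bullet> (h (x + t *\<^sub>R u) - h x - t *\<^sub>R \<nu>)\<bar> \<le> e * norm (t *\<^sub>R u)"
      using Cauchy_Schwarz_ineq2[of \<nu> "h (x + t *\<^sub>R u) - h x - t *\<^sub>R \<nu>"] 2 \<nu>(1) by simp
    moreover have "\<nu> \<bullet> (h (x + t *\<^sub>R u) - h x - t *\<^sub>R \<nu>) = \<nu> \<bullet> (h (x + t *\<^sub>R u) - h x) - t"
      using \<nu>(1) by (simp add: inner_diff_right dot_square_norm)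
    ultimately have 3: "t \<le> (1 / real (Suc j) + e) * norm (t *\<^sub>R u)"
      using 1 by (simp only: distrib_right)
    also have "\<dots> \<le> (1 / real (Suc j) + e) * (t * K)"
      using e t uK by (intro mult_left_mono) auto
    also have "\<dots> < (1 / (2 * K) + 1 / (4 * K)) * (t * K)"
      using j K t unfolding e_def by (intro mult_strict_right_mono) auto
    also have "\<dots> = 3 / 4 * t" using K(1) by (simp add: field_simps)
    finally show False using t by simp
  qed
  show "x \<in> degenerate_set h" if ns: "range D \<noteq> UNIV"
  proof -
    have "subspace (range D)" by (simp add: lin linear_subspace_image)
    then have "span (range D) \<noteq> UNIV" using ns by (metis span_eq_iff)
    then have "dim (range D) < DIM('b)"
      by (metis dim_eq_full dim_span dim_subset_UNIV le_neq_implies_less span_span)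
    then obtain a where a: "a \<noteq> 0" "span (range D) \<subseteq> {x. a \<bullet> x = 0}"
      using lowdim_subset_hyperplane by blast
    define \<nu> where "\<nu> = a /\<^sub>R norm a"
    have "norm \<nu> = 1" using a(1) by (simp add: \<nu>_def)
    moreover have "\<nu> \<bullet> D v = 0" for v
    proof -
      have "D v \<in> span (range D)" by (rule span_base) simp
      then have "a \<bullet> D v = 0" using a(2) by blast
      then show ?thesis by (simp add: \<nu>_def)
    qed
    ultimately have \<nu>: "norm \<nu> = 1" "\<And>v. \<nu> \<bullet> D v = 0" by blast+
    show ?thesis
      unfolding degenerate_set_def
    proof (intro INT_I)
      fix j :: nat
      have "0 < 1 / real (Suc j)" by simp
      then obtain d where d: "0 < d" "\<And>y. norm (y - x) < d \<Longrightarrow> norm (h y - h x - D (y - x)) \<le> 1 / real (Suc j) * norm (y - x)"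
        using D[unfolded has_derivative_at_alt] by blast
      obtain k where k: "1 / real (Suc k) < d" using nat_approx_posE[OF d(1)] by blast
      have "x \<in> flat_set h (1 / real (Suc j)) (1 / real (Suc k))"
        unfolding flat_set_def
      proof (intro CollectI exI[of _ \<nu>] conjI allI impI)
        fix y assume y: "norm (y - x) < 1 / real (Suc k)"
        have "\<nu> \<bullet> (h y - h x) = \<nu> \<bullet> (h y - h x - D (y - x))"
          using \<nu>(2) by (simp add: inner_diff_right)
        also have "\<bar>\<dots>\<bar> \<le> norm (h y - h x - D (y - x))"
          using Cauchy_Schwarz_ineq2[of \<nu> "h y - h x - D (y - x)"] \<nu>(1) by simp
        finally have "\<bar>\<nu> \<bullet> (h y - h x)\<bar> \<le> norm (h y - h x - D (y - x))" .
        also have "\<dots> \<le> 1 / real (Suc j) * norm (y - x)"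
          using d(2) y k by (meson less_trans)
        finally show "\<bar>\<nu> \<bullet> (h y - h x)\<bar> \<le> 1 / real (Suc j) * norm (y - x)" .
      qed (rule \<nu>)
      then show "x \<in> (\<Union>k. flat_set h (1 / real (Suc j)) (1 / real (Suc k)))" by blast
    qed
  qed
qed

text \<open>The image lies in a slab around the hyperplane through \<open>w\<close> orthogonal to
  \<open>\<nu>\<close>. One of the factors of its volume is the thickness instead of
  \<open>2 * r\<close>; this is the gain from degeneracy.\<close>

lemma measure_slab_image:
  fixes h :: "real ^ 'm \<Rightarrow> real ^ 'n::{finite,wellorder}"
  assumes "compact Q" "continuous_on UNIV h" and nu: "norm \<nu> = 1" and pos: "0 \<le> r" "0 \<le> e"
    and near: "\<And>y. y \<in> Q \<Longrightarrow> norm (h y - w) \<le> r"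
    and flat: "\<And>y. y \<in> Q \<Longrightarrow> \<bar>\<nu> \<bullet> (h y - w)\<bar> \<le> e"
  shows "measure lebesgue (h ` Q) \<le> 2 * e * (2 * r) ^ (CARD('n) - 1)"
proof -
  have "\<nu> \<noteq> 0" using nu by auto
  then have "dim {x. \<nu> \<bullet> x = 0} = CARD('n) - 1"
    by (simp add: dim_hyperplane)
  then have "dim {x. \<nu> \<bullet> x = 0} < CARD('n)"
    by (metis One_nat_def diff_less zero_less_card_finite zero_less_one)
  then obtain S where S: "S \<in> lmeasurable" "{z. norm (z - w) \<le> r \<and> (\<exists>t\<in>{x. \<nu> \<bullet> x = 0}. norm (z - w - t) \<le> e)} \<subseteq> S"
    "measure lebesgue S \<le> (2 * e) * (2 * r) ^ (CARD('n) - 1)"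
    using Sard_lemma1[of "{x. \<nu> \<bullet> x = 0}" r e w] pos by blast
  have "h ` Q \<subseteq> {z. norm (z - w) \<le> r \<and> (\<exists>t\<in>{x. \<nu> \<bullet> x = 0}. norm (z - w - t) \<le> e)}"
  proof (intro subsetI CollectI conjI)
    fix z assume "z \<in> h ` Q"
    then obtain y where y: "y \<in> Q" "z = h y" by blast
    show "norm (z - w) \<le> r" using near y by simp
    define t where "t = (z - w) - (\<nu> \<bullet> (z - w)) *\<^sub>R \<nu>"
    have "\<nu> \<bullet> t = 0" using nu by (simp add: t_def inner_diff_right dot_square_norm)
    moreover have "norm (z - w - t) \<le> e" using flat[OF y(1)] nu y(2) by (simp add: t_def)
    ultimately show "\<exists>t\<in>{x. \<nu> \<bullet> x = 0}. norm (z - w - t) \<le> e" by blast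
  qed
  then have "h ` Q \<subseteq> S" using S(2) by blast
  moreover have "compact (h ` Q)"
    using assms(1,2) compact_continuous_image continuous_on_subset by blast
  ultimately have "measure lebesgue (h ` Q) \<le> measure lebesgue S"
    using S(1) by (intro measure_mono_fmeasurable) (auto simp: lmeasurable_compact fmeasurableD)
  then show ?thesis using S(3) by simp
qed

lemma measure_ball_image:
  fixes h :: "real ^ 'm \<Rightarrow> real ^ 'n::finite"
  assumes "compact Q" "continuous_on UNIV h" and "0 \<le> r"
    and near: "\<And>y. y \<in> Q \<Longrightarrow> norm (h y - w) \<le> r"
  shows "measure lebesgue (h ` Q) \<le> (2 * r) ^ CARD('n)"
proof -
  define B where "B = cbox (\<chi> i. w $ i - r) (\<chi> i. w $ i + r)"
  have "h ` Q \<subseteq> B"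
  proof
    fix z assume "z \<in> h ` Q"
    then have "norm (z - w) \<le> r" using near by blast
    then have "\<bar>z $ i - w $ i\<bar> \<le> r" for i
      using component_le_norm_cart[of "z - w" i] by simp
    then show "z \<in> B"
      unfolding B_def mem_box_cart by (simp add: abs_le_iff algebra_simps)
  qed
  moreover have "compact (h ` Q)"
    using assms(1,2) compact_continuous_image continuous_on_subset by blast
  ultimately have "measure lebesgue (h ` Q) \<le> measure lebesgue B"
    by (intro measure_mono_fmeasurable) (auto simp: B_def lmeasurable_compact fmeasurableD)
  also have "\<dots> = (2 * r) ^ CARD('n)"
  proof -
    have "B \<noteq> {}" using assms(3) by (auto simp: B_def interval_ne_empty_cart)
    then show ?thesis unfolding B_def by (simp add: content_cbox_cart)
  qed
  finally show ?thesis .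
qed

section \<open>Cubical grids and the length of fibres\<close>

definition grid_box :: "real \<Rightarrow> nat \<Rightarrow> ('m::finite \<Rightarrow> nat) \<Rightarrow> (real ^ 'm) set" where
  "grid_box R m p = cbox (\<chi> i. -R + 2 * R / m * p i) (\<chi> i. -R + 2 * R / m * (p i + 1))"

lemma grid_box_covers:
  fixes x :: "real ^ 'm::finite"
  assumes "0 < R" "0 < m" "x \<in> cbox (\<chi> i. -R) (\<chi> i. R)"
  shows "\<exists>p. (\<forall>i. p i < m) \<and> x \<in> grid_box R m p"
proof -
  have "\<exists>k<m. -R + 2 * R / m * k \<le> x $ i \<and> x $ i \<le> -R + 2 * R / m * (real k + 1)" for i
  \<comment> \<open>On the top face the floor used below would give the index \<open>m\<close>, one
    too many; that face belongs to the last box.\<close>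
  proof (cases "x $ i = R")
    case True
    have "-R + 2 * R / m * (m - 1) \<le> R" "-R + 2 * R / m * (real (m - 1) + 1) = R"
      using assms by (auto simp: field_simps of_nat_diff)
    then show ?thesis using True assms
      by (intro exI[of _ "m - 1"]) (auto simp: of_nat_diff)
  next
    case False
    have xi: "-R \<le> x $ i" "x $ i < R" using assms(3) False by (auto simp: mem_box_cart less_le)
    define z where "z = (x $ i + R) * m / (2 * R)"
    have "0 \<le> (x $ i + R) * m" "(x $ i + R) * m < 2 * R * m"
      using xi assms by (auto intro!: mult_nonneg_nonneg mult_strict_right_mono)
    then have z: "0 \<le> z" "z < m" using assms by (auto simp: z_def pos_divide_less_eq mult.commute)
    define k where "k = nat \<lfloor>z\<rfloor>"
    have k: "real k \<le> z" "z \<le> real k + 1" "k < m"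
      using z by (auto simp: k_def) (linarith)
    have xz: "x $ i = -R + 2 * R / m * z" using assms by (simp add: z_def field_simps)
    have "0 \<le> 2 * R / m" using assms by simp
    then show ?thesis
      using k unfolding xz by (intro exI[of _ k] conjI add_left_mono mult_left_mono)
  qed
  then have "\<forall>i. \<exists>k<m. -R + 2 * R / m * k \<le> x $ i \<and> x $ i \<le> -R + 2 * R / m * (real k + 1)" by blast
  then obtain p where p: "\<And>i. p i < m \<and> -R + 2 * R / m * p i \<le> x $ i \<and> x $ i \<le> -R + 2 * R / m * (real (p i) + 1)"
    by metis
  then show ?thesis
    by (intro exI[of _ p]) (auto simp: grid_box_def mem_box_cart add.commute)
qed

lemma grid_box_subset:
  fixes p :: "'m::finite \<Rightarrow> nat"
  assumes "0 < R" "\<And>i. p i < m"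
  shows "grid_box R m p \<subseteq> cbox (\<chi> i. -R) (\<chi> i. R)"
proof
  fix x assume x: "x \<in> grid_box R m p"
  show "x \<in> cbox (\<chi> i. -R) (\<chi> i. R)"
    unfolding mem_box_cart
  proof (intro allI conjI)
    fix i
    have m: "0 < m" using assms(2)[of i] by simp
    have 1: "-R + 2 * R / m * p i \<le> x $ i" "x $ i \<le> -R + 2 * R / m * (p i + 1)"
      using x by (auto simp: grid_box_def mem_box_cart)
    have "0 \<le> 2 * R / m * p i" using assms by simp
    then show "(\<chi> i. -R) $ i \<le> x $ i" using 1(1) by simp
    have "real (p i + 1) \<le> real m" using assms(2)[of i] by linarith
    then have "2 * R / m * (p i + 1) \<le> 2 * R / m * m" using assms(1) by (intro mult_left_mono) auto
    also have "\<dots> = 2 * R" using m by simp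
    finally show "x $ i \<le> (\<chi> i. R) $ i" using 1(2) by simp
  qed
qed

lemma grid_box_norm:
  fixes p :: "'m::finite \<Rightarrow> nat"
  assumes "0 < R" "0 < m" "x \<in> grid_box R m p" "y \<in> grid_box R m p"
  shows "norm (y - x) \<le> CARD('m) * (2 * R / m)"
proof -
  have "norm (y - x) \<le> (\<Sum>i\<in>UNIV. \<bar>(y - x) $ i\<bar>)" by (rule norm_le_l1_cart)
  also have "\<dots> \<le> (\<Sum>i\<in>(UNIV::'m set). 2 * R / m)"
  proof (rule sum_mono)
    fix i
    have "-R + 2 * R / m * p i \<le> x $ i \<and> x $ i \<le> -R + (2 * R / m * p i + 2 * R / m)"
      "-R + 2 * R / m * p i \<le> y $ i \<and> y $ i \<le> -R + (2 * R / m * p i + 2 * R / m)"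
      using assms(3,4) by (auto simp: grid_box_def mem_box_cart algebra_simps add_divide_distrib)
    then show "\<bar>(y - x) $ i\<bar> \<le> 2 * R / m" unfolding vector_minus_component by linarith
  qed
  finally show ?thesis by simp
qed

lemma measure_grid_box:
  fixes p :: "'m::finite \<Rightarrow> nat"
  assumes "0 < R" "0 < m"
  shows "measure lebesgue (grid_box R m p) = (2 * R / m) ^ CARD('m)"
proof -
  have le: "-R + 2 * R / m * p i \<le> -R + 2 * R / m * (p i + 1)" for i
    using assms by (simp add: field_simps)
  then have "grid_box R m p \<noteq> {}"
    unfolding grid_box_def interval_ne_empty_cart by simp
  then have "measure lebesgue (grid_box R m p) =
      (\<Prod>i\<in>(UNIV::'m set). (-R + 2 * R / m * (p i + 1)) - (-R + 2 * R / m * p i))"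
    unfolding grid_box_def by (simp add: content_cbox_cart)
  also have "\<dots> = (\<Prod>i\<in>(UNIV::'m set). 2 * R / m)"
    by (intro prod.cong refl) (simp add: distrib_left)
  finally show ?thesis by simp
qed

lemma negligible_grid_box_Int:
  fixes p q :: "'m::finite \<Rightarrow> nat"
  assumes "0 < R" "0 < m" "p \<noteq> q"
  shows "negligible (grid_box R m p \<inter> grid_box R m q)"
proof -
  have main: "negligible (grid_box R m p \<inter> grid_box R m q)" if pq: "p i < q i" for p q :: "'m \<Rightarrow> nat" and i
  proof (rule negligible_subset)
    show "negligible {x :: real ^ 'm. x $ i = -R + 2 * R / m * (p i + 1)}"
      using negligible_standard_hyperplane[of "axis i (1::real)" "-R + 2 * R / m * (p i + 1)"]
      by (simp add: inner_axis axis_in_Basis_iff)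
    show "grid_box R m p \<inter> grid_box R m q \<subseteq> {x :: real ^ 'm. x $ i = -R + 2 * R / m * (p i + 1)}"
    proof (intro subsetI CollectI antisym)
      fix x assume x: "x \<in> grid_box R m p \<inter> grid_box R m q"
      then show "x $ i \<le> -R + 2 * R / m * (p i + 1)" by (auto simp: grid_box_def mem_box_cart)
      have "2 * R / m * (p i + 1) \<le> 2 * R / m * q i"
        using pq assms by (intro mult_left_mono) auto
      moreover have "-R + 2 * R / m * q i \<le> x $ i" using x by (auto simp: grid_box_def mem_box_cart)
      ultimately show "-R + 2 * R / m * (p i + 1) \<le> x $ i" by linarith
    qed
  qed
  obtain i where "p i < q i \<or> q i < p i" using assms(3) by (meson ext linorder_neqE_nat)
  then show ?thesis using main[of p i q] main[of q i p] by (auto simp: Int_commute)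
qed

text \<open>The sum counts grid boxes meeting a fibre, integrated over the fibres.  A box containing a point of
  \<^const>\<open>flat_set\<close> has its image in a thin slab; the other boxes fill a set of small measure.\<close>

lemma fiber_covering_estimate:
  fixes h :: "real ^ 'm \<Rightarrow> real ^ 'n::{finite,wellorder}"
  assumes lip: "L-lipschitz_on UNIV h" and L: "0 < L" and card: "CARD('m) = CARD('n) + 1" and R: "0 < R"
    and \<rho>: "0 < \<rho>"
    and ae: "negligible ({x \<in> cbox (\<chi> i. -R) (\<chi> i. R). h x \<in> cball v0 (2 * \<rho>)} - degenerate_set h)"
    and "0 < \<eta>"
  shows "\<exists>m>0. 2 * R / real m * (\<Sum>p | (\<forall>i. p i < m) \<and> grid_box R m p \<inter> h -` ball v0 \<rho> \<noteq> {}.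
            measure lebesgue (h ` grid_box R m p)) \<le> \<eta>"
proof -
  define N where "N = CARD('m)"
  define n where "n = CARD('n)"
  have n1: "1 \<le> n" and N: "N = n + 1" using card by (auto simp: n_def N_def Suc_leI)
  define C :: "(real ^ 'm) set" where "C = cbox (\<chi> i. -R) (\<chi> i. R)"
  have conth: "continuous_on UNIV h" using lip lipschitz_on_continuous_on by blast
  define A where "A = {x \<in> C. h x \<in> cball v0 (2 * \<rho>)}"
  have "closed A"
  proof -
    have "closed (h -` cball v0 (2 * \<rho>))" using conth by (simp add: closed_vimage continuous_on_eq_continuous_at)
    moreover have "A = C \<inter> h -` cball v0 (2 * \<rho>)" by (auto simp: A_def)
    moreover have "closed C" unfolding C_def by (rule closed_cbox)
    ultimately show ?thesis by (simp only: closed_Int)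
  qed
  then have A: "A \<in> lmeasurable"
    by (intro lmeasurable_compact) (auto simp: compact_eq_bounded_closed A_def C_def intro: bounded_subset[OF bounded_cbox])
  \<comment> \<open>The first summand is for the boxes that meet the flat set, at most
    \<open>m ^ N\<close> of them, each with a slab volume. The second is for the other boxes, whose
    total volume is at most \<open>\<epsilon>\<close>.\<close>
  define K where "K = (2 * R) ^ N * (2 * N) * (2 * (L * N)) ^ (n - 1) + (2 * (L * N)) ^ n"
  have K0: "0 \<le> K" using R L by (simp add: K_def)
  have "0 < \<eta> / (K + 1)" using assms K0 by simp
  then obtain j where j: "1 / real (Suc j) < \<eta> / (K + 1)"
    using nat_approx_posE by metis
  define \<epsilon> where "\<epsilon> = 1 / real (Suc j)"
  have \<epsilon>: "0 < \<epsilon>" by (simp add: \<epsilon>_def)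
  have K\<epsilon>: "K * \<epsilon> \<le> \<eta>"
  proof -
    have "\<epsilon> * (K + 1) < \<eta>" using j K0 by (simp add: \<epsilon>_def pos_less_divide_eq)
    then show ?thesis using \<epsilon> by (simp add: algebra_simps)
  qed
  define F where "F k = flat_set h \<epsilon> (1 / real (Suc k))" for k
  \<comment> \<open>The points that are not flat at scale 1 / (k + 1). They decrease to a null set,
    so some \<open>k\<close> leaves less than volume \<open>\<epsilon>\<close>.\<close>
  define Rk where "Rk k = A - F k" for k
  have Fc: "closed (F k)" for k unfolding F_def by (rule closed_flat_set[OF conth])
  have Rm: "Rk k \<in> lmeasurable" for k
    unfolding Rk_def using A Fc[of k] by (intro fmeasurable_Diff) auto
  have "decseq Rk"
  proof (rule decseq_SucI)
    fix k
    have "F k \<subseteq> F (Suc k)"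
      unfolding F_def by (intro flat_set_mono) (simp add: frac_le)
    then show "Rk (Suc k) \<subseteq> Rk k" by (auto simp: Rk_def)
  qed
  have lim: "(\<lambda>k. measure lebesgue (Rk k)) \<longlonglongrightarrow> measure lebesgue (\<Inter>k. Rk k)"
  proof (rule Lim_measure_decseq[OF _ \<open>decseq Rk\<close>])
    show "range Rk \<subseteq> sets lebesgue" using Rm fmeasurableD by blast
    show "emeasure lebesgue (Rk i) \<noteq> \<infinity>" for i using fmeasurableD2[OF Rm[of i]] by simp
  qed
  have "negligible (\<Inter>k. Rk k)"
  proof (rule negligible_subset[OF ae])
    show "(\<Inter>k. Rk k) \<subseteq> {x \<in> cbox (\<chi> i. -R) (\<chi> i. R). h x \<in> cball v0 (2 * \<rho>)} - degenerate_set h"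
      unfolding Rk_def A_def C_def F_def degenerate_set_def \<epsilon>_def by blast
  qed
  then have "measure lebesgue (\<Inter>k. Rk k) = 0" by (rule negligible_imp_measure0)
  then have "\<forall>\<^sub>F k in sequentially. measure lebesgue (Rk k) < \<epsilon>"
    using lim \<epsilon> by (intro order_tendstoD(2)) auto
  then obtain k where k: "measure lebesgue (Rk k) < \<epsilon>"
    using eventually_happens by force
  \<comment> \<open>Below the first bound flatness holds across a whole box. Below the second a box
    image has diameter less than \<open>\<rho>\<close>, so a box meeting the preimage of the small
    ball stays over the ball of radius \<open>2 * \<rho>\<close>.\<close>
  define \<delta> where "\<delta> = min (1 / real (Suc k)) (\<rho> / L)"
  have \<delta>: "0 < \<delta>" using \<rho> L by (simp add: \<delta>_def)
  obtain m where m: "2 * R * N / \<delta> < real m" using reals_Archimedean2 by blast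
  have m0: "0 < m"
  proof -
    have "0 \<le> 2 * R * N / \<delta>" using R \<delta> by simp
    then show ?thesis using m by linarith
  qed
  define s where "s = 2 * R / m"
  define d where "d = N * s"
  have s: "0 < s" using R m0 by (simp add: s_def)
  have d0: "0 < d" using s N by (simp add: d_def)
  have d: "d < \<delta>"
    using m m0 \<delta> by (simp add: d_def s_def pos_divide_less_eq mult_ac)
  have dk: "d < 1 / real (Suc k)" and d\<rho>: "L * d < \<rho>"
    using d L by (auto simp: \<delta>_def pos_less_divide_eq mult.commute)
  define Q :: "('m \<Rightarrow> nat) \<Rightarrow> _" where "Q = grid_box R m"
  define I where "I = {p::'m \<Rightarrow> nat. \<forall>i. p i < m}"
  have I_Pi: "I = Pi UNIV (\<lambda>_. {..<m})" by (auto simp: I_def)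
  have finI: "finite I" and cardI: "card I = m ^ N"
    unfolding I_Pi PiE_UNIV_domain[symmetric] by (auto simp: finite_PiE card_PiE N_def)
  define J where "J = {p \<in> I. Q p \<inter> h -` ball v0 \<rho> \<noteq> {}}"
  define G where "G = {p \<in> J. Q p \<inter> F k \<noteq> {}}"
  define B where "B = {p \<in> J. Q p \<inter> F k = {}}"
  have fin: "finite J" "finite G" "finite B" using finI by (auto simp: J_def G_def B_def)
  have comp: "compact (Q p)" for p by (simp add: Q_def grid_box_def)
  have hd: "norm (h y - h x) \<le> L * d" if "x \<in> Q p" "y \<in> Q p" for x y p
  proof -
    have "norm (h y - h x) \<le> L * norm (y - x)"
      using lipschitz_onD[OF lip, of y x] by (simp add: dist_norm)
    also have "\<dots> \<le> L * d"
      using grid_box_norm[OF R m0, of x p y] that L unfolding Q_def d_def s_def N_def by (intro mult_left_mono) auto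
    finally show ?thesis .
  qed
  have JA: "Q p \<subseteq> A" if p: "p \<in> J" for p
  proof
    fix x assume x: "x \<in> Q p"
    obtain y where y: "y \<in> Q p" "h y \<in> ball v0 \<rho>" using p unfolding J_def by blast
    have "x \<in> C" using x p grid_box_subset[OF R, of p m] unfolding C_def Q_def J_def I_def by blast
    moreover have "dist v0 (h x) \<le> dist v0 (h y) + dist (h y) (h x)" by (rule dist_triangle)
    then have "h x \<in> cball v0 (2 * \<rho>)"
      using y hd[OF x y(1)] d\<rho> by (simp add: dist_norm)
    ultimately show "x \<in> A" by (simp add: A_def)
  qed
  have good: "measure lebesgue (h ` Q p) \<le> 2 * (\<epsilon> * d) * (2 * (L * d)) ^ (n - 1)" if p: "p \<in> G" for p
  proof -
    obtain x where x: "x \<in> Q p" "x \<in> F k" using p by (auto simp: G_def)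
    then obtain \<nu> where \<nu>: "norm \<nu> = 1"
      "\<And>y. norm (y - x) < 1 / real (Suc k) \<Longrightarrow> \<bar>\<nu> \<bullet> (h y - h x)\<bar> \<le> \<epsilon> * norm (y - x)"
      unfolding F_def flat_set_def by blast
    show ?thesis unfolding n_def
    proof (rule measure_slab_image[OF comp conth \<nu>(1)])
      fix y assume y: "y \<in> Q p"
      show "norm (h y - h x) \<le> L * d" using hd x y by blast
      have yx: "norm (y - x) \<le> d"
        using grid_box_norm[OF R m0, of x p y] x y unfolding Q_def d_def s_def N_def by auto
      then have "\<bar>\<nu> \<bullet> (h y - h x)\<bar> \<le> \<epsilon> * norm (y - x)" using dk by (intro \<nu>(2)) auto
      also have "\<dots> \<le> \<epsilon> * d" using yx \<epsilon> by (intro mult_left_mono) auto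
      finally show "\<bar>\<nu> \<bullet> (h y - h x)\<bar> \<le> \<epsilon> * d" .
    qed (use L d0 \<epsilon> in auto)
  qed
  have bad: "measure lebesgue (h ` Q p) \<le> (2 * (L * d)) ^ n" if p: "p \<in> B" for p
  proof -
    obtain x where x: "x \<in> Q p" using p by (auto simp: B_def J_def)
    show ?thesis unfolding n_def
      by (rule measure_ball_image[OF comp conth, where w = "h x"]) (use hd x L d0 in auto)
  qed
  have cardB: "card B * s ^ N \<le> \<epsilon>"
  proof -
    have "card B * s ^ N = (\<Sum>p\<in>B. measure lebesgue (Q p))"
      by (simp add: Q_def measure_grid_box[OF R m0] s_def N_def)
    also have "\<dots> = measure lebesgue (\<Union>p\<in>B. Q p)"
    proof (rule measure_negligible_finite_Union_image[symmetric, OF fin(3)])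
      show "pairwise (\<lambda>x y. negligible (Q x \<inter> Q y)) B"
        unfolding pairwise_def Q_def using negligible_grid_box_Int[OF R m0] by blast
    qed (simp add: comp lmeasurable_compact)
    also have "\<dots> \<le> measure lebesgue (Rk k)"
    proof (rule measure_mono_fmeasurable[OF _ _ Rm])
      show "(\<Union>p\<in>B. Q p) \<subseteq> Rk k"
        using JA unfolding B_def Rk_def by blast
      show "(\<Union>p\<in>B. Q p) \<in> sets lebesgue"
        using fin comp by (intro sets.finite_UN) (auto simp: lmeasurable_compact fmeasurableD)
    qed
    finally show ?thesis using k by simp
  qed
  have cardG: "card G * s ^ N \<le> (2 * R) ^ N"
  proof -
    have "card G \<le> m ^ N"
      using card_mono[OF finI, of G] cardI by (auto simp: G_def J_def)
    then have "real (card G) \<le> real m ^ N" by (metis of_nat_le_iff of_nat_power)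
    then have "card G * s ^ N \<le> m ^ N * s ^ N" using s by (intro mult_right_mono) auto
    also have "\<dots> = (2 * R) ^ N" using m0 by (simp add: s_def power_divide)
    finally show ?thesis .
  qed
  have J_eq: "J = G \<union> B" "G \<inter> B = {}" by (auto simp: G_def B_def)
  have "s * (\<Sum>p\<in>J. measure lebesgue (h ` Q p)) =
      s * ((\<Sum>p\<in>G. measure lebesgue (h ` Q p)) + (\<Sum>p\<in>B. measure lebesgue (h ` Q p)))"
    unfolding J_eq(1) using fin J_eq(2) by (simp add: sum.union_disjoint)
  also have "\<dots> \<le> s * ((\<Sum>p\<in>G. 2 * (\<epsilon> * d) * (2 * (L * d)) ^ (n - 1)) + (\<Sum>p\<in>B. (2 * (L * d)) ^ n))"
    using s good bad by (intro mult_left_mono add_mono sum_mono) auto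
  \<comment> \<open>Since \<open>N = n + 1\<close>, the \<open>n\<close> factors of an image volume
    and the extra side length make up the volume \<open>s ^ N\<close> of one box, so all powers of
    \<open>s\<close> are absorbed by the box counts.\<close>
  also have "\<dots> = \<epsilon> * (2 * N) * (2 * (L * N)) ^ (n - 1) * (card G * s ^ N) + (2 * (L * N)) ^ n * (card B * s ^ N)"
  proof -
    have 1: "s ^ N = s * s * s ^ (n - 1)" "s ^ N = s * s ^ n"
      using N n1 by (cases n; simp)+
    have 2: "(2 * (L * d)) ^ q = (2 * (L * N)) ^ q * s ^ q" for q
      by (simp add: d_def power_mult_distrib[symmetric] mult_ac)
    have "s * (card G * (2 * (\<epsilon> * d) * ((2 * (L * N)) ^ (n - 1) * s ^ (n - 1)))) =
        \<epsilon> * (2 * N) * (2 * (L * N)) ^ (n - 1) * (card G * s ^ N)"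
      unfolding 1(1) d_def by (simp add: mult_ac)
    moreover have "s * (card B * ((2 * (L * N)) ^ n * s ^ n)) = (2 * (L * N)) ^ n * (card B * s ^ N)"
      unfolding 1(2) by (simp add: mult_ac)
    ultimately show ?thesis by (simp only: 2 sum_constant distrib_left)
  qed
  also have "\<dots> \<le> \<epsilon> * (2 * N) * (2 * (L * N)) ^ (n - 1) * (2 * R) ^ N + (2 * (L * N)) ^ n * \<epsilon>"
    using cardG cardB \<epsilon> L by (intro add_mono mult_left_mono) auto
  also have "\<dots> = K * \<epsilon>" by (simp add: K_def algebra_simps)
  also have "\<dots> \<le> \<eta>" by (rule K\<epsilon>)
  finally show ?thesis
    using m0 unfolding s_def J_def I_def Q_def by auto
qed

text \<open>Side length times the number of boxes meeting a fibre bounds the measure of each of its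
  coordinate projections. By Markov's inequality, the values for which this product stays above a
  positive \<open>\<tau>\<close> at every scale form a null set.\<close>

lemma fiber_projections_negligible:
  fixes h :: "real ^ 'm \<Rightarrow> real ^ 'n::{finite,wellorder}"
  assumes lip: "L-lipschitz_on UNIV h" and L: "0 < L" and card: "CARD('m) = CARD('n) + 1" and R: "0 < R"
    and \<rho>: "0 < \<rho>"
    and ae: "negligible ({x \<in> cbox (\<chi> i. -R) (\<chi> i. R). h x \<in> cball v0 (2 * \<rho>)} - degenerate_set h)"
  shows "negligible {w \<in> ball v0 \<rho>. \<exists>i. \<not> negligible ((\<lambda>x. x $ i) ` {x \<in> cbox (\<chi> i. -R) (\<chi> i. R). h x = w})}"
proof -
  have conth: "continuous_on UNIV h" using lip lipschitz_on_continuous_on by blast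
  define I where "I m w = {p::'m \<Rightarrow> nat. (\<forall>i. p i < m) \<and> w \<in> h ` grid_box R m p}" for m w
  have finI: "finite {p::'m \<Rightarrow> nat. (\<forall>i. p i < m)}" for m :: nat
  proof -
    have "{p::'m \<Rightarrow> nat. (\<forall>i. p i < m)} = Pi UNIV (\<lambda>_. {..<m})" by auto
    then show ?thesis unfolding PiE_UNIV_domain[symmetric] by (simp add: finite_PiE)
  qed
  define W where "W \<tau> = {w \<in> ball v0 \<rho>. \<forall>m>0. \<tau> \<le> 2 * R / real m * card (I m w)}" for \<tau>
  have negW: "negligible (W \<tau>)" if \<tau>: "0 < \<tau>" for \<tau>
    unfolding negligible_outer_le
  proof (intro allI impI)
    fix e :: real assume e: "0 < e"
    then have "0 < e * \<tau>" using \<tau> by simp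
    then obtain m where m: "0 < m" "2 * R / real m * (\<Sum>p | (\<forall>i. p i < m) \<and> grid_box R m p \<inter> h -` ball v0 \<rho> \<noteq> {}.
            measure lebesgue (h ` grid_box R m p)) \<le> e * \<tau>"
      using fiber_covering_estimate[OF lip L card R \<rho> ae] by blast
    define J where "J = {p. (\<forall>i. p i < m) \<and> grid_box R m p \<inter> h -` ball v0 \<rho> \<noteq> {}}"
    define s where "s = 2 * R / real m"
    have s: "0 < s" using R m by (simp add: s_def)
    have finJ: "finite J" by (rule finite_subset[OF _ finI[of m]]) (auto simp: J_def)
    have comp: "compact (h ` grid_box R m p)" for p
      unfolding grid_box_def
      by (rule compact_continuous_image[OF continuous_on_subset[OF conth subset_UNIV] compact_cbox])
    then have meas: "h ` grid_box R m p \<in> sets lebesgue" for p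
      by (simp add: lmeasurable_compact fmeasurableD)
    \<comment> \<open>A discrete substitute for the length of the fibre of \<open>w\<close>; its
      integral is the sum that was estimated.\<close>
    define u where "u w = (\<Sum>p\<in>J. ennreal s * indicator (h ` grid_box R m p) w)" for w
    have um: "u \<in> borel_measurable lebesgue" unfolding u_def using meas by measurable
    define T where "T = {w \<in> space lebesgue. 1 \<le> ennreal (1 / \<tau>) * u w}"
    have "emeasure lebesgue T \<le> ennreal (1 / \<tau>) * (\<integral>\<^sup>+w. u w * indicator (space lebesgue) w \<partial>lebesgue)"
      unfolding T_def by (rule nn_integral_Markov_inequality) (use um in auto)
    also have "(\<integral>\<^sup>+w. u w * indicator (space lebesgue) w \<partial>lebesgue) = (\<integral>\<^sup>+w. u w \<partial>lebesgue)"
      by simp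
    also have "\<dots> = (\<Sum>p\<in>J. ennreal s * emeasure lebesgue (h ` grid_box R m p))"
      unfolding u_def using meas by (subst nn_integral_sum) (auto simp: nn_integral_cmult_indicator)
    also have "\<dots> = ennreal (s * (\<Sum>p\<in>J. measure lebesgue (h ` grid_box R m p)))"
      using s comp by (simp add: emeasure_eq_measure2 lmeasurable_compact ennreal_mult[symmetric] sum_distrib_left)
    also have "\<dots> \<le> ennreal (e * \<tau>)"
      using m(2) unfolding s_def J_def by (rule ennreal_leI)
    also have "ennreal (1 / \<tau>) * ennreal (e * \<tau>) = ennreal e"
      using \<tau> e by (simp add: ennreal_mult[symmetric])
    finally have eT: "emeasure lebesgue T \<le> ennreal e" by (simp add: mult_left_mono)
    have Tm: "T \<in> sets lebesgue" unfolding T_def using um by measurable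
    have Tl: "T \<in> lmeasurable" using eT Tm by (intro fmeasurableI) (auto intro: le_less_trans)
    have "measure lebesgue T \<le> e" using eT e by (simp add: measure_def enn2real_leI)
    moreover have "W \<tau> \<subseteq> T"
    proof
      fix w assume w: "w \<in> W \<tau>"
      then have 1: "\<tau> \<le> s * card (I m w)" using m(1) by (simp add: W_def s_def)
      have "I m w = {p \<in> J. w \<in> h ` grid_box R m p}"
        using w by (auto simp: I_def J_def W_def)
      then have "u w = (\<Sum>p\<in>I m w. ennreal s)"
        unfolding u_def using finJ
        by (simp add: sum.inter_filter indicator_def if_distrib Int_def cong: if_cong)
      also have "\<dots> = ennreal (s * card (I m w))"
        using s by (simp add: ennreal_mult ennreal_of_nat_eq_real_of_nat mult.commute)
      finally have "ennreal (1 / \<tau>) * u w = ennreal (s * card (I m w) / \<tau>)"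
        using \<tau> s by (simp add: ennreal_mult[symmetric])
      moreover have "1 \<le> s * card (I m w) / \<tau>" using 1 \<tau> by simp
      ultimately show "w \<in> T" by (simp add: T_def ennreal_1[symmetric] del: ennreal_1)
    qed
    ultimately show "\<exists>T. W \<tau> \<subseteq> T \<and> T \<in> lmeasurable \<and> measure lebesgue T \<le> e"
      using Tl by blast
  qed
  have negl: "negligible (\<Union>j. W (1 / real (Suc j)))"
    by (rule negligible_countable_Union) (auto simp: negW)
  show ?thesis
  proof (rule negligible_subset[OF negl], rule subsetI, rule ccontr)
    fix w assume w: "w \<in> {w \<in> ball v0 \<rho>. \<exists>i. \<not> negligible ((\<lambda>x. x $ i) ` {x \<in> cbox (\<chi> i. -R) (\<chi> i. R). h x = w})}"
      and nW: "w \<notin> (\<Union>j. W (1 / real (Suc j)))"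
    then obtain i where i: "\<not> negligible ((\<lambda>x. x $ i) ` {x \<in> cbox (\<chi> i. -R) (\<chi> i. R). h x = w})" by blast
    have "negligible ((\<lambda>x. x $ i) ` {x \<in> cbox (\<chi> i. -R) (\<chi> i. R). h x = w})"
      unfolding negligible_outer_le
    proof (intro allI impI)
      fix e :: real assume "0 < e"
      then obtain j where j: "1 / real (Suc j) < e" using nat_approx_posE by metis
      have "w \<notin> W (1 / real (Suc j))" using nW by blast
      then obtain m where m: "0 < m" "2 * R / real m * card (I m w) < e"
      proof -
        have "\<not> (\<forall>m>0. 1 / real (Suc j) \<le> 2 * R / real m * card (I m w))"
          using w \<open>w \<notin> W (1 / real (Suc j))\<close> unfolding W_def by blast
        then show ?thesis using j that by (meson less_trans not_le)
      qed
      define T where "T = (\<Union>p\<in>I m w. cbox (-R + 2 * R / m * p i) (-R + 2 * R / m * (p i + 1)))"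
      have fin: "finite (I m w)" by (rule finite_subset[OF _ finI[of m]]) (auto simp: I_def)
      have "(\<lambda>x. x $ i) ` {x \<in> cbox (\<chi> i. -R) (\<chi> i. R). h x = w} \<subseteq> T"
      proof
        fix t assume "t \<in> (\<lambda>x. x $ i) ` {x \<in> cbox (\<chi> i. -R) (\<chi> i. R). h x = w}"
        then obtain x where x: "x \<in> cbox (\<chi> i. -R) (\<chi> i. R)" "h x = w" "t = x $ i" by blast
        obtain p where p: "\<forall>i. p i < m" "x \<in> grid_box R m p"
          using grid_box_covers[OF R m(1) x(1)] by blast
        then have "p \<in> I m w" using x(2) by (auto simp: I_def)
        moreover have "t \<in> cbox (-R + 2 * R / m * p i) (-R + 2 * R / m * (p i + 1))"
          using p(2) x(3) by (auto simp: grid_box_def mem_box_cart)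
        ultimately show "t \<in> T" unfolding T_def by blast
      qed
      moreover have "T \<in> lmeasurable" unfolding T_def using fin by (intro fmeasurable.finite_UN) auto
      moreover have "measure lebesgue T \<le> e"
      proof -
        have "measure lebesgue T \<le> (\<Sum>p\<in>I m w. measure lebesgue (cbox (-R + 2 * R / m * p i) (-R + 2 * R / m * (p i + 1))))"
          unfolding T_def using fin by (intro measure_UNION_le) auto
        also have "\<dots> = (\<Sum>p\<in>I m w. 2 * R / m)"
          using R by (intro sum.cong refl) (simp add: distrib_left mult_left_mono)
        also have "\<dots> \<le> e" using m by (simp add: mult.commute)
        finally show ?thesis .
      qed
      ultimately show "\<exists>T. (\<lambda>x. x $ i) ` {x \<in> cbox (\<chi> i. -R) (\<chi> i. R). h x = w} \<subseteq> T \<and> T \<in> lmeasurable \<and> measure lebesgue T \<le> e"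
        by blast
    qed
    then show False using i by blast
  qed
qed

section \<open>Moving a map off a point\<close>

text \<open>The box is cut again and again by hyperplanes whose position avoids the null projection
  of \<open>K\<close>. A small box that meets \<open>K\<close> keeps only its frontier, any other
  small box is kept entire. \<open>Pr\<close> stands for a lifting property that survives gluing
  along convex walls.\<close>

lemma box_skeleton_avoiding:
  fixes K :: "(real ^ 'm) set" and Pr :: "(real ^ 'm) set \<Rightarrow> bool"
  assumes K: "\<And>i. negligible ((\<lambda>x. x $ i) ` K)"
    and box: "\<And>a b. Pr (cbox a b)"
    and fr: "\<And>a b. (\<And>i. a $ i < b $ i) \<Longrightarrow> Pr (frontier (cbox a b))"
    and un: "\<And>S T. \<lbrakk>compact S; compact T; Pr S; Pr T; convex (S \<inter> T); S \<inter> T \<noteq> {}\<rbrakk> \<Longrightarrow> Pr (S \<union> T)"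
    and ab: "\<And>i. a $ i < b $ i" and frK: "frontier (cbox a b) \<inter> K = {}" and \<delta>: "0 < \<delta>"
  shows "\<exists>X. compact X \<and> frontier (cbox a b) \<subseteq> X \<and> X \<subseteq> cbox a b \<and> X \<inter> K = {} \<and> Pr X \<and>
           (\<forall>x\<in>cbox a b - X. \<exists>y\<in>K. norm (x - y) \<le> \<delta>)"
proof -
  define N where "N = real CARD('m)"
  have N: "0 < N" by (simp add: N_def)
  \<comment> \<open>Sides of at most \<open>\<delta>'\<close> give a diameter of at most
    \<open>\<delta>\<close>, because the norm is bounded by the sum of the coordinates.\<close>
  define \<delta>' where "\<delta>' = \<delta> / N"
  have \<delta>': "0 < \<delta>'" using \<delta> N by (simp add: \<delta>'_def)
  define upd where "upd v i t = (\<chi> j. if j = i then t else v $ j)" for v :: "real ^ 'm" and i t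
  \<comment> \<open>Induction on the total side length in units of \<open>\<delta>' / 3\<close>: a
    cut in the middle third of a side longer than \<open>\<delta>'\<close> saves at least one unit
    in both parts.\<close>
  have main: "\<exists>X. compact X \<and> frontier (cbox a b) \<subseteq> X \<and> X \<subseteq> cbox a b \<and> X \<inter> K = {} \<and> Pr X \<and>
           (\<forall>x\<in>cbox a b - X. \<exists>y\<in>K. norm (x - y) \<le> \<delta>)"
    if "(\<Sum>i\<in>UNIV. b $ i - a $ i) \<le> real k * (\<delta>' / 3)" "\<And>i. a $ i < b $ i" "frontier (cbox a b) \<inter> K = {}" for k a b
    using that
  proof (induction k arbitrary: a b)
    case 0
    have "0 < (\<Sum>i\<in>(UNIV::'m set). b $ i - a $ i)"
      using 0(2) by (intro sum_pos) auto
    then show ?case using 0(1) by simp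
  next
    case (Suc k)
    note lt = Suc.prems(2)
    show ?case
    proof (cases "\<forall>i. b $ i - a $ i \<le> \<delta>'")
      case True
      have diam: "norm (x - y) \<le> \<delta>" if xy: "x \<in> cbox a b" "y \<in> cbox a b" for x y
      proof -
        have "norm (x - y) \<le> (\<Sum>i\<in>UNIV. \<bar>(x - y) $ i\<bar>)" by (rule norm_le_l1_cart)
        also have "\<dots> \<le> (\<Sum>i\<in>(UNIV::'m set). \<delta>')"
        proof (rule sum_mono)
          fix i
          have "a $ i \<le> x $ i" "x $ i \<le> b $ i" "a $ i \<le> y $ i" "y $ i \<le> b $ i" "b $ i - a $ i \<le> \<delta>'"
            using xy True by (auto simp: mem_box_cart)
          then show "\<bar>(x - y) $ i\<bar> \<le> \<delta>'" unfolding vector_minus_component by linarith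
        qed
        also have "\<dots> = \<delta>" using N by (simp add: \<delta>'_def N_def)
        finally show ?thesis .
      qed
      show ?thesis
      proof (cases "cbox a b \<inter> K = {}")
        case T: True
        show ?thesis
        proof (intro exI[of _ "cbox a b"] conjI)
          show "frontier (cbox a b) \<subseteq> cbox a b" by (simp add: frontier_cbox Diff_subset)
        qed (use T box in auto)
      next
        case False
        then obtain y where y: "y \<in> cbox a b" "y \<in> K" by blast
        show ?thesis
        proof (intro exI[of _ "frontier (cbox a b)"] conjI ballI)
          show "frontier (cbox a b) \<subseteq> cbox a b" by (simp add: frontier_cbox Diff_subset)
          show "compact (frontier (cbox a b))" by (simp add: compact_frontier)
          show "Pr (frontier (cbox a b))" by (rule fr[OF lt])
          fix x assume "x \<in> cbox a b - frontier (cbox a b)"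
          then show "\<exists>y\<in>K. norm (x - y) \<le> \<delta>" using diam y by blast
        qed (use Suc.prems(3) in auto)
      qed
    next
      case False
      then obtain i where i: "\<delta>' < b $ i - a $ i" by (auto simp: not_le)
      define w where "w = b $ i - a $ i"
      have w: "\<delta>' < w" "0 < w" using i \<delta>' by (auto simp: w_def)
      have "\<not> negligible (box (a $ i + w / 3) (b $ i - w / 3))"
        using w by (intro open_not_negligible open_box) (auto simp: w_def field_simps)
      then have "\<not> box (a $ i + w / 3) (b $ i - w / 3) \<subseteq> (\<lambda>x. x $ i) ` K"
        using K[of i] negligible_subset by blast
      then obtain t where t0: "t \<in> box (a $ i + w / 3) (b $ i - w / 3)" "t \<notin> (\<lambda>x. x $ i) ` K" by blast
      have t: "a $ i + w / 3 < t" "t < b $ i - w / 3" "a $ i < t" "t < b $ i" using t0(1) w by auto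
      have tK: "x \<notin> K" if "x $ i = t" for x using t0(2) that by blast
      define b' where "b' = upd b i t"
      define a' where "a' = upd a i t"
      have comp: "b' $ j = (if j = i then t else b $ j)" "a' $ j = (if j = i then t else a $ j)" for j
        by (auto simp: a'_def b'_def upd_def)
      have sum1: "(\<Sum>j\<in>UNIV. b' $ j - a $ j) \<le> real k * (\<delta>' / 3)"
      proof -
        have "(\<Sum>j\<in>UNIV. b' $ j - a $ j) = (\<Sum>j\<in>UNIV. (b $ j - a $ j) - (if j = i then b $ i - t else 0))"
          by (intro sum.cong) (auto simp: comp)
        also have "\<dots> = (\<Sum>j\<in>UNIV. b $ j - a $ j) - (b $ i - t)"
          by (simp add: sum_subtractf)
        also have "\<dots> \<le> real (Suc k) * (\<delta>' / 3) - \<delta>' / 3"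
          using Suc.prems(1) t w by linarith
        also have "\<dots> = real k * (\<delta>' / 3)" by (simp add: algebra_simps)
        finally show ?thesis .
      qed
      have sum2: "(\<Sum>j\<in>UNIV. b $ j - a' $ j) \<le> real k * (\<delta>' / 3)"
      proof -
        have "(\<Sum>j\<in>UNIV. b $ j - a' $ j) = (\<Sum>j\<in>UNIV. (b $ j - a $ j) - (if j = i then t - a $ i else 0))"
          by (intro sum.cong) (auto simp: comp)
        also have "\<dots> = (\<Sum>j\<in>UNIV. b $ j - a $ j) - (t - a $ i)"
          by (simp add: sum_subtractf)
        also have "\<dots> \<le> real (Suc k) * (\<delta>' / 3) - \<delta>' / 3"
          using Suc.prems(1) t w by linarith
        also have "\<dots> = real k * (\<delta>' / 3)" by (simp add: algebra_simps)
        finally show ?thesis .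
      qed
      \<comment> \<open>Moving one bound in coordinate \<open>i\<close> inwards to \<open>t\<close>
        amounts to adding one condition on \<open>x $ i\<close>; the four descriptions of the half
        boxes are instances.\<close>
      have gen: "(\<forall>j. A j \<and> (if j = i then D else B j)) \<longleftrightarrow> (\<forall>j. A j \<and> B j) \<and> D"
        if "D \<longrightarrow> B i" for A B :: "'m \<Rightarrow> bool" and D
      proof (intro iffI conjI allI)
        fix j assume *: "\<forall>j. A j \<and> (if j = i then D else B j)"
        show "A j" "D" "B j"
          using *[rule_format, of j] *[rule_format, of i] that by (auto split: if_splits)
      qed (use that in auto)
      have le: "x $ j \<le> b' $ j \<longleftrightarrow> (if j = i then x $ i \<le> t else x $ j \<le> b $ j)"
        "a' $ j \<le> x $ j \<longleftrightarrow> (if j = i then t \<le> x $ i else a $ j \<le> x $ j)"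
        "x $ j < b' $ j \<longleftrightarrow> (if j = i then x $ i < t else x $ j < b $ j)"
        "a' $ j < x $ j \<longleftrightarrow> (if j = i then t < x $ i else a $ j < x $ j)" for x j
        by (auto simp: comp)
      have cb1: "x \<in> cbox a b' \<longleftrightarrow> x \<in> cbox a b \<and> x $ i \<le> t" for x
        unfolding mem_box_cart le by (rule gen) (use t in auto)
      have b1: "x \<in> box a b' \<longleftrightarrow> x \<in> box a b \<and> x $ i < t" for x
        unfolding mem_box_cart le by (rule gen) (use t in auto)
      have cb2: "x \<in> cbox a' b \<longleftrightarrow> x \<in> cbox a b \<and> t \<le> x $ i" for x
        unfolding mem_box_cart le conj_commute[of "if _ then _ else _"] conj_commute[of "a $ _ \<le> _"]
        by (rule gen) (use t in auto)
      have b2: "x \<in> box a' b \<longleftrightarrow> x \<in> box a b \<and> t < x $ i" for x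
        unfolding mem_box_cart le conj_commute[of "if _ then _ else _"] conj_commute[of "a $ _ < _"]
        by (rule gen) (use t in auto)
      have frb: "frontier (cbox c d) = cbox c d - box c d" for c d :: "real ^ 'm"
        by (rule frontier_cbox)
      have K1: "frontier (cbox a b') \<inter> K = {}"
        using Suc.prems(3) tK unfolding frb by (auto simp: cb1 b1 less_le)
      have K2: "frontier (cbox a' b) \<inter> K = {}"
        using Suc.prems(3) tK unfolding frb by (auto simp: cb2 b2 less_le)
      have l1: "a $ j < b' $ j" and l2: "a' $ j < b $ j" for j using lt t by (auto simp: comp)
      obtain X1 where X1: "compact X1" "frontier (cbox a b') \<subseteq> X1" "X1 \<subseteq> cbox a b'" "X1 \<inter> K = {}" "Pr X1"
         "\<forall>x\<in>cbox a b' - X1. \<exists>y\<in>K. norm (x - y) \<le> \<delta>"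
        using Suc.IH[OF sum1 l1 K1] by blast
      obtain X2 where X2: "compact X2" "frontier (cbox a' b) \<subseteq> X2" "X2 \<subseteq> cbox a' b" "X2 \<inter> K = {}" "Pr X2"
         "\<forall>x\<in>cbox a' b - X2. \<exists>y\<in>K. norm (x - y) \<le> \<delta>"
        using Suc.IH[OF sum2 l2 K2] by blast
      \<comment> \<open>The wall belongs to the frontiers of both halves and thus to both skeleta,
        and beyond it the halves are disjoint. So the gluing set is itself a degenerate box, in
        particular convex.\<close>
      have Int: "X1 \<inter> X2 = cbox a' b'"
      proof
        have "x \<in> cbox a' b'" if "x \<in> cbox a b" "x $ i = t" for x
          using that by (auto simp: mem_box_cart comp)
        then show "X1 \<inter> X2 \<subseteq> cbox a' b'"
          using X1(3) X2(3) cb1 cb2 by (meson Int_iff antisym subsetI subset_iff)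
        show "cbox a' b' \<subseteq> X1 \<inter> X2"
        proof
          fix x assume x: "x \<in> cbox a' b'"
          then have xi: "x $ i = t" using comp[of i] unfolding mem_box_cart by (metis antisym)
          have "x \<in> cbox a b"
            unfolding mem_box_cart
          proof
            fix j show "a $ j \<le> x $ j \<and> x $ j \<le> b $ j"
              using x t xi unfolding mem_box_cart comp by (cases "j = i") (auto dest: spec[of _ j])
          qed
          then show "x \<in> X1 \<inter> X2" using X1(2) X2(2) xi unfolding frb by (auto simp: cb1 cb2 b1 b2)
        qed
      qed
      have "cbox a' b' \<noteq> {}"
        using lt by (auto simp: interval_ne_empty_cart comp less_imp_le)
      then have "Pr (X1 \<union> X2)"
        using X1 X2 Int by (intro un) auto
      moreover have "frontier (cbox a b) \<subseteq> X1 \<union> X2"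
      proof
        fix x assume "x \<in> frontier (cbox a b)"
        then have "x \<in> frontier (cbox a b') \<or> x \<in> frontier (cbox a' b)"
          unfolding frb by (auto simp: cb1 cb2 b1 b2)
        then show "x \<in> X1 \<union> X2" using X1(2) X2(2) by blast
      qed
      moreover have "X1 \<union> X2 \<subseteq> cbox a b" using X1(3) X2(3) cb1 cb2 by blast
      moreover have "\<forall>x\<in>cbox a b - (X1 \<union> X2). \<exists>y\<in>K. norm (x - y) \<le> \<delta>"
      proof
        fix x assume x: "x \<in> cbox a b - (X1 \<union> X2)"
        then have "x \<in> cbox a b' - X1 \<or> x \<in> cbox a' b - X2" by (auto simp: cb1 cb2)
        then show "\<exists>y\<in>K. norm (x - y) \<le> \<delta>" using X1(6) X2(6) by blast
      qed
      moreover have "(X1 \<union> X2) \<inter> K = {}" using X1(4) X2(4) by blast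
      ultimately show ?thesis using X1(1) X2(1) compact_Un by blast
    qed
  qed
  obtain k where "(\<Sum>i\<in>UNIV. b $ i - a $ i) / (\<delta>' / 3) \<le> real k" using real_arch_simple by blast
  then have "(\<Sum>i\<in>UNIV. b $ i - a $ i) \<le> real k * (\<delta>' / 3)" using \<delta>' by (simp add: pos_divide_le_eq)
  then show ?thesis using main ab frK by blast
qed

text \<open>Here \<open>K\<close> is the fibre. Uniform continuity turns closeness of a removed
  point to the fibre into closeness of its value to \<open>w\<close>.\<close>

lemma skeleton_avoiding_fiber:
  fixes h :: "real ^ 'm \<Rightarrow> 'b::euclidean_space" and Pr :: "(real ^ 'm) set \<Rightarrow> bool"
  assumes h: "continuous_on UNIV h"
    and K: "\<And>i. negligible ((\<lambda>x. x $ i) ` {x \<in> cbox a b. h x = w})"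
    and ab: "\<And>i. a $ i < b $ i" and fr: "\<And>x. x \<in> frontier (cbox a b) \<Longrightarrow> h x \<noteq> w" and \<eta>: "0 < \<eta>"
    and Pr: "\<And>a b. Pr (cbox a b)" "\<And>a b. (\<And>i. a $ i < b $ i) \<Longrightarrow> Pr (frontier (cbox a b))"
      "\<And>S T. \<lbrakk>compact S; compact T; Pr S; Pr T; convex (S \<inter> T); S \<inter> T \<noteq> {}\<rbrakk> \<Longrightarrow> Pr (S \<union> T)"
  shows "\<exists>X. compact X \<and> X \<subseteq> cbox a b \<and> Pr X \<and> (\<forall>x\<in>X. h x \<noteq> w) \<and> (\<forall>x\<in>cbox a b - X. norm (h x - w) < \<eta>)"
proof -
  have "uniformly_continuous_on (cbox a b) h"
    by (rule compact_uniformly_continuous[OF continuous_on_subset[OF h subset_UNIV] compact_cbox])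
  then obtain \<delta> where \<delta>: "0 < \<delta>" "\<And>x y. x \<in> cbox a b \<Longrightarrow> y \<in> cbox a b \<Longrightarrow> dist y x < \<delta> \<Longrightarrow> dist (h y) (h x) < \<eta>"
    unfolding uniformly_continuous_on_def using \<eta> by metis
  define K where "K = {x \<in> cbox a b. h x = w}"
  have "frontier (cbox a b) \<inter> K = {}" using fr by (auto simp: K_def)
  moreover have "0 < \<delta> / 2" using \<delta>(1) by simp
  ultimately obtain X where X: "compact X" "X \<subseteq> cbox a b" "X \<inter> K = {}" "Pr X"
     "\<forall>x\<in>cbox a b - X. \<exists>y\<in>K. norm (x - y) \<le> \<delta> / 2"
    using box_skeleton_avoiding[of K Pr a b "\<delta> / 2"] assms(2) Pr ab unfolding K_def by blast
  have "norm (h x - w) < \<eta>" if x: "x \<in> cbox a b - X" for x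
  proof -
    obtain y where y: "y \<in> K" "norm (x - y) \<le> \<delta> / 2" using X(5) x by blast
    then have "dist (h x) (h y) < \<eta>" using x \<delta> unfolding K_def by (intro \<delta>(2)) (auto simp: dist_norm)
    then show ?thesis using y(1) by (simp add: K_def dist_norm)
  qed
  moreover have "\<forall>x\<in>X. h x \<noteq> w" using X(2,3) by (auto simp: K_def)
  ultimately show ?thesis using X by blast
qed

text \<open>Agreement with \<open>h\<close> away from \<open>w\<close> allows the new map to be
  glued to an unchanged one. The factor 4 comes from the Hopf lift: a displacement there can double
  norms, and the Hopf map squares them.\<close>

definition pushable :: "('a::euclidean_space \<Rightarrow> 'b::euclidean_space) \<Rightarrow> 'a set \<Rightarrow> 'b \<Rightarrow> real \<Rightarrow> bool" where
  "pushable h C w e \<longleftrightarrow> (\<exists>h'. continuous_on C h' \<and> (\<forall>x\<in>C. h' x \<noteq> w \<and>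
     (e \<le> norm (h x - w) \<longrightarrow> h' x = h x) \<and> (norm (h x - w) \<le> e \<longrightarrow> norm (h' x - w) \<le> 4 * e)))"

lemma compact_norm_lower_bound:
  fixes v :: "'a::topological_space \<Rightarrow> 'b::real_normed_vector"
  assumes "compact X" "continuous_on X v" "\<And>x. x \<in> X \<Longrightarrow> v x \<noteq> 0"
  obtains c where "0 < c" "\<And>x. x \<in> X \<Longrightarrow> c \<le> norm (v x)"
proof (cases "X = {}")
  case False
  have "continuous_on X (\<lambda>x. norm (v x))" by (intro continuous_intros assms(2))
  then obtain x0 where "x0 \<in> X" "\<And>y. y \<in> X \<Longrightarrow> norm (v x0) \<le> norm (v y)"
    using continuous_attains_inf[OF assms(1) False] by blast
  then show ?thesis using that[of "norm (v x0)"] assms(3) by auto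
qed (use that[of 1] in auto)

text \<open>On the skeleton the argument of \<open>h - w\<close> lifts to a real function, and any extension of it
  gives a map into the punctured plane.\<close>

lemma push_off_plane:
  fixes h :: "real ^ 'm \<Rightarrow> real ^ 'n"
  assumes dims: "CARD('m) = 3" "CARD('n) = 2"
    and h: "continuous_on UNIV h"
    and K: "\<And>i. negligible ((\<lambda>x. x $ i) ` {x \<in> cbox a b. h x = w})"
    and ab: "\<And>i. a $ i < b $ i" and fr: "\<And>x. x \<in> frontier (cbox a b) \<Longrightarrow> h x \<noteq> w" and e: "0 < e"
  shows "pushable h (cbox a b) w e"
proof -
  have frB: "Borsukian (frontier (cbox a b))" if "\<And>i. a $ i < b $ i" for a b :: "real ^ 'm"
  proof -
    have "box a b \<noteq> {}" using that by (simp add: interval_ne_empty_cart)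
    then have "frontier (cbox a b) homeomorphic sphere (0 :: real ^ 'm) 1"
      by (intro homeomorphic_frontier_cbox_sphere) auto
    then show ?thesis
      using Borsukian_sphere[of "0 :: real ^ 'm" 1] dims(1) homeomorphic_Borsukian_eq by auto
  qed
  have unB: "Borsukian (S \<union> T)"
    if "compact S" "compact T" "Borsukian S" "Borsukian T" "convex (S \<inter> T)" for S T :: "(real ^ 'm) set"
    using that by (intro Borsukian_closed_Un closed_subset) (auto simp: compact_imp_closed convex_connected)
  have "\<exists>X. compact X \<and> X \<subseteq> cbox a b \<and> Borsukian X \<and> (\<forall>x\<in>X. h x \<noteq> w) \<and> (\<forall>x\<in>cbox a b - X. norm (h x - w) < e)"
    by (rule skeleton_avoiding_fiber[OF h K ab fr e convex_imp_Borsukian[OF convex_box(1)] frB unB]) simp_all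
  then obtain X where X: "compact X" "X \<subseteq> cbox a b" "Borsukian X" "\<forall>x\<in>X. h x \<noteq> w"
     "\<forall>x\<in>cbox a b - X. norm (h x - w) < e"
    by blast
  obtain J :: "real ^ 'n \<Rightarrow> complex" and J' where J: "linear J" "linear J'" "\<And>x. norm (J x) = norm x"
     "\<And>y. norm (J' y) = norm y" "\<And>x. J' (J x) = x" "\<And>y. J (J' y) = y"
    using isomorphisms_UNIV_UNIV[where 'M="real ^ 'n" and 'N=complex] dims(2) by auto
  define v where "v x = J (h x - w)" for x
  have cJ: "continuous_on UNIV J" "continuous_on UNIV J'"
    using J by (auto simp: linear_continuous_on linear_conv_bounded_linear)
  have cv: "continuous_on S v" for S
    unfolding v_def
    by (rule continuous_on_compose2[OF cJ(1)]) (auto intro!: continuous_intros continuous_on_subset[OF h])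
  have nv: "norm (v x) = norm (h x - w)" for x by (simp add: v_def J(3))
  have v0: "v x \<noteq> 0" if "x \<in> X" for x using X(4) that nv[of x] by (metis norm_eq_zero right_minus_eq)
  obtain g where g: "continuous_on X g" "\<And>x. x \<in> X \<Longrightarrow> v x = exp (g x)"
    using X(3)[unfolded Borsukian_continuous_logarithm, rule_format, of v] cv v0 by (auto simp: Pi_iff)
  have "closedin (top_of_set UNIV) X" using X(1) by (simp add: compact_imp_closed)
  moreover have "continuous_on X (\<lambda>x. Im (g x))" by (intro continuous_intros g(1))
  \<comment> \<open>Only the argument is extended; the modulus is supplied separately by
    \<open>m\<close>.\<close>
  ultimately obtain \<theta> where \<theta>: "continuous_on UNIV \<theta>" "\<And>x. x \<in> X \<Longrightarrow> \<theta> x = Im (g x)"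
    using Tietze_unbounded[of X "\<lambda>x. Im (g x)" UNIV] by blast
  obtain c where c: "0 < c" "\<And>x. x \<in> X \<Longrightarrow> c \<le> norm (v x)"
    by (rule compact_norm_lower_bound[OF X(1) cv v0]) blast+
  \<comment> \<open>On \<open>X\<close> this is the true modulus because of the lower bound
    \<open>c\<close>. Everywhere it is positive, and it is at most \<open>e\<close> where
    \<open>norm (v x) \<le> e\<close>.\<close>
  define m where "m x = max (norm (v x)) (min c e)" for x
  have m0: "0 < m x" for x using c(1) e by (simp add: m_def less_max_iff_disj)
  define h' where "h' x = w + J' (of_real (m x) * exp (\<i> * of_real (\<theta> x)))" for x
  have nh': "norm (h' x - w) = m x" for x
    using m0[of x] by (simp add: h'_def J(4) norm_mult)
  have eqX: "h' x = h x" if x: "x \<in> X" for x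
  proof -
    have "m x = norm (v x)" using c(2)[OF x] by (simp add: m_def)
    then have "m x = exp (Re (g x))" using g(2)[OF x] by (simp add: norm_exp_eq_Re)
    moreover have "v x = of_real (exp (Re (g x))) * exp (\<i> * of_real (Im (g x)))"
      unfolding g(2)[OF x] by (simp only: exp_eq_polar[of "g x"] cis_conv_exp)
    ultimately have "of_real (m x) * exp (\<i> * of_real (\<theta> x)) = v x"
      using \<theta>(2)[OF x] by simp
    then show ?thesis by (simp add: h'_def v_def J(5))
  qed
  have "continuous_on (cbox a b) h'"
    unfolding h'_def m_def
    by (intro continuous_intros continuous_on_compose2[OF cJ(2)] cv continuous_on_subset[OF \<theta>(1)]) auto
  moreover have "h' x \<noteq> w" for x using nh'[of x] m0[of x] by auto
  moreover have "h' x = h x" if "x \<in> cbox a b" "e \<le> norm (h x - w)" for x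
  proof -
    have "x \<in> X" using X(5) that by (meson DiffI not_le)
    then show ?thesis by (rule eqX)
  qed
  moreover have "norm (h' x - w) \<le> 4 * e" if "norm (h x - w) \<le> e" for x
    unfolding nh' m_def using that e nv[of x] by auto
  ultimately show ?thesis unfolding pushable_def by blast
qed

section \<open>Regularity of Hopf lifts\<close>

text \<open>A point is the lift guided by itself, so \<open>\<lambda>v. hopf_lift v p\<close> is a
  local section of the Hopf map through \<open>p\<close>.\<close>

lemma hopf_lift_self: "hopf_lift (hopf p) p = p"
proof (cases "p = 0")
  case False
  obtain z w where p: "p = (z, w)" by (metis surj_pair)
  define r where "r = (norm p)\<^sup>2"
  have r: "0 < r" using False by (simp add: r_def)
  have rp: "r = (cmod z)\<^sup>2 + (cmod w)\<^sup>2" by (simp add: r_def p norm_Pair)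
  have "hopf_weight (hopf p) p = 2 * r\<^sup>2"
  proof -
    have "p \<bullet> p = r" "norm (hopf p) = r" "hopf p \<bullet> hopf p = r\<^sup>2"
      by (simp_all only: r_def norm_hopf power2_norm_eq_inner[symmetric])
    then show ?thesis by (simp add: hopf_weight_def power2_eq_square)
  qed
  then have "sqrt (2 * hopf_weight (hopf p) p) = 2 * r"
    using r by (intro real_sqrt_unique) (auto simp: power2_eq_square)
  moreover have "hopf_proj (hopf p) p = (2 * r) *\<^sub>R p"
  proof -
    have 1: "norm (hopf p) + snd (hopf p) = 2 * (cmod z)\<^sup>2" "norm (hopf p) - snd (hopf p) = 2 * (cmod w)\<^sup>2"
      unfolding norm_hopf r_def[symmetric] rp by (simp_all add: hopf_def p)
    have 2: "of_real (2 * r) = 2 * (z * cnj z) + 2 * (w * cnj w)"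
      unfolding rp of_real_mult of_real_add complex_norm_square by simp
    show ?thesis
    proof -
      have "of_real (2 * (cmod z)\<^sup>2) * z + 2 * z * cnj w * w = of_real (2 * r) * z"
        "cnj (2 * z * cnj w) * z + of_real (2 * (cmod w)\<^sup>2) * w = of_real (2 * r) * w"
        unfolding 2 unfolding of_real_mult complex_norm_square by (simp_all add: algebra_simps)
      then show ?thesis
        unfolding hopf_proj_def 1 by (simp add: p hopf_def scaleR_conv_of_real)
    qed
  qed
  ultimately show ?thesis using r by (simp add: hopf_lift_def)
qed (simp add: hopf_lift_def hopf_proj_def zero_prod_def)

lemma differentiable_fst_snd:
  assumes "f differentiable (at x within S)"
  shows "(\<lambda>y. fst (f y)) differentiable (at x within S)" "(\<lambda>y. snd (f y)) differentiable (at x within S)"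
  using assms unfolding differentiable_def by (auto intro: has_derivative_fst has_derivative_snd)

lemma differentiable_bounded_linear:
  assumes "bounded_linear l" "f differentiable (at x within S)"
  shows "(\<lambda>y. l (f y)) differentiable (at x within S)"
  using assms unfolding differentiable_def by (auto intro: bounded_linear.has_derivative)

lemma differentiable_hopf:
  assumes "f differentiable (at x within S)"
  shows "(\<lambda>y. hopf (f y)) differentiable (at x within S)"
  unfolding hopf_def power2_norm_eq_inner
  by (intro derivative_intros differentiable_inner differentiable_fst_snd differentiable_bounded_linear[OF bounded_linear_cnj] assms)

lemma differentiable_hopf_lift:
  assumes V: "V differentiable (at x within S)" and P: "P differentiable (at x within S)"
    and nz: "V x \<noteq> 0" and pos: "0 < hopf_weight (V x) (P x)"
  shows "(\<lambda>y. hopf_lift (V y) (P y)) differentiable (at x within S)"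
proof -
  have nV: "(\<lambda>y. norm (V y)) differentiable (at x within S)"
    using differentiable_compose[OF differentiable_norm_at[OF nz] V] .
  have W: "(\<lambda>y. hopf_weight (V y) (P y)) differentiable (at x within S)"
    unfolding hopf_weight_def
    by (intro derivative_intros differentiable_inner differentiable_hopf V P nV)
  have sq: "sqrt differentiable (at (2 * hopf_weight (V x) (P x)))"
    using DERIV_real_sqrt[of "2 * hopf_weight (V x) (P x)"] pos by (auto simp: real_differentiable_def)
  have "(\<lambda>y. sqrt (2 * hopf_weight (V y) (P y))) differentiable (at x within S)"
    by (rule differentiable_compose[where f = sqrt and g = "\<lambda>y. 2 * hopf_weight (V y) (P y)", OF sq])
      (intro derivative_intros W)
  then have 1: "(\<lambda>y. 1 / sqrt (2 * hopf_weight (V y) (P y))) differentiable (at x within S)"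
    using pos by (intro derivative_intros) auto
  have 2: "(\<lambda>y. complex_of_real (f y)) differentiable (at x within S)" if "f differentiable (at x within S)" for f
    by (rule differentiable_bounded_linear[OF bounded_linear_of_real that])
  show ?thesis
    unfolding hopf_lift_def hopf_proj_def
    by (intro derivative_intros 1 2 nV differentiable_fst_snd V P differentiable_bounded_linear[OF bounded_linear_cnj])
qed

text \<open>The local section through \<open>p\<close> is differentiable, and its derivative is a
  right inverse of \<open>D\<close>.\<close>

lemma hopf_submersion:
  assumes "(hopf has_derivative D) (at p)" "p \<noteq> 0"
  shows "range D = UNIV"
proof -
  have nz: "hopf p \<noteq> 0" using assms(2) by simp
  have pos: "0 < hopf_weight (hopf p) p"
    by (rule hopf_weight_pos[OF refl]) (use nz in simp)
  have id: "(\<lambda>v. v) differentiable (at (hopf p))" "(\<lambda>v. p) differentiable (at (hopf p))" by auto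
  obtain E where E: "((\<lambda>v. hopf_lift v p) has_derivative E) (at (hopf p))"
    using differentiable_hopf_lift[OF id nz pos] unfolding differentiable_def by blast
  have "(hopf has_derivative D) (at (hopf_lift (hopf p) p))" using assms(1) by (simp add: hopf_lift_self)
  from diff_chain_at[OF E this]
  have "((\<lambda>v. hopf (hopf_lift v p)) has_derivative (D \<circ> E)) (at (hopf p))" by (simp add: o_def)
  moreover have "open {v. 0 < hopf_weight v p}"
    unfolding hopf_weight_def by (intro open_Collect_less continuous_intros)
  ultimately have "((\<lambda>v. v) has_derivative (D \<circ> E)) (at (hopf p))"
    by (rule has_derivative_transform_within_open) (use pos hopf_hopf_lift in auto)
  then have "D \<circ> E = (\<lambda>v. v)"
    using has_derivative_unique[OF _ has_derivative_ident] by blast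
  then show ?thesis by (metis comp_apply surjI)
qed

text \<open>A lift through the Hopf map has rank at most one more than the map being lifted, so a
  degenerate map lifts to a map with null image.\<close>

lemma negligible_hopf_lift_image:
  fixes h :: "real ^ 'm::{finite,wellorder} \<Rightarrow> real ^ 3" and J :: "real ^ 3 \<Rightarrow> complex \<times> real"
    and P :: "real ^ 'm::{finite,wellorder} \<Rightarrow> complex \<times> complex"
  assumes dims: "CARD('m) = 4"
    and lip: "L-lipschitz_on UNIV h" and J: "linear J" "inj J" and P: "\<And>x. P differentiable (at x)"
    and A: "\<And>x. x \<in> A \<Longrightarrow> J (h x - w) \<noteq> 0" "\<And>x. x \<in> A \<Longrightarrow> 0 < hopf_weight (J (h x - w)) (P x)"
    and ae: "negligible {x \<in> A. \<not> (h differentiable (at x) \<and> x \<in> degenerate_set h)}"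
  shows "negligible ((\<lambda>x. hopf_lift (J (h x - w)) (P x)) ` A)"
proof -
  define F where "F x = hopf_lift (J (h x - w)) (P x)" for x
  define B where "B = {x \<in> A. \<not> (h differentiable (at x) \<and> x \<in> degenerate_set h)}"
  define G where "G = A - B"
  have bJ: "bounded_linear J" using J(1) by (simp add: linear_conv_bounded_linear)
  have L0: "0 \<le> L" using lip lipschitz_on_nonneg by blast
  have conth: "continuous_on UNIV h" using lip lipschitz_on_continuous_on by blast
  have contP: "continuous_on UNIV P"
    using P by (simp add: continuous_on_eq_continuous_at differentiable_imp_continuous_within)
  have contJ: "continuous_on S (\<lambda>x. J (h x - w))" for S
    by (intro bounded_linear.continuous_on[OF bJ] continuous_intros continuous_on_subset[OF conth]) simp
  \<comment> \<open>On the exceptional null set \<open>F\<close> still satisfies a Lipschitz bound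
    at each point, being a differentiable function of the pair \<open>(h x, x)\<close>. The
    dimensions are equal, so null sets go to null sets.\<close>
  have negB: "negligible (F ` B)"
  proof (rule negligible_locally_Lipschitz_image)
    show "negligible B" using ae by (simp add: B_def)
    show "DIM((real, 'm) vec) \<le> DIM(complex \<times> complex)" using dims by simp
    fix x assume "x \<in> B"
    then have x: "x \<in> A" by (simp add: B_def)
    define \<Phi> where "\<Phi> q = hopf_lift (J (fst q - w)) (P (snd q))" for q
    have id: "(\<lambda>q. q) differentiable (at (h x, x))" by simp
    have 1: "(\<lambda>q. J (fst q - w)) differentiable (at (h x, x))"
      by (intro differentiable_bounded_linear[OF bJ] derivative_intros differentiable_fst_snd id)
    have Px: "P differentiable (at (snd (h x, x)))" using P by simp
    have 2: "(\<lambda>q. P (snd q)) differentiable (at (h x, x))"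
      by (rule differentiable_compose[where f = P and g = snd, OF Px differentiable_fst_snd(2)[OF id]])
    have "\<Phi> differentiable (at (h x, x))"
      unfolding \<Phi>_def by (rule differentiable_hopf_lift[OF 1 2]) (use A x in auto)
    then obtain D where D: "(\<Phi> has_derivative D) (at (h x, x))" by (auto simp: differentiable_def)
    have "linear D" using D by (rule has_derivative_linear)
    then obtain K where K: "0 < K" "\<And>q. norm (D q) \<le> K * norm q" using linear_bounded_pos by blast
    obtain d where d: "0 < d" "\<And>q. norm (q - (h x, x)) < d \<Longrightarrow> norm (\<Phi> q - \<Phi> (h x, x) - D (q - (h x, x))) \<le> 1 * norm (q - (h x, x))"
      using D[unfolded has_derivative_at_alt, THEN conjunct2, rule_format, of 1] by auto
    show "\<exists>T C. open T \<and> x \<in> T \<and> (\<forall>y\<in>B \<inter> T. norm (F y - F x) \<le> C * norm (y - x))"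
    proof (intro exI conjI ballI)
      show "open (ball x (d / (L + 1)))" "x \<in> ball x (d / (L + 1))" using d(1) L0 by auto
      fix y assume "y \<in> B \<inter> ball x (d / (L + 1))"
      then have y: "norm (y - x) < d / (L + 1)" by (simp add: dist_norm norm_minus_commute)
      have q: "norm ((h y, y) - (h x, x)) \<le> (L + 1) * norm (y - x)"
      proof -
        have "norm ((h y, y) - (h x, x)) \<le> norm (h y - h x) + norm (y - x)"
          by (simp add: norm_Pair_le)
        also have "norm (h y - h x) \<le> L * norm (y - x)"
          using lipschitz_onD[OF lip, of y x] by (simp add: dist_norm)
        finally show ?thesis by (simp add: algebra_simps)
      qed
      also have "\<dots> < d" using y L0 by (simp add: pos_less_divide_eq mult.commute)
      finally have "norm (\<Phi> (h y, y) - \<Phi> (h x, x) - D ((h y, y) - (h x, x))) \<le> norm ((h y, y) - (h x, x))"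
        using d(2)[of "(h y, y)"] by simp
      then have "norm (\<Phi> (h y, y) - \<Phi> (h x, x)) \<le> norm (D ((h y, y) - (h x, x))) + norm ((h y, y) - (h x, x))"
        by (smt (verit) norm_triangle_sub)
      also have "\<dots> \<le> (K + 1) * norm ((h y, y) - (h x, x))"
        using K(2)[of "(h y, y) - (h x, x)"] by (simp add: algebra_simps)
      also have "\<dots> \<le> (K + 1) * ((L + 1) * norm (y - x))" using q K(1) by (intro mult_left_mono) auto
      finally show "norm (F y - F x) \<le> ((K + 1) * (L + 1)) * norm (y - x)"
        by (simp add: \<Phi>_def F_def mult.assoc)
    qed
  qed
  have Gd: "F differentiable (at x)" if x: "x \<in> G" for x
  proof -
    have "h differentiable (at x)" using x by (auto simp: G_def B_def)
    then have "(\<lambda>x. J (h x - w)) differentiable (at x)"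
      by (intro differentiable_bounded_linear[OF bJ] derivative_intros) auto
    then show ?thesis unfolding F_def using A x P by (intro differentiable_hopf_lift) (auto simp: G_def)
  qed
  \<comment> \<open>Differentiating \<open>hopf (F x) = J (h x - w)\<close> gives
    \<open>E \<circ> D = J \<circ> T\<close>. Since \<open>E\<close> is onto, \<open>D\<close> can
    be onto only if \<open>T\<close> is.\<close>
  have G_deg: "range D \<noteq> UNIV" if x: "x \<in> G" and D: "(F has_derivative D) (at x)" for x D
  proof
    assume surj: "range D = UNIV"
    have xA: "x \<in> A" using x by (simp add: G_def)
    obtain T where T: "(h has_derivative T) (at x)"
      using x by (auto simp: G_def B_def differentiable_def)
    have "x \<in> degenerate_set h" using x by (auto simp: G_def B_def)
    then have nT: "range T \<noteq> UNIV" using degenerate_set_iff[OF T] by simp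
    have hw: "hopf (F x) = J (h x - w)" unfolding F_def by (rule hopf_hopf_lift[OF A(2)[OF xA]])
    then have F0: "F x \<noteq> 0" using A(1)[OF xA] by (metis hopf_eq_0_iff)
    obtain E where E: "(hopf has_derivative E) (at (F x))"
      using differentiable_hopf[OF differentiable_ident[of "at (F x)"]] by (auto simp: differentiable_def)
    have "((\<lambda>x. hopf (F x)) has_derivative (E \<circ> D)) (at x)"
      using diff_chain_at[OF D E] by (simp add: o_def)
    moreover have "open {x. 0 < hopf_weight (J (h x - w)) (P x)}"
      unfolding hopf_weight_def by (intro open_Collect_less continuous_intros contJ contP)
    ultimately have 1: "((\<lambda>x. J (h x - w)) has_derivative (E \<circ> D)) (at x)"
      by (rule has_derivative_transform_within_open) (use A(2)[OF xA] in \<open>auto simp: F_def hopf_hopf_lift\<close>)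
    have 2: "((\<lambda>x. J (h x - w)) has_derivative (\<lambda>u. J (T u))) (at x)"
      by (intro bounded_linear.has_derivative[OF bJ]) (auto intro!: derivative_eq_intros T)
    have eq: "E \<circ> D = (\<lambda>u. J (T u))" by (rule has_derivative_unique[OF 1 2])
    have "range T = UNIV"
    proof (unfold surj_def, rule allI)
      fix b
      have "range E = UNIV" by (rule hopf_submersion[OF E F0])
      then obtain u where "E (D u) = J b" using surj by (metis surjD)
      then have "J (T u) = J b" using eq by (metis comp_apply)
      then have "b = T u" using J(2) by (auto dest: injD)
      then show "\<exists>u. b = T u" by blast
    qed
    then show False using nT by simp
  qed
  have negG: "negligible (F ` G)"
  proof -
    have "DIM(complex \<times> complex) = DIM((real, 'm) vec)" using dims by simp
    \<comment> \<open>Pairs of complex numbers are identified with vectors because Sard's theorem is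
      applied through ranks of matrices.\<close>
    then obtain I :: "complex \<times> complex \<Rightarrow> (real, 'm) vec" and I' where I: "linear I" "linear I'"
      "\<And>x. norm (I x) = norm x" "\<And>y. norm (I' y) = norm y" "\<And>x. I' (I x) = x" "\<And>y. I (I' y) = y"
      by (rule isomorphisms_UNIV_UNIV) blast
    have bI: "bounded_linear I" "bounded_linear I'" using I by (simp_all add: linear_conv_bounded_linear)
    have "negligible ((\<lambda>x. I (F x)) ` G)"
    proof (rule baby_Sard[where f' = "\<lambda>x. frechet_derivative (\<lambda>x. I (F x)) (at x)"])
      fix x assume x: "x \<in> G"
      obtain D where D: "(F has_derivative D) (at x)" using Gd[OF x] by (auto simp: differentiable_def)
      have ID: "((\<lambda>x. I (F x)) has_derivative (\<lambda>u. I (D u))) (at x)"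
        by (rule bounded_linear.has_derivative[OF bI(1) D])
      have eq: "frechet_derivative (\<lambda>x. I (F x)) (at x) = (\<lambda>u. I (D u))"
        using frechet_derivative_at[OF ID] by simp
      show "((\<lambda>x. I (F x)) has_derivative frechet_derivative (\<lambda>x. I (F x)) (at x)) (at x within G)"
        unfolding eq by (rule has_derivative_at_withinI[OF ID])
      have lin: "linear (\<lambda>u. I (D u))" using ID by (rule has_derivative_linear)
      have "\<not> surj (\<lambda>u. I (D u))"
      proof
        assume s: "surj (\<lambda>u. I (D u))"
        have "range D = UNIV"
        proof (unfold surj_def, rule allI)
          fix y obtain u where "I y = I (D u)" using s by (metis surjD)
          then show "\<exists>u. y = D u" using I(5) by metis
        qed
        then show False using G_deg[OF x D] by simp
      qed
      moreover have "(*v) (matrix (\<lambda>u. I (D u))) = (\<lambda>u. I (D u))"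
        using lin by (rule matrix_vector_mul(2))
      ultimately have "rank (matrix (\<lambda>u. I (D u))) \<noteq> CARD('m)"
        using full_rank_surjective[of "matrix (\<lambda>u. I (D u))"] by simp
      moreover have "rank (matrix (\<lambda>u. I (D u))) \<le> CARD('m)"
        using rank_bound[of "matrix (\<lambda>u. I (D u))"] by simp
      ultimately show "rank (matrix (frechet_derivative (\<lambda>x. I (F x)) (at x))) < CARD('m)"
        unfolding eq by simp
    qed simp
    then have "negligible (I' ` (\<lambda>x. I (F x)) ` G)"
    proof (rule negligible_differentiable_image_negligible[rotated])
      show "I' differentiable_on (\<lambda>x. I (F x)) ` G"
        by (rule bounded_linear_imp_differentiable_on[OF bI(2)])
    qed (use dims in simp)
    then show ?thesis by (simp add: image_image I(5))
  qed
  have "F ` A = F ` B \<union> F ` G" by (auto simp: G_def B_def)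
  then show ?thesis using negB negG unfolding F_def by simp
qed

text \<open>The lift may not extend over the removed boxes without zeros. It is extended with small
  values instead, and a point \<open>c\<close> missed by the extension takes over the role of the
  origin. Such a point exists because the lift has null image where \<open>h\<close> is close to
  \<open>w\<close>.\<close>

lemma push_off_space:
  fixes h :: "real ^ 'm::{finite,wellorder} \<Rightarrow> real ^ 3"
  assumes dims: "CARD('m) = 4"
    and lip: "L-lipschitz_on UNIV h"
    and K: "\<And>i. negligible ((\<lambda>x. x $ i) ` {x \<in> cbox a b. h x = w})"
    and ab: "\<And>i. a $ i < b $ i" and fr: "\<And>x. x \<in> frontier (cbox a b) \<Longrightarrow> h x \<noteq> w" and e: "0 < e"
    and ae: "negligible {x \<in> cbox a b. norm (h x - w) \<le> e \<and> \<not> (h differentiable (at x) \<and> x \<in> degenerate_set h)}"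
  shows "pushable h (cbox a b) w e"
proof -
  have h: "continuous_on UNIV h" using lip lipschitz_on_continuous_on by blast
  define \<eta> where "\<eta> = e / 2"
  have \<eta>: "0 < \<eta>" "\<eta> < e" using e by (auto simp: \<eta>_def)
  have box: "hopf_liftable (cbox a b)" for a b :: "(real, 'm) vec"
    by (intro hopf_liftable_convex) auto
  have frL: "hopf_liftable (frontier (cbox a b))" if "\<And>i. a $ i < b $ i" for a b :: "(real, 'm) vec"
  proof -
    have "box a b \<noteq> {}" using that by (simp add: interval_ne_empty_cart)
    then have "frontier (cbox a b) homeomorphic sphere (0 :: (real ^ 3) \<times> real) 1"
      using dims by (intro homeomorphic_frontier_cbox_sphere) auto
    moreover have "hopf_liftable (sphere (0 :: (real ^ 3) \<times> real) 1)" by (rule hopf_liftable_sphere) simp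
    ultimately show ?thesis using homeomorphic_hopf_liftable homeomorphic_sym by blast
  qed
  have unL: "hopf_liftable (S \<union> T)"
    if "compact S" "compact T" "hopf_liftable S" "hopf_liftable T" "convex (S \<inter> T)" "S \<inter> T \<noteq> {}" for S T :: "((real, 'm) vec) set"
    using that by (intro hopf_liftable_Un) (auto simp: compact_imp_closed convex_imp_Borsukian)
  have "\<exists>X. compact X \<and> X \<subseteq> cbox a b \<and> hopf_liftable X \<and> (\<forall>x\<in>X. h x \<noteq> w) \<and> (\<forall>x\<in>cbox a b - X. norm (h x - w) < \<eta>)"
    by (rule skeleton_avoiding_fiber[OF h K ab fr \<eta>(1) box frL unL]) simp_all
  then obtain X where X: "compact X" "X \<subseteq> cbox a b" "hopf_liftable X" "\<forall>x\<in>X. h x \<noteq> w"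
     "\<forall>x\<in>cbox a b - X. norm (h x - w) < \<eta>" by blast
  obtain J :: "real ^ 3 \<Rightarrow> complex \<times> real" and J' where J: "linear J" "linear J'" "\<And>x. norm (J x) = norm x"
     "\<And>y. norm (J' y) = norm y" "\<And>x. J' (J x) = x" "\<And>y. J (J' y) = y"
    using isomorphisms_UNIV_UNIV[where 'M="real ^ 3" and 'N="complex \<times> real"] by auto
  have bJ: "bounded_linear J" "bounded_linear J'" using J by (simp_all add: linear_conv_bounded_linear)
  define v where "v x = J (h x - w)" for x
  have cv: "continuous_on S v" for S
    unfolding v_def by (intro bounded_linear.continuous_on[OF bJ(1)] continuous_intros continuous_on_subset[OF h]) simp
  have nv: "norm (v x) = norm (h x - w)" for x by (simp add: v_def J(3))
  have v0: "v x \<noteq> 0" if "x \<in> X" for x using X(4) that nv[of x] by (metis norm_eq_zero right_minus_eq)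
  obtain F0 where F0: "continuous_on X F0" "\<And>x. x \<in> X \<Longrightarrow> hopf (F0 x) = v x"
    using X(3)[unfolded hopf_liftable_def, rule_format, of v] cv v0 by blast
  obtain m where m: "0 < m" "\<And>x. x \<in> X \<Longrightarrow> m \<le> norm (v x)"
    by (rule compact_norm_lower_bound[OF X(1) cv v0]) blast+
  \<comment> \<open>\<open>F0\<close> is merely continuous. A polynomial close to it is a guide for
    a new lift \<open>F\<close>, whose regularity comes from that of \<open>h\<close>.\<close>
  obtain P where P: "polynomial_function P" "\<And>x. x \<in> X \<Longrightarrow> 0 < hopf_weight (v x) (P x)"
  proof -
    have "bounded (F0 ` X)" using compact_continuous_image[OF F0(1) X(1)] by (rule compact_imp_bounded)
    then obtain r where r: "\<And>x. x \<in> X \<Longrightarrow> norm (F0 x) \<le> r" unfolding bounded_iff by blast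
    \<comment> \<open>This ball contains the values of \<open>F0\<close> and of every approximation
      to it within distance 1.\<close>
    have "uniformly_continuous_on (cball 0 (r + 1)) hopf"
      by (intro compact_uniformly_continuous continuous_intros compact_cball)
    then obtain \<delta> where \<delta>: "0 < \<delta>" "\<And>p q. p \<in> cball 0 (r + 1) \<Longrightarrow> q \<in> cball 0 (r + 1) \<Longrightarrow> dist q p < \<delta> \<Longrightarrow> dist (hopf q) (hopf p) < m / 2"
      unfolding uniformly_continuous_on_def using m(1) by (metis half_gt_zero)
    obtain P where P: "polynomial_function P" "\<And>x. x \<in> X \<Longrightarrow> norm (F0 x - P x) < min \<delta> 1"
      using Stone_Weierstrass_polynomial_function[OF X(1) F0(1), of "min \<delta> 1"] \<delta>(1) by auto
    have "0 < hopf_weight (v x) (P x)" if x: "x \<in> X" for x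
    proof (rule hopf_weight_pos[OF refl])
      have "norm (P x) \<le> norm (F0 x) + norm (F0 x - P x)" by (metis norm_minus_commute norm_triangle_sub)
      then have "F0 x \<in> cball 0 (r + 1)" "P x \<in> cball 0 (r + 1)" using r[OF x] P(2)[OF x] by auto
      then have "dist (hopf (F0 x)) (hopf (P x)) < m / 2"
        using P(2)[OF x] by (intro \<delta>(2)) (auto simp: dist_norm)
      then have 1: "norm (v x - hopf (P x)) < m / 2" using F0(2)[OF x] by (simp add: dist_norm)
      then have "m / 2 < norm (hopf (P x))"
        using m(2)[OF x] norm_triangle_sub[of "v x" "hopf (P x)"] by linarith
      then show "norm (v x - hopf (P x)) < norm (hopf (P x))" using 1 by linarith
    qed
    then show ?thesis using that P(1) by blast
  qed
  define F where "F x = hopf_lift (v x) (P x)" for x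
  have hF: "hopf (F x) = v x" if "x \<in> X" for x unfolding F_def by (rule hopf_hopf_lift[OF P(2)[OF that]])
  have nF: "(norm (F x))\<^sup>2 = norm (v x)" if "x \<in> X" for x using hF[OF that] norm_hopf by metis
  have cF: "continuous_on X F"
    unfolding F_def using P cv by (intro continuous_on_hopf_lift) (auto simp: continuous_on_polymonial_function)
  define A where "A = {x \<in> X. norm (v x) \<le> e}"
  have negA: "negligible (F ` A)"
    unfolding F_def v_def
  proof (rule negligible_hopf_lift_image[OF dims lip J(1)])
    show "inj J" using J(5) by (rule inj_on_inverseI)
    show "P differentiable (at x)" for x using P(1) by (rule differentiable_at_polynomial_function)
    show "J (h x - w) \<noteq> 0" "0 < hopf_weight (J (h x - w)) (P x)" if "x \<in> A" for x
      using that v0 P(2) unfolding A_def v_def by auto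
    show "negligible {x \<in> A. \<not> (h differentiable (at x) \<and> x \<in> degenerate_set h)}"
      by (rule negligible_subset[OF ae]) (use X(2) in \<open>auto simp: A_def nv\<close>)
  qed
  \<comment> \<open>Squared norm above \<open>\<eta>\<close> keeps \<open>c\<close> out of reach of
    the extension; squared norm below \<open>e\<close> allows the map to stay unchanged where
    \<open>h\<close> is at distance at least \<open>e\<close> from \<open>w\<close>.\<close>
  obtain c where c: "\<eta> < (norm c)\<^sup>2" "(norm c)\<^sup>2 < e" "c \<notin> F ` A"
  proof -
    have "open {c :: complex \<times> complex. \<eta> < (norm c)\<^sup>2 \<and> (norm c)\<^sup>2 < e}"
      by (intro open_Collect_conj open_Collect_less continuous_intros)
    moreover have "(complex_of_real (sqrt (3 * e / 4)), 0) \<in> {c :: complex \<times> complex. \<eta> < (norm c)\<^sup>2 \<and> (norm c)\<^sup>2 < e}"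
      using e by (simp add: norm_Pair \<eta>_def)
    ultimately have "\<not> negligible {c :: complex \<times> complex. \<eta> < (norm c)\<^sup>2 \<and> (norm c)\<^sup>2 < e}"
      using open_not_negligible by blast
    then have "\<not> {c :: complex \<times> complex. \<eta> < (norm c)\<^sup>2 \<and> (norm c)\<^sup>2 < e} \<subseteq> F ` A"
      using negA negligible_subset by blast
    then show ?thesis using that by blast
  qed
  define S where "S = {x \<in> cbox a b. norm (v x) \<le> \<eta>}"
  have "closed S"
  proof -
    have "S = cbox a b \<inter> {x. norm (v x) \<le> \<eta>}" by (auto simp: S_def)
    then show ?thesis by (simp only: closed_Int closed_cbox closed_Collect_le continuous_intros cv)
  qed
  have "closedin (top_of_set S) (X \<inter> S)"
    using X(1) by (metis closedin_closed_Int compact_imp_closed inf_commute)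
  moreover have "continuous_on (X \<inter> S) F" using cF continuous_on_subset by blast
  moreover have "F ` (X \<inter> S) \<subseteq> cball 0 (sqrt \<eta>)"
  proof
    fix z assume "z \<in> F ` (X \<inter> S)"
    then obtain x where "x \<in> X" "x \<in> S" "z = F x" by blast
    then have "(norm z)\<^sup>2 \<le> \<eta>" using nF by (simp add: S_def)
    then show "z \<in> cball 0 (sqrt \<eta>)" by (simp add: real_le_rsqrt)
  qed
  moreover have "cball (0 :: complex \<times> complex) (sqrt \<eta>) \<noteq> {}" using \<eta>(1) by simp
  \<comment> \<open>Dugundji's extension stays in the convex ball that contains the given values, so
    \<open>g\<close> remains below the norm of \<open>c\<close>.\<close>
  ultimately obtain g where g: "continuous_on S g" "g ` S \<subseteq> cball 0 (sqrt \<eta>)" "\<And>x. x \<in> X \<inter> S \<Longrightarrow> g x = F x"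
    using Dugundji[of "cball 0 (sqrt \<eta>)" S "X \<inter> S" F] convex_cball by blast
  \<comment> \<open>Off \<open>X\<close> the values of \<open>h\<close> are within
    \<open>\<eta>\<close> of \<open>w\<close>, so \<open>F\<close> is a lift on all of
    \<open>T\<close>.\<close>
  define T where "T = {x \<in> cbox a b. \<eta> \<le> norm (v x)}"
  have TX: "T \<subseteq> X" using X(5) by (auto simp: T_def nv) (meson DiffI mem_box(2) not_le)
  have "closed T"
  proof -
    have "T = cbox a b \<inter> {x. \<eta> \<le> norm (v x)}" by (auto simp: T_def)
    then show ?thesis by (simp only: closed_Int closed_cbox closed_Collect_le continuous_intros cv)
  qed
  define H where "H x = (if x \<in> T then F x else g x)" for x
  have "continuous_on (T \<union> S) H"
    unfolding H_def
  proof (rule continuous_on_cases[OF \<open>closed T\<close> \<open>closed S\<close> _ g(1)])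
    show "continuous_on T F" using cF TX continuous_on_subset by blast
    show "\<forall>x. x \<in> T \<and> x \<notin> T \<or> x \<in> S \<and> x \<in> T \<longrightarrow> F x = g x" using g(3) TX by auto
  qed
  moreover have TS: "T \<union> S = cbox a b" by (auto simp: T_def S_def)
  ultimately have cH: "continuous_on (cbox a b) H" by simp
  have H1: "hopf (H x) = v x" "(norm (H x))\<^sup>2 = norm (v x)" "H x = F x" if "x \<in> T" for x
    using that TX hF nF by (auto simp: H_def)
  have H2: "(norm (H x))\<^sup>2 \<le> \<eta>" if "x \<in> cbox a b" "x \<notin> T" for x
  proof -
    have "x \<in> S" using that TS by blast
    then have "norm (H x) \<le> sqrt \<eta>" using g(2) that(2) by (auto simp: H_def)
    then have "(norm (H x))\<^sup>2 \<le> (sqrt \<eta>)\<^sup>2" by (intro power_mono) auto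
    then show ?thesis using \<eta>(1) by simp
  qed
  have Hc: "H x \<noteq> c" if x: "x \<in> cbox a b" for x
  proof (cases "x \<in> T")
    case True
    show ?thesis
    proof (cases "norm (v x) \<le> e")
      case le: True
      then have "x \<in> A" using True TX by (auto simp: A_def)
      then show ?thesis using c(3) H1(3)[OF True] by auto
    next
      case False
      then show ?thesis using c(2) H1(2)[OF True] by auto
    qed
  next
    case False
    then show ?thesis using H2[OF x False] c(1) by auto
  qed
  have cpos: "norm c < sqrt e" using c(2) by (simp add: real_less_rsqrt)
  \<comment> \<open>It is 1 up to the norm of \<open>c\<close> and 0 from \<open>sqrt e\<close> on.
    Thus \<open>R\<close> carries \<open>c\<close> and no other point to the origin, and fixes every
    point of norm at least \<open>sqrt e\<close>.\<close>
  define taper where "taper z = max 0 (min 1 ((sqrt e - norm z) / (sqrt e - norm c)))" for z :: "complex \<times> complex"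
  define R where "R z = z - taper z *\<^sub>R c" for z
  have taper01: "0 \<le> taper z" "taper z \<le> 1" for z by (auto simp: taper_def)
  have R0: "R z \<noteq> 0" if "z \<noteq> c" for z
  proof
    assume "R z = 0"
    then have z: "z = taper z *\<^sub>R c" by (simp add: R_def)
    then have "norm z = taper z * norm c" using taper01(1)[of z] by (metis abs_of_nonneg norm_scaleR)
    also have "\<dots> \<le> 1 * norm c" using taper01 by (intro mult_right_mono) auto
    finally have "1 \<le> (sqrt e - norm z) / (sqrt e - norm c)" using cpos by (simp add: pos_le_divide_eq)
    then have "taper z = 1" by (simp add: taper_def)
    then show False using z that by simp
  qed
  have Rid: "R z = z" if "e \<le> (norm z)\<^sup>2" for z
  proof -
    have "sqrt e \<le> norm z" using that by (simp add: real_le_lsqrt)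
    then have "(sqrt e - norm z) / (sqrt e - norm c) \<le> 0" using cpos by (simp add: divide_le_0_iff)
    then show ?thesis by (simp add: R_def taper_def)
  qed
  have Rn: "(norm (R z))\<^sup>2 \<le> 4 * e" if "(norm z)\<^sup>2 \<le> e" for z
  proof -
    have "norm z \<le> sqrt e" using that by (simp add: real_le_rsqrt)
    moreover have "norm (taper z *\<^sub>R c) \<le> 1 * norm c" using mult_right_mono[OF taper01(2)[of z], of "norm c"] taper01(1)[of z] by simp
    ultimately have "norm (R z) \<le> 2 * sqrt e" unfolding R_def using cpos norm_triangle_ineq4[of z "taper z *\<^sub>R c"] by linarith
    then have "(norm (R z))\<^sup>2 \<le> (2 * sqrt e)\<^sup>2" by (intro power_mono) auto
    then show ?thesis using e by (simp add: power_mult_distrib)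
  qed
  define h' where "h' x = w + J' (hopf (R (H x)))" for x
  have "sqrt e - norm c \<noteq> 0" using cpos by simp
  then have "continuous_on (cbox a b) h'"
    unfolding h'_def R_def taper_def
    by (intro continuous_intros bounded_linear.continuous_on[OF bJ(2)] cH) auto
  moreover have "h' x \<noteq> w" if "x \<in> cbox a b" for x
  proof
    assume "h' x = w"
    then have "J' (hopf (R (H x))) = 0" by (simp add: h'_def)
    then have "norm (hopf (R (H x))) = 0" using J(4) by (metis norm_zero)
    then show False using R0[OF Hc[OF that]] by simp
  qed
  moreover have "h' x = h x" if "x \<in> cbox a b" "e \<le> norm (h x - w)" for x
  proof -
    have "x \<in> T" using that \<eta> by (simp add: T_def nv)
    then have "R (H x) = H x" using H1(2) that(2) nv by (intro Rid) simp
    then show ?thesis using H1(1)[OF \<open>x \<in> T\<close>] by (simp add: h'_def v_def J(5))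
  qed
  moreover have "norm (h' x - w) \<le> 4 * e" if "x \<in> cbox a b" "norm (h x - w) \<le> e" for x
  proof -
    have "(norm (H x))\<^sup>2 \<le> e" using H1(2)[of x] H2[OF that(1)] \<eta> that(2) nv by (cases "x \<in> T") auto
    then have "norm (hopf (R (H x))) \<le> 4 * e" unfolding norm_hopf by (rule Rn)
    then show ?thesis by (simp add: h'_def J(4))
  qed
  ultimately show ?thesis unfolding pushable_def by blast
qed

section \<open>Hausdorff measure of closed sets\<close>

lemma hausdorff_content_antimono:
  assumes "\<delta> \<le> \<delta>'"
  shows "hausdorff_content d \<delta>' A \<le> hausdorff_content d \<delta> A"
  unfolding hausdorff_content_def using assms by (intro INF_superset_mono) (auto intro: order_trans)

text \<open>A set of diameter at most \<open>\<delta>\<close> cannot meet both parts, so each cover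
  of the union splits into a cover of \<open>A\<close> and one of \<open>B\<close>.\<close>

lemma hausdorff_content_separated:
  assumes sep: "\<And>x y. x \<in> A \<Longrightarrow> y \<in> B \<Longrightarrow> \<delta> < dist x y"
  shows "hausdorff_content d \<delta> A + hausdorff_content d \<delta> B \<le> hausdorff_content d \<delta> (A \<union> B)"
  unfolding hausdorff_content_def[of d \<delta> "A \<union> B"]
proof (rule INF_greatest)
  fix U :: "nat \<Rightarrow> 'a set"
  assume "U \<in> {U. (\<forall>i. bounded (U i) \<and> diameter (U i) \<le> \<delta>) \<and> A \<union> B \<subseteq> (\<Union>i. U i)}"
  then have U: "\<And>i. bounded (U i)" "\<And>i. diameter (U i) \<le> \<delta>" "A \<union> B \<subseteq> (\<Union>i. U i)" by auto
  define UA where "UA i = (if U i \<inter> A = {} then {} else U i)" for i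
  define UB where "UB i = (if U i \<inter> B = {} then {} else U i)" for i
  have disj: "UA i = {} \<or> UB i = {}" for i
  proof (rule ccontr)
    assume "\<not> ?thesis"
    then obtain x y where "x \<in> U i \<inter> A" "y \<in> U i \<inter> B" unfolding UA_def UB_def by (meson ex_in_conv)
    then have "\<delta> < dist x y" "dist x y \<le> diameter (U i)" using sep U(1) diameter_bounded_bound by blast+
    then show False using U(2)[of i] by simp
  qed
  have "0 \<le> \<delta>" using U(2)[of 0] diameter_ge_0[OF U(1)[of 0]] by linarith
  then have cov: "UA \<in> {U. (\<forall>i. bounded (U i) \<and> diameter (U i) \<le> \<delta>) \<and> A \<subseteq> (\<Union>i. U i)}"
    "UB \<in> {U. (\<forall>i. bounded (U i) \<and> diameter (U i) \<le> \<delta>) \<and> B \<subseteq> (\<Union>i. U i)}"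
    using U unfolding UA_def UB_def by (auto simp: subset_iff) (metis IntI empty_iff)+
  have "hausdorff_content d \<delta> A + hausdorff_content d \<delta> B \<le> (\<Sum>i. hausdorff_weight d (UA i)) + (\<Sum>i. hausdorff_weight d (UB i))"
    unfolding hausdorff_content_def using cov by (intro add_mono INF_lower)
  also have "\<dots> = (\<Sum>i. hausdorff_weight d (UA i) + hausdorff_weight d (UB i))"
    by (rule suminf_add) auto
  also have "\<dots> \<le> (\<Sum>i. hausdorff_weight d (U i))"
  proof (rule suminf_le)
    fix i
    show "hausdorff_weight d (UA i) + hausdorff_weight d (UB i) \<le> hausdorff_weight d (U i)"
    proof -
      have "UA i = {} \<or> UA i = U i" "UB i = {} \<or> UB i = U i" by (auto simp: UA_def UB_def)
      moreover have "hausdorff_weight d ({} :: 'a set) = 0" by (simp add: hausdorff_weight_def)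
      ultimately show ?thesis using disj[of i] by auto
    qed
  qed auto
  finally show "hausdorff_content d \<delta> A + hausdorff_content d \<delta> B \<le> (\<Sum>i. hausdorff_weight d (U i))" .
qed

lemma hausdorff_outer_measure_separated:
  assumes sep: "\<And>x y. x \<in> A \<Longrightarrow> y \<in> B \<Longrightarrow> r \<le> dist x y" and r: "0 < r"
  shows "hausdorff_outer_measure d A + hausdorff_outer_measure d B \<le> hausdorff_outer_measure d (A \<union> B)"
proof -
  have 1: "hausdorff_content d \<alpha> A + hausdorff_content d \<beta> B \<le> hausdorff_outer_measure d (A \<union> B)"
    if "0 < \<alpha>" "0 < \<beta>" for \<alpha> \<beta>
  proof -
    \<comment> \<open>Refining the scale only increases contents, and below \<open>r\<close> the two
      sets are separated at that scale.\<close>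
    define \<delta> where "\<delta> = min (min \<alpha> \<beta>) (r / 2)"
    have \<delta>: "0 < \<delta>" "\<delta> \<le> \<alpha>" "\<delta> \<le> \<beta>" "\<delta> < r" using that r by (auto simp: \<delta>_def)
    have "hausdorff_content d \<alpha> A + hausdorff_content d \<beta> B \<le> hausdorff_content d \<delta> A + hausdorff_content d \<delta> B"
      using \<delta> by (intro add_mono hausdorff_content_antimono)
    also have "\<dots> \<le> hausdorff_content d \<delta> (A \<union> B)"
      using sep \<delta>(4) by (intro hausdorff_content_separated) (meson less_le_trans)
    also have "\<dots> \<le> hausdorff_outer_measure d (A \<union> B)"
      unfolding hausdorff_outer_measure_def using \<delta>(1) by (intro SUP_upper) simp
    finally show ?thesis .
  qed
  have ne: "{0::real<..} \<noteq> {}" by auto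
  have 2: "hausdorff_outer_measure d A + hausdorff_content d \<beta> B \<le> hausdorff_outer_measure d (A \<union> B)" if "0 < \<beta>" for \<beta>
    unfolding hausdorff_outer_measure_def[of d A]
    using 1 that ne by (subst ennreal_SUP_add_left[symmetric]) (auto intro!: SUP_least)
  show ?thesis
    unfolding hausdorff_outer_measure_def[of d B]
    using 2 ne by (subst add.commute, subst ennreal_SUP_add_left[symmetric]) (auto simp: add.commute intro!: SUP_least)
qed

lemma hausdorff_outer_measure_mono:
  "A \<subseteq> B \<Longrightarrow> hausdorff_outer_measure d A \<le> hausdorff_outer_measure d B"
  using outer_measure_space_hausdorff[of d] by (auto simp: outer_measure_space_def increasing_def)

lemma hausdorff_outer_measure_empty [simp]: "hausdorff_outer_measure d {} = 0"
  using outer_measure_space_hausdorff[of d] by (auto simp: outer_measure_space_def positive_def)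

lemma hausdorff_outer_measure_UN:
  "disjoint_family A \<Longrightarrow> hausdorff_outer_measure d (\<Union>i. A i) \<le> (\<Sum>i. hausdorff_outer_measure d (A i :: 'a::metric_space set))"
  using outer_measure_space_hausdorff[where 'a='a and d=d] by (auto simp: outer_measure_space_def countably_subadditive_def)

lemma hausdorff_outer_measure_Un:
  assumes "A \<inter> B = {}"
  shows "hausdorff_outer_measure d (A \<union> B) \<le> hausdorff_outer_measure d A + hausdorff_outer_measure d B"
proof -
  have "hausdorff_outer_measure d (\<Union>i. binaryset A B i) \<le> (\<Sum>i. hausdorff_outer_measure d (binaryset A B i))"
    using assms by (intro hausdorff_outer_measure_UN) (auto simp: disjoint_family_on_def binaryset_def)
  then show ?thesis by (simp add: UN_binaryset_eq suminf_binaryset_eq)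
qed

text \<open>Caratheodory's criterion: the part of \<open>A\<close> outside the closed set is exhausted by sets at positive
  distance from it, and the successive differences of these, taken with even or with odd index, are
  separated from each other, so their measures are summable.\<close>

lemma hausdorff_outer_measure_closed_split:
  fixes C :: "'a::metric_space set"
  assumes C: "closed C"
  shows "hausdorff_outer_measure d (A \<inter> C) + hausdorff_outer_measure d (A - C) \<le> hausdorff_outer_measure d A"
proof (cases "C = {} \<or> hausdorff_outer_measure d A = \<infinity>")
  case True
  then show ?thesis by auto
next
  case False
  then have Cne: "C \<noteq> {}" and fin: "hausdorff_outer_measure d A < \<infinity>" by (auto simp: less_top)
  define \<mu> where "\<mu> = (hausdorff_outer_measure d :: 'a set \<Rightarrow> ennreal)"
  define D where "D n = {x \<in> A. 1 / real (Suc n) \<le> infdist x C}" for n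
  define R where "R k = D (Suc k) - D k" for k
  have mono: "\<mu> S \<le> \<mu> T" if "S \<subseteq> T" for S T unfolding \<mu>_def using that by (rule hausdorff_outer_measure_mono)
  have DA: "D n \<subseteq> A - C" for n
  proof
    fix x assume x: "x \<in> D n"
    have "x \<notin> C"
    proof
      assume "x \<in> C"
      then have "1 / real (Suc n) \<le> 0" using x by (simp add: D_def)
      then show False by simp
    qed
    then show "x \<in> A - C" using x by (simp add: D_def)
  qed
  have Dmono: "D m \<subseteq> D n" if "m \<le> n" for m n
  proof -
    have "1 / real (Suc n) \<le> 1 / real (Suc m)" using that by (simp add: frac_le)
    then show ?thesis by (auto simp: D_def)
  qed
  have infd: "infdist x C \<le> dist x y + infdist y C" for x y
    using infdist_triangle[of x C y] by (simp add: add.commute)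
  have sepD: "\<mu> (A \<inter> C) + \<mu> (D n) \<le> \<mu> A" for n
  proof -
    have "\<mu> (A \<inter> C) + \<mu> (D n) \<le> \<mu> ((A \<inter> C) \<union> D n)"
      unfolding \<mu>_def
    proof (rule hausdorff_outer_measure_separated)
      show "1 / real (Suc n) \<le> dist x y" if "x \<in> A \<inter> C" "y \<in> D n" for x y
        using that infdist_le[of x C y] by (auto simp: D_def dist_commute)
    qed simp
    also have "\<dots> \<le> \<mu> A" using DA by (intro mono) auto
    finally show ?thesis .
  qed
  \<comment> \<open>Distances to \<open>C\<close> are at least 1 / (k + 1) on \<open>D k\<close> and
    less than 1 / (k + 2) on \<open>R (Suc k)\<close>; skipping one index opens this gap.\<close>
  have sepR: "\<mu> (D k) + \<mu> (R (Suc k)) \<le> \<mu> (D (Suc (Suc k)))" for k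
  proof -
    have "\<mu> (D k) + \<mu> (R (Suc k)) \<le> \<mu> (D k \<union> R (Suc k))"
      unfolding \<mu>_def
    proof (rule hausdorff_outer_measure_separated)
      show "1 / real (Suc k) - 1 / real (Suc (Suc k)) \<le> dist x y" if "x \<in> D k" "y \<in> R (Suc k)" for x y
        using that infd[of x y] by (auto simp: D_def R_def)
      have "1 / real (Suc (Suc k)) < 1 / real (Suc k)" by (intro divide_strict_left_mono) auto
      then show "0 < 1 / real (Suc k) - 1 / real (Suc (Suc k))" by simp
    qed
    also have "\<dots> \<le> \<mu> (D (Suc (Suc k)))"
      using Dmono[of k "Suc (Suc k)"] by (intro mono) (auto simp: R_def)
    finally show ?thesis .
  qed
  \<comment> \<open>\<open>q = 0\<close> collects the odd indices and \<open>q = 1\<close> the even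
    ones from 2 on.\<close>
  have half: "(\<Sum>j<n. \<mu> (R (2 * j + Suc q))) \<le> \<mu> (D (2 * n + q))" for n q
  proof (induction n)
    case (Suc n)
    have "(\<Sum>j<Suc n. \<mu> (R (2 * j + Suc q))) \<le> \<mu> (D (2 * n + q)) + \<mu> (R (Suc (2 * n + q)))"
      using Suc by (simp add: add_right_mono)
    also have "\<dots> \<le> \<mu> (D (Suc (Suc (2 * n + q))))" by (rule sepR)
    finally show ?case by simp
  qed simp
  have total: "(\<Sum>k<n. \<mu> (R (Suc k))) \<le> 2 * \<mu> A" for n
  proof -
    have "(\<Sum>k<n. \<mu> (R (Suc k))) \<le> (\<Sum>k<2 * n. \<mu> (R (Suc k)))"
      by (rule sum_mono2) auto
    also have "\<dots> = (\<Sum>j<n. \<mu> (R (2 * j + Suc 0))) + (\<Sum>j<n. \<mu> (R (2 * j + Suc 1)))"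
      by (induction n) (auto simp: add_ac)
    also have "\<dots> \<le> \<mu> A + \<mu> A"
      using DA by (intro add_mono order_trans[OF half] mono) auto
    finally show ?thesis by (simp add: mult_2)
  qed
  have Rfin: "\<mu> (R k) < \<infinity>" for k
    using mono[of "R k" A] DA fin unfolding \<mu>_def[symmetric] R_def by (meson Diff_subset le_less_trans order_trans)
  define \<rho> where "\<rho> k = enn2real (\<mu> (R (Suc k)))" for k
  have \<rho>: "ennreal (\<rho> k) = \<mu> (R (Suc k))" "0 \<le> \<rho> k" for k
    using Rfin[of "Suc k"] by (auto simp: \<rho>_def)
  have "summable \<rho>"
  proof (rule summableI_nonneg_bounded)
    fix n
    have "ennreal (\<Sum>k<n. \<rho> k) = (\<Sum>k<n. \<mu> (R (Suc k)))"
      using \<rho> by (simp add: sum_ennreal[symmetric])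
    also have "\<dots> \<le> 2 * \<mu> A" by (rule total)
    also have "\<dots> = ennreal (2 * enn2real (\<mu> A))"
      using fin by (simp add: \<mu>_def ennreal_mult)
    finally show "(\<Sum>k<n. \<rho> k) \<le> 2 * enn2real (\<mu> A)"
      by (subst (asm) ennreal_le_iff) auto
  qed (rule \<rho>)
  have "\<mu> (A \<inter> C) + \<mu> (A - C) \<le> \<mu> A + ennreal e" if e: "0 < e" for e
  proof -
    obtain N where N: "norm (\<Sum>i. \<rho> (i + N)) < e"
      using suminf_exist_split[OF e \<open>summable \<rho>\<close>] by blast
    have sN: "summable (\<lambda>i. \<rho> (i + N))" using \<open>summable \<rho>\<close> by (rule summable_ignore_initial_segment)
    \<comment> \<open>The least \<open>m\<close> with \<open>x \<in> D m\<close> places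
      \<open>x\<close> in one successive difference; the differences used here have total measure
      below \<open>e\<close>.\<close>
    have "A - C \<subseteq> D (Suc N) \<union> (\<Union>i. R (Suc (i + N)))"
    proof
      fix x assume x: "x \<in> A - C"
      then have "0 < infdist x C"
        using C Cne by (simp add: in_closed_iff_infdist_zero infdist_nonneg less_le)
      then obtain n where "1 / real (Suc n) < infdist x C" using nat_approx_posE by metis
      then have "x \<in> D n" using x by (simp add: D_def)
      show "x \<in> D (Suc N) \<union> (\<Union>i. R (Suc (i + N)))"
      proof (cases "x \<in> D (Suc N)")
        case False
        define m where "m = (LEAST n. x \<in> D n)"
        have m: "x \<in> D m" unfolding m_def using \<open>x \<in> D n\<close> by (rule LeastI)
        have "Suc N < m" using False m Dmono by (meson not_le subsetD)
        then obtain i where i: "m = Suc (Suc (i + N))" by (metis add.commute add_Suc less_natE)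
        have "x \<notin> D (Suc (i + N))" using not_less_Least[of "Suc (i + N)" "\<lambda>n. x \<in> D n"] i unfolding m_def by simp
        then have "x \<in> R (Suc (i + N))" using m i by (simp add: R_def)
        then show ?thesis by blast
      qed simp
    qed
    then have "\<mu> (A - C) \<le> \<mu> (D (Suc N) \<union> (\<Union>i. R (Suc (i + N))))" by (rule mono)
    also have "\<dots> \<le> \<mu> (D (Suc N)) + \<mu> (\<Union>i. R (Suc (i + N)))"
    proof -
      have "D (Suc N) \<inter> R (Suc (i + N)) = {}" for i
        using Dmono[of "Suc N" "Suc (i + N)"] by (auto simp: R_def)
      then show ?thesis unfolding \<mu>_def by (intro hausdorff_outer_measure_Un) blast
    qed
    also have "\<mu> (\<Union>i. R (Suc (i + N))) \<le> (\<Sum>i. \<mu> (R (Suc (i + N))))"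
      unfolding \<mu>_def
    proof (rule hausdorff_outer_measure_UN)
      have "R i \<inter> R j = {}" if "i < j" for i j
        using Dmono[of "Suc i" j] that by (auto simp: R_def)
      then have dis: "R i \<inter> R j = {}" if "i \<noteq> j" for i j
        using that by (metis inf_commute nat_neq_iff)
      show "disjoint_family (\<lambda>i. R (Suc (i + N)))"
        unfolding disjoint_family_on_def by (auto intro!: dis)
    qed
    also have "(\<Sum>i. \<mu> (R (Suc (i + N)))) = ennreal (\<Sum>i. \<rho> (i + N))"
      unfolding \<rho>(1)[symmetric] by (rule suminf_ennreal2) (use \<rho> sN in auto)
    also have "\<dots> \<le> ennreal e" using N by (intro ennreal_leI) simp
    finally have "\<mu> (A - C) \<le> \<mu> (D (Suc N)) + ennreal e" by (simp add: add_left_mono)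
    then have "\<mu> (A \<inter> C) + \<mu> (A - C) \<le> \<mu> (A \<inter> C) + (\<mu> (D (Suc N)) + ennreal e)" by (rule add_left_mono)
    also have "\<dots> \<le> \<mu> A + ennreal e" using sepD[of "Suc N"] by (simp add: add.assoc[symmetric] add_right_mono)
    finally show ?thesis .
  qed
  then have "\<mu> (A \<inter> C) + \<mu> (A - C) \<le> \<mu> A"
    by (rule ennreal_le_epsilon)
  then show ?thesis by (simp add: \<mu>_def)
qed

lemma closed_in_sets_hausdorff_measure:
  fixes C :: "'a::metric_space set"
  assumes "closed C"
  shows "C \<in> sets (hausdorff_measure d)"
  unfolding sets_hausdorff_measure lambda_system_def
proof (intro CollectI conjI ballI)
  fix A :: "'a set"
  have "hausdorff_outer_measure d A \<le> hausdorff_outer_measure d (A \<inter> C) + hausdorff_outer_measure d (A - C)"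
    using hausdorff_outer_measure_Un[of "A \<inter> C" "A - C" d] by (simp add: Int_Diff_Un Int_Diff_disjoint)
  moreover have "C \<inter> A = A \<inter> C" "(UNIV - C) \<inter> A = A - C" by auto
  ultimately show "hausdorff_outer_measure d (C \<inter> A) + hausdorff_outer_measure d ((UNIV - C) \<inter> A) = hausdorff_outer_measure d A"
    using hausdorff_outer_measure_closed_split[OF assms, of d A] by (metis antisym)
qed simp

text \<open>Each covering set is replaced by a ball whose radius is \<open>M\<close> times its
  diameter, whereas the Hausdorff weight uses half the diameter; this explains the factor
  \<open>(2 * M) ^ n\<close>. The contrapositive detects positive measure on the sphere.\<close>

lemma negligible_Lipschitz_image_hausdorff_null:
  fixes g :: "'a::metric_space \<Rightarrow> 'b::euclidean_space"
  assumes null: "hausdorff_outer_measure (DIM('b)) A = 0"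
    and lip: "\<And>x y. x \<in> A \<Longrightarrow> y \<in> A \<Longrightarrow> dist (g x) (g y) \<le> M * dist x y" and M: "0 < M"
  shows "negligible (g ` A)"
  unfolding negligible_outer_le
proof (intro allI impI)
  fix e :: real assume e: "0 < e"
  define n where "n = DIM('b)"
  define c where "c = (2 * M) ^ n"
  have c: "0 < c" using M by (simp add: c_def)
  have "hausdorff_content n 1 A \<le> hausdorff_outer_measure n A"
    unfolding hausdorff_outer_measure_def by (intro SUP_upper) simp
  then have "hausdorff_content n 1 A < ennreal (e / c)"
    using null e c by (simp add: n_def)
  then obtain U where U: "\<forall>i. bounded (U i) \<and> diameter (U i) \<le> 1" "A \<subseteq> (\<Union>i. U i)"
    and sum: "(\<Sum>i. hausdorff_weight n (U i)) < ennreal (e / c)"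
    unfolding hausdorff_content_def INF_less_iff by auto
  \<comment> \<open>The centres are chosen in \<open>A\<close> because \<open>g\<close> is
    controlled only there.\<close>
  define p where "p i = (SOME x. x \<in> U i \<inter> A)" for i
  define B where "B i = (if U i \<inter> A = {} then {} else cball (g (p i)) (M * diameter (U i)))" for i
  have pi: "p i \<in> U i \<inter> A" if "U i \<inter> A \<noteq> {}" for i
  proof -
    have "\<exists>x. x \<in> U i \<inter> A" using that by blast
    then show ?thesis unfolding p_def by (rule someI_ex)
  qed
  have sub: "g ` A \<subseteq> (\<Union>i. B i)"
  proof
    fix y assume "y \<in> g ` A"
    then obtain x i where x: "x \<in> A" "y = g x" "x \<in> U i" using U(2) by blast
    then have ne: "U i \<inter> A \<noteq> {}" by blast
    have "dist (g (p i)) (g x) \<le> M * dist (p i) x" using lip pi[OF ne] x by blast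
    also have "\<dots> \<le> M * diameter (U i)"
      using M U(1) pi[OF ne] x by (intro mult_left_mono diameter_bounded_bound) auto
    finally show "y \<in> (\<Union>i. B i)" using x ne by (auto simp: B_def intro!: exI[of _ i])
  qed
  have Bm: "B i \<in> sets lebesgue" for i by (auto simp: B_def)
  have Bw: "emeasure lebesgue (B i) \<le> ennreal c * hausdorff_weight n (U i)" for i
  proof (cases "U i \<inter> A = {}")
    case False
    have d0: "0 \<le> diameter (U i)" using U(1) by (simp add: diameter_ge_0)
    have "emeasure lebesgue (B i) = ennreal (measure lebesgue (cball (g (p i)) (M * diameter (U i))))"
      using False by (simp add: B_def emeasure_eq_measure2)
    also have "measure lebesgue (cball (g (p i)) (M * diameter (U i))) = unit_ball_vol (real n) * (M * diameter (U i)) ^ n"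
      using d0 M by (simp add: content_cball n_def)
    also have "\<dots> = c * (unit_ball_vol (real n) * (diameter (U i) / 2) ^ n)"
      by (simp add: c_def power_mult_distrib power_divide)
    also have "ennreal \<dots> = ennreal c * hausdorff_weight n (U i)"
      using False c d0 by (auto simp: hausdorff_weight_def ennreal_mult)
    finally show ?thesis by simp
  qed (simp add: B_def)
  define T where "T = (\<Union>i. B i)"
  have Tm: "T \<in> sets lebesgue" unfolding T_def using Bm by auto
  have "emeasure lebesgue T \<le> (\<Sum>i. emeasure lebesgue (B i))"
    unfolding T_def using Bm by (intro emeasure_subadditive_countably) auto
  also have "\<dots> \<le> (\<Sum>i. ennreal c * hausdorff_weight n (U i))"
    by (intro suminf_le Bw) auto
  also have "\<dots> = ennreal c * (\<Sum>i. hausdorff_weight n (U i))" by simp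
  also have "\<dots> \<le> ennreal c * ennreal (e / c)" using sum by (intro mult_left_mono) auto
  also have "\<dots> = ennreal e" using c e by (simp add: ennreal_mult[symmetric])
  finally have eT: "emeasure lebesgue T \<le> ennreal e" .
  then have "T \<in> lmeasurable" using Tm by (intro fmeasurableI) (auto intro: le_less_trans)
  moreover have "measure lebesgue T \<le> e" using eT e by (simp add: measure_def enn2real_leI)
  ultimately show "\<exists>T. g ` A \<subseteq> T \<and> T \<in> lmeasurable \<and> measure lebesgue T \<le> e"
    using sub unfolding T_def by blast
qed

section \<open>Stereographic projection and maps of spheres\<close>

text \<open>The pole \<open>(0, 1)\<close> is the one point of the sphere that is left out.\<close>

definition stereo_inv :: "'a::euclidean_space \<Rightarrow> 'a \<times> real" where
  "stereo_inv x = ((2 / (1 + x \<bullet> x)) *\<^sub>R x, (x \<bullet> x - 1) / (1 + x \<bullet> x))"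

definition stereo :: "'a::euclidean_space \<times> real \<Rightarrow> 'a" where
  "stereo z = (1 / (1 - snd z)) *\<^sub>R fst z"

lemma stereo_inv_denom: "0 < 1 + x \<bullet> (x :: 'a::euclidean_space)"
  by (simp add: add_pos_nonneg)

lemma stereo_stereo_inv [simp]: "stereo (stereo_inv x) = x"
proof -
  have "1 - (x \<bullet> x - 1) / (1 + x \<bullet> x) = 2 / (1 + x \<bullet> x)"
    using stereo_inv_denom[of x] by (simp add: field_simps)
  moreover have "1 / (2 / a) * (2 / a) = 1" if "0 < a" for a :: real using that by simp
  ultimately show ?thesis
    using stereo_inv_denom[of x] by (simp only: stereo_def stereo_inv_def fst_conv snd_conv scaleR_scaleR scaleR_one)
qed

text \<open>The formula for the chordal distance. It yields the Lipschitz bound of the chart and, on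
  bounded sets, that of its inverse.\<close>

lemma dist_stereo_inv:
  "(dist (stereo_inv x) (stereo_inv y))\<^sup>2 = 4 * (dist x y)\<^sup>2 / ((1 + x \<bullet> x) * (1 + y \<bullet> y))"
proof -
  define X Y P where "X = x \<bullet> x" and "Y = y \<bullet> y" and "P = x \<bullet> y"
  have pos: "0 < 1 + X" "0 < 1 + Y" unfolding X_def Y_def by (rule stereo_inv_denom)+
  have "(dist (stereo_inv x) (stereo_inv y))\<^sup>2 =
      (4 * X / (1 + X)\<^sup>2 + 4 * Y / (1 + Y)\<^sup>2 - 8 * P / ((1 + X) * (1 + Y))) + ((X - 1) / (1 + X) - (Y - 1) / (1 + Y))\<^sup>2"
  proof -
    have "(norm (p *\<^sub>R x - q *\<^sub>R y))\<^sup>2 = p\<^sup>2 * X + q\<^sup>2 * Y - 2 * p * q * P" for p q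
      unfolding power2_norm_eq_inner X_def Y_def P_def
      by (simp add: inner_diff_left inner_diff_right inner_commute[of y x] power2_eq_square algebra_simps)
    from this[of "2 / (1 + X)" "2 / (1 + Y)"] show ?thesis
    proof -
      assume *: "(norm ((2 / (1 + X)) *\<^sub>R x - (2 / (1 + Y)) *\<^sub>R y))\<^sup>2 =
        (2 / (1 + X))\<^sup>2 * X + (2 / (1 + Y))\<^sup>2 * Y - 2 * (2 / (1 + X)) * (2 / (1 + Y)) * P"
      have dP: "(dist (p, s) (q, t))\<^sup>2 = (norm (p - q))\<^sup>2 + (s - t)\<^sup>2" for p q :: 'a and s t :: real
        unfolding dist_Pair_Pair unfolding dist_norm by simp
      show ?thesis
        unfolding stereo_inv_def X_def[symmetric] Y_def[symmetric] dP * by (simp add: power_divide)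
    qed
  qed
  also have "\<dots> = 4 * (X + Y - 2 * P) / ((1 + X) * (1 + Y))"
    using pos by (simp add: divide_simps power2_eq_square) (simp add: algebra_simps)
  also have "X + Y - 2 * P = (dist x y)\<^sup>2"
    by (simp add: dist_norm power2_norm_eq_inner inner_diff_left inner_diff_right inner_commute[of y x] X_def Y_def P_def)
  finally show ?thesis by (simp add: X_def Y_def)
qed

lemma norm_stereo_inv [simp]: "norm (stereo_inv x) = 1"
proof -
  have "0 < 1 + x \<bullet> x" by (rule stereo_inv_denom)
  then have "(norm (stereo_inv x))\<^sup>2 = 1"
    unfolding stereo_inv_def norm_Pair
    by (simp add: power2_norm_eq_inner power_divide divide_simps power_mult_distrib) (simp add: power2_eq_square algebra_simps)
  then show ?thesis using norm_ge_zero[of "stereo_inv x"] by (metis power2_eq_imp_eq one_power2 zero_le_one)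
qed

lemma stereo_inv_stereo:
  assumes "norm z = 1" "snd z \<noteq> 1"
  shows "stereo_inv (stereo z) = z"
proof -
  obtain p s where z: "z = (p, s)" by (metis surj_pair)
  have pp: "p \<bullet> p = 1 - s\<^sup>2"
    using assms(1) by (simp add: z norm_Pair power2_norm_eq_inner[symmetric])
  have s1: "1 - s \<noteq> 0" using assms(2) by (simp add: z)
  have q: "stereo z \<bullet> stereo z = (1 + s) / (1 - s)"
  proof -
    have "stereo z \<bullet> stereo z = (1 - s\<^sup>2) / (1 - s)\<^sup>2"
      by (simp add: stereo_def z pp power2_eq_square)
    also have "1 - s\<^sup>2 = (1 + s) * (1 - s)" by (simp add: power2_eq_square algebra_simps)
    finally show ?thesis using s1 by (simp add: power2_eq_square)
  qed
  have "1 + (1 + s) / (1 - s) = 2 / (1 - s)" using s1 by (simp add: field_simps)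
  moreover have "(1 + s) / (1 - s) - 1 = 2 * s / (1 - s)" using s1 by (simp add: field_simps)
  ultimately show ?thesis
    unfolding stereo_inv_def q using s1 by (simp add: stereo_def z)
qed

lemma lipschitz_stereo_inv: "2-lipschitz_on UNIV (stereo_inv :: 'a::euclidean_space \<Rightarrow> _)"
proof (rule lipschitz_onI)
  fix x y :: 'a
  have "1 * 1 \<le> (1 + x \<bullet> x) * (1 + y \<bullet> y)" by (intro mult_mono) auto
  then have "4 * (dist x y)\<^sup>2 / ((1 + x \<bullet> x) * (1 + y \<bullet> y)) \<le> 4 * (dist x y)\<^sup>2 / 1"
    by (intro divide_left_mono) (auto simp: stereo_inv_denom intro!: mult_pos_pos)
  then have "(dist (stereo_inv x) (stereo_inv y))\<^sup>2 \<le> (2 * dist x y)\<^sup>2"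
    unfolding dist_stereo_inv by (simp add: power_mult_distrib)
  then show "dist (stereo_inv x) (stereo_inv y) \<le> 2 * dist x y"
    by (rule power2_le_imp_le) simp
qed simp

lemma dist_le_dist_stereo_inv:
  assumes "norm x \<le> r" "norm y \<le> r"
  shows "dist x y \<le> (1 + r\<^sup>2) * dist (stereo_inv x) (stereo_inv y)"
proof -
  have "x \<bullet> x \<le> r\<^sup>2" "y \<bullet> y \<le> r\<^sup>2"
    using power_mono[OF assms(1), of 2] power_mono[OF assms(2), of 2] by (simp_all add: power2_norm_eq_inner)
  then have "(1 + x \<bullet> x) * (1 + y \<bullet> y) \<le> (1 + r\<^sup>2) * (1 + r\<^sup>2)" by (intro mult_mono) auto
  then have "(dist x y)\<^sup>2 / (1 + r\<^sup>2)\<^sup>2 \<le> (dist x y)\<^sup>2 / ((1 + x \<bullet> x) * (1 + y \<bullet> y))"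
    unfolding power2_eq_square[of "1 + r\<^sup>2"]
    by (intro divide_left_mono) (auto simp: stereo_inv_denom intro!: mult_pos_pos add_pos_nonneg)
  also have "\<dots> \<le> 4 * (dist x y)\<^sup>2 / ((1 + x \<bullet> x) * (1 + y \<bullet> y))"
    by (intro divide_right_mono) (auto simp: stereo_inv_denom less_imp_le)
  also have "\<dots> = (dist (stereo_inv x) (stereo_inv y))\<^sup>2" by (rule dist_stereo_inv[symmetric])
  finally have *: "(dist x y)\<^sup>2 / (1 + r\<^sup>2)\<^sup>2 \<le> (dist (stereo_inv x) (stereo_inv y))\<^sup>2" .
  have "(dist x y)\<^sup>2 \<le> (dist (stereo_inv x) (stereo_inv y))\<^sup>2 * (1 + r\<^sup>2)\<^sup>2"
  proof -
    have "0 < (1 + r\<^sup>2)\<^sup>2" by (intro zero_less_power add_pos_nonneg) auto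
    then show ?thesis using * by (simp only: pos_divide_le_eq)
  qed
  then have "(dist x y)\<^sup>2 \<le> ((1 + r\<^sup>2) * dist (stereo_inv x) (stereo_inv y))\<^sup>2"
    by (simp add: power_mult_distrib mult.commute)
  then show ?thesis by (rule power2_le_imp_le) simp
qed

lemma differentiable_stereo_inv: "stereo_inv differentiable (at x)"
  unfolding stereo_inv_def[abs_def] using stereo_inv_denom[of x]
  by (intro derivative_intros differentiable_inner) auto

lemma differentiable_stereo:
  assumes "snd z \<noteq> 1"
  shows "stereo differentiable (at z within S)"
  unfolding stereo_def[abs_def] using assms
  by (intro derivative_intros differentiable_fst_snd) auto

text \<open>The rate of approach to the pole. It makes \<open>h\<close> almost constant far out, so
  that fibres over other values are bounded.\<close>

lemma dist_stereo_inv_pole: "dist (stereo_inv x) (0, 1) = 2 / sqrt (1 + x \<bullet> x)"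
proof -
  have pos: "0 < 1 + x \<bullet> x" by (rule stereo_inv_denom)
  define X where "X = x \<bullet> x"
  have "(dist (stereo_inv x) (0, 1))\<^sup>2 = 4 * X / (1 + X)\<^sup>2 + ((X - 1) / (1 + X) - 1)\<^sup>2"
    unfolding stereo_inv_def dist_Pair_Pair
    by (simp add: dist_norm power_divide power_mult_distrib power2_norm_eq_inner X_def)
  also have "(X - 1) / (1 + X) - 1 = - 2 / (1 + X)" using pos by (simp add: X_def field_simps)
  also have "4 * X / (1 + X)\<^sup>2 + (- 2 / (1 + X))\<^sup>2 = 4 * (1 + X) / ((1 + X) * (1 + X))"
    by (simp add: power2_eq_square add_divide_distrib[symmetric] algebra_simps)
  also have "\<dots> = 4 / (1 + X)" using pos unfolding X_def by (subst mult_divide_mult_cancel_right) auto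
  also have "\<dots> = (2 / sqrt (1 + X))\<^sup>2" using pos by (simp add: power_divide X_def)
  finally show ?thesis unfolding X_def using pos
    by (metis divide_nonneg_pos power2_eq_iff_nonneg real_sqrt_gt_zero zero_le_dist zero_le_numeral)
qed

section \<open>Homotopies of maps into a sphere\<close>

text \<open>The segment between two unit vectors contains the origin only if they are antipodal, so
  the straight homotopy can be normalised.\<close>

lemma homotopic_spheremaps_not_antipodal:
  fixes f g :: "'a::topological_space \<Rightarrow> 'b::euclidean_space"
  assumes f: "continuous_on S f" "f ` S \<subseteq> sphere 0 1" and g: "continuous_on S g" "g ` S \<subseteq> sphere 0 1"
    and na: "\<And>x. x \<in> S \<Longrightarrow> g x \<noteq> - f x"
  shows "homotopic_with_canon (\<lambda>_. True) S (sphere 0 1) f g"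
proof -
  have seg: "closed_segment (f x) (g x) \<subseteq> - {0}" if x: "x \<in> S" for x
  proof
    fix y assume "y \<in> closed_segment (f x) (g x)"
    then obtain u where u: "0 \<le> u" "u \<le> 1" "y = (1 - u) *\<^sub>R f x + u *\<^sub>R g x" by (auto simp: in_segment)
    have n: "norm (f x) = 1" "norm (g x) = 1" using f(2) g(2) x by auto
    have "y \<noteq> 0"
    proof
      assume "y = 0"
      then have eq: "(1 - u) *\<^sub>R f x = - (u *\<^sub>R g x)" using u(3) by (simp add: eq_neg_iff_add_eq_0)
      then have "norm ((1 - u) *\<^sub>R f x) = norm (u *\<^sub>R g x)" by simp
      then have "u = 1 / 2" using u n by simp
      then have "(1 / 2 :: real) *\<^sub>R f x = (1 / 2 :: real) *\<^sub>R (- g x)" using eq by (simp only:) simp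
      then have "f x = - g x" by (simp only: scaleR_cancel_left) simp
      then show False using na[OF x] by simp
    qed
    then show "y \<in> - {0}" by simp
  qed
  have "homotopic_with_canon (\<lambda>_. True) S (- {0}) f g"
    by (rule homotopic_with_linear[OF f(1) g(1) seg])
  then have "homotopic_with_canon (\<lambda>_. True) S (sphere 0 1) ((\<lambda>y. y /\<^sub>R norm y) \<circ> f) ((\<lambda>y. y /\<^sub>R norm y) \<circ> g)"
    by (rule homotopic_with_compose_continuous_left) (auto intro!: continuous_intros)
  then show ?thesis
    by (rule homotopic_with_eq) (use f(2) g(2) in \<open>auto simp: image_subset_iff\<close>)
qed

lemma nullhomotopic_nonsurjective_spheremap:
  fixes f :: "'a::topological_space \<Rightarrow> 'b::euclidean_space"
  assumes f: "continuous_on S f" "f ` S \<subseteq> sphere 0 1 - {y}" and y: "y \<in> sphere 0 1"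
  shows "\<exists>c. homotopic_with_canon (\<lambda>_. True) S (sphere 0 1) f (\<lambda>_. c)"
proof -
  have "homotopic_with_canon (\<lambda>_. True) S (sphere 0 1) f (\<lambda>_. - y)"
    by (rule homotopic_spheremaps_not_antipodal) (use f y in auto)
  then show ?thesis by blast
qed

text \<open>One value \<open>w\<close> is removed from the image of \<open>h\<close>, and the change
  is carried back to the sphere over a region where \<open>f\<close> stays off the fold. Taking
  \<open>push\<close> as a hypothesis lets both dimensions share the argument.\<close>

lemma image_degenerate_chart_negligible_imp_nullhomotopic:
  fixes f :: "(real ^ 'm::{finite,wellorder}) \<times> real \<Rightarrow> (real ^ 'n::{finite,wellorder}) \<times> real"
  defines "h \<equiv> \<lambda>x. fst (f (stereo_inv x))"
  assumes card: "CARD('m) = CARD('n) + 1"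
    and lip: "L-lipschitz_on (sphere 0 1) f" and fS: "f ` sphere 0 1 \<subseteq> sphere 0 1"
    and V: "open V" "V \<noteq> {}" "V \<subseteq> ball 0 1"
    and null: "negligible {x. h x \<in> V \<and> x \<notin> degenerate_set h}"
    and push: "\<And>(h :: (real, 'm) vec \<Rightarrow> (real, 'n) vec) L a b w e. \<lbrakk>L-lipschitz_on UNIV h;
        \<And>i. negligible ((\<lambda>x. x $ i) ` {x \<in> cbox a b. h x = w}); \<And>i. a $ i < b $ i;
        \<And>x. x \<in> frontier (cbox a b) \<Longrightarrow> h x \<noteq> w; 0 < e;
        negligible {x \<in> cbox a b. norm (h x - w) \<le> e \<and> \<not> (h differentiable (at x) \<and> x \<in> degenerate_set h)}\<rbrakk>
      \<Longrightarrow> pushable h (cbox a b) w e"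
  shows "\<exists>c. homotopic_with_canon (\<lambda>_. True) (sphere 0 1) (sphere 0 1) f (\<lambda>_. c)"
proof -
  have L0: "0 \<le> L" using lip lipschitz_on_nonneg by blast
  define M where "M = 2 * L + 1"
  have M: "0 < M" using L0 by (simp add: M_def)
  have contf: "continuous_on (sphere 0 1) f" using lip lipschitz_on_continuous_on by blast
  have dfst: "dist (fst p) (fst q) \<le> dist p q" for p q :: "(real, 'n) vec \<times> real"
    by (rule dist_fst_le)
  have hlip: "M-lipschitz_on UNIV h"
  proof (rule lipschitz_onI)
    fix x y :: "(real, 'm) vec"
    have "dist (h x) (h y) \<le> dist (f (stereo_inv x)) (f (stereo_inv y))" unfolding h_def by (rule dfst)
    also have "\<dots> \<le> L * dist (stereo_inv x) (stereo_inv y)" by (rule lipschitz_onD[OF lip]) auto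
    also have "\<dots> \<le> L * (2 * dist x y)" using lipschitz_onD[OF lipschitz_stereo_inv, of x y] L0 by (intro mult_left_mono) auto
    also have "\<dots> \<le> M * dist x y" by (simp add: M_def algebra_simps)
    finally show "dist (h x) (h y) \<le> M * dist x y" .
  qed (use M in simp)
  define pole where "pole = (0 :: (real, 'm) vec, 1 :: real)"
  define h\<^sub>0 where "h\<^sub>0 = fst (f pole)"
  have pole: "pole \<in> sphere 0 1" by (simp add: pole_def norm_Pair)
  have hpole: "dist (h x) h\<^sub>0 \<le> L * (2 / sqrt (1 + x \<bullet> x))" for x
  proof -
    have "dist (h x) h\<^sub>0 \<le> dist (f (stereo_inv x)) (f pole)" unfolding h_def h\<^sub>0_def by (rule dfst)
    also have "\<dots> \<le> L * dist (stereo_inv x) pole" by (rule lipschitz_onD[OF lip]) (use pole in auto)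
    finally show ?thesis by (simp add: pole_def dist_stereo_inv_pole)
  qed
  obtain v\<^sub>0 where v0: "v\<^sub>0 \<in> V" "v\<^sub>0 \<noteq> h\<^sub>0"
    using V(1,2) not_open_singleton[of h\<^sub>0] by (metis (no_types, lifting) ex_in_conv insertI1 insert_absorb singletonD subsetI subset_singletonD)
  obtain r where r: "0 < r" "cball v\<^sub>0 r \<subseteq> V" using V(1) v0(1) open_contains_cball by blast
  \<comment> \<open>\<open>h\<^sub>0\<close> is the value of \<open>h\<close> at infinity. A point
    within \<open>\<rho>\<close> of \<open>v\<^sub>0\<close> has distance at least
    \<open>3 * \<rho>\<close> from it, while far out \<open>h\<close> stays within
    \<open>\<rho>\<close> of it; so the fibre of such a point lies in a bounded cube.\<close>
  define \<rho> where "\<rho> = min (r / 2) (dist v\<^sub>0 h\<^sub>0 / 4)"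
  have \<rho>: "0 < \<rho>" "cball v\<^sub>0 (2 * \<rho>) \<subseteq> V" "4 * \<rho> \<le> dist v\<^sub>0 h\<^sub>0"
    using r v0(2) by (auto simp: \<rho>_def subset_iff)
  \<comment> \<open>From radius \<open>R\<close> on, the pole estimate is at most
    \<open>2 * L / R\<close>, hence at most \<open>\<rho>\<close>; the summand 1 keeps
    \<open>R\<close> positive.\<close>
  define R where "R = 2 * L / \<rho> + 1"
  have R: "0 < R" using L0 \<rho>(1) by (simp add: R_def add_nonneg_pos)
  have far: "dist (h x) h\<^sub>0 \<le> \<rho>" if "R \<le> norm x" for x
  proof -
    have "R \<le> sqrt (1 + x \<bullet> x)"
      using that R by (intro real_le_rsqrt) (metis add_increasing norm_ge_zero power2_norm_eq_inner power_mono zero_le_one less_imp_le)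
    moreover have "0 < sqrt (1 + x \<bullet> x) * R" using R calculation by (intro mult_pos_pos) linarith+
    ultimately have "2 / sqrt (1 + x \<bullet> x) \<le> 2 / R" by (intro divide_left_mono) auto
    then have "L * (2 / sqrt (1 + x \<bullet> x)) \<le> L * (2 / R)" using L0 by (rule mult_left_mono)
    also have "\<dots> \<le> \<rho>"
    proof -
      have "\<rho> * R = 2 * L + \<rho>" using \<rho>(1) by (simp add: R_def algebra_simps)
      then show ?thesis using R \<rho>(1) by (simp add: pos_divide_le_eq)
    qed
    finally show ?thesis using hpole[of x] by linarith
  qed
  define a b where "a = (\<chi> i. -R :: (real, 'm) vec)" and "b = (\<chi> i. R :: (real, 'm) vec)"
  have ab: "a $ i < b $ i" for i using R by (simp add: a_def b_def)
  have "negligible ({x \<in> cbox a b. h x \<in> cball v\<^sub>0 (2 * \<rho>)} - degenerate_set h)"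
    by (rule negligible_subset[OF null]) (use \<rho>(2) in auto)
  then have "negligible {w \<in> ball v\<^sub>0 \<rho>. \<exists>i. \<not> negligible ((\<lambda>x. x $ i) ` {x \<in> cbox a b. h x = w})}"
    using fiber_projections_negligible[OF hlip M card R \<rho>(1)] unfolding a_def b_def by blast
  moreover have "\<not> negligible (ball v\<^sub>0 \<rho>)" using \<rho>(1) by (intro open_not_negligible) auto
  ultimately have "\<not> ball v\<^sub>0 \<rho> \<subseteq> {w \<in> ball v\<^sub>0 \<rho>. \<exists>i. \<not> negligible ((\<lambda>x. x $ i) ` {x \<in> cbox a b. h x = w})}"
    using negligible_subset by blast
  then obtain w where w: "w \<in> ball v\<^sub>0 \<rho>" "\<And>i. negligible ((\<lambda>x. x $ i) ` {x \<in> cbox a b. h x = w})"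
    by blast
  have wh0: "3 * \<rho> \<le> dist w h\<^sub>0"
    using dist_triangle[of v\<^sub>0 h\<^sub>0 w] w(1) \<rho>(3) by simp
  have hw: "\<rho> < norm (h x - w)" if "R \<le> norm x" for x
    using far[OF that] wh0 dist_triangle[of w h\<^sub>0 "h x"] \<rho>(1) by (simp add: dist_norm norm_minus_commute)
  have "w \<in> V" using w(1) \<rho> by (auto simp: subset_iff)
  then have w1: "norm w < 1" using V(3) by auto
  \<comment> \<open>Values at distance at most \<open>4 * e\<close> from \<open>w\<close> stay in
    the open unit ball, over which the sphere is a pair of graphs. The bound \<open>\<rho>\<close>
    keeps the changed region inside the cube and over \<open>V\<close>.\<close>
  define e where "e = min \<rho> ((1 - norm w) / 8)"
  have "e \<le> (1 - norm w) / 8" unfolding e_def by (rule min.cobounded2)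
  then have e: "0 < e" "e \<le> \<rho>" "norm w + 4 * e < 1" using \<rho>(1) w1 by (auto simp: e_def)
  have inbox: "x \<in> cbox a b" if "norm x \<le> R" for x
    using component_le_norm_cart[of x] that by (auto simp: mem_box_cart a_def b_def abs_le_iff) (smt (verit))+
  have fr: "h x \<noteq> w" if "x \<in> frontier (cbox a b)" for x
  proof -
    have "x \<in> cbox a b" "x \<notin> box a b" using that by (auto simp: frontier_cbox)
    then obtain i where "\<not> (a $ i < x $ i \<and> x $ i < b $ i)" "a $ i \<le> x $ i \<and> x $ i \<le> b $ i"
      unfolding mem_box_cart by blast
    then have i: "x $ i = a $ i \<or> x $ i = b $ i" by linarith
    then have "\<bar>x $ i\<bar> = R" using R by (auto simp: a_def b_def)
    then have "R \<le> norm x" using component_le_norm_cart[of x i] by simp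
    then show ?thesis using hw[of x] \<rho>(1) by auto
  qed
  have ae: "negligible {x \<in> cbox a b. norm (h x - w) \<le> e \<and> \<not> (h differentiable (at x) \<and> x \<in> degenerate_set h)}"
  proof (rule negligible_subset)
    show "negligible ({x. \<not> h differentiable (at x)} \<union> {x. h x \<in> V \<and> x \<notin> degenerate_set h})"
      using rademacher[OF hlip] null by (rule negligible_Un)
    have "h x \<in> V" if "norm (h x - w) \<le> e" for x
    proof -
      have "dist v\<^sub>0 (h x) \<le> 2 * \<rho>"
        using dist_triangle[of v\<^sub>0 "h x" w] w(1) that e(2) by (simp add: dist_norm norm_minus_commute)
      then show ?thesis using \<rho>(2) by auto
    qed
    then show "{x \<in> cbox a b. norm (h x - w) \<le> e \<and> \<not> (h differentiable (at x) \<and> x \<in> degenerate_set h)}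
       \<subseteq> {x. \<not> h differentiable (at x)} \<union> {x. h x \<in> V \<and> x \<notin> degenerate_set h}" by blast
  qed
  obtain h' where h': "continuous_on (cbox a b) h'" "\<And>x. x \<in> cbox a b \<Longrightarrow> h' x \<noteq> w"
     "\<And>x. x \<in> cbox a b \<Longrightarrow> e \<le> norm (h x - w) \<Longrightarrow> h' x = h x"
     "\<And>x. x \<in> cbox a b \<Longrightarrow> norm (h x - w) \<le> e \<Longrightarrow> norm (h' x - w) \<le> 4 * e"
    using push[OF hlip w(2) ab fr e(1) ae] unfolding pushable_def by blast
  \<comment> \<open>The map is changed on \<open>Z\<close> only; on the overlap with
    \<open>Y\<close> the changed map already equals \<open>f\<close>.\<close>
  define Z where "Z = {z \<in> sphere 0 1. norm (fst (f z) - w) \<le> e}"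
  define Y where "Y = {z \<in> sphere 0 1. e \<le> norm (fst (f z) - w)}"
  have cn: "continuous_on (sphere 0 1) (\<lambda>z. norm (fst (f z) - w))"
    by (intro continuous_intros contf)
  have "closedin (top_of_set (sphere 0 1)) Z" "closedin (top_of_set (sphere 0 1)) Y"
    unfolding Z_def Y_def using continuous_closedin_preimage[OF cn closed_atMost[of e]] continuous_closedin_preimage[OF cn closed_atLeast[of e]]
    by (simp_all add: Int_def vimage_def)
  then have clZ: "closed Z" "closed Y" using closedin_closed_trans closed_sphere by blast+
  have YZ: "Z \<union> Y = sphere 0 1" by (auto simp: Z_def Y_def)
  have Zs: "snd z \<noteq> 1" "stereo z \<in> cbox a b" "h (stereo z) = fst (f z)" if z: "z \<in> Z" for z
  proof -
    have nz: "norm z = 1" and fz: "norm (fst (f z) - w) \<le> e" using z by (auto simp: Z_def)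
    show s: "snd z \<noteq> 1"
    proof
      assume s: "snd z = 1"
      then have "(norm (fst z))\<^sup>2 = 0" using nz by (simp add: norm_prod_def)
      then have "z = pole" using s by (simp add: pole_def prod_eq_iff)
      then have "dist w h\<^sub>0 \<le> e" using fz by (simp add: h\<^sub>0_def dist_norm norm_minus_commute)
      then show False using wh0 e(2) \<rho>(1) by linarith
    qed
    show hz: "h (stereo z) = fst (f z)" unfolding h_def by (simp add: stereo_inv_stereo[OF nz s])
    show "stereo z \<in> cbox a b"
    proof (rule inbox, rule ccontr)
      assume "\<not> norm (stereo z) \<le> R"
      then have "\<rho> < norm (h (stereo z) - w)" by (intro hw) simp
      then show False using fz e(2) hz by simp
    qed
  qed
  have unit: "(norm (fst (f z)))\<^sup>2 + (snd (f z))\<^sup>2 = 1" if "z \<in> sphere 0 1" for z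
  proof -
    have "f z \<in> sphere 0 1" using fS that by blast
    then have "norm (f z) = 1" by simp
    then show ?thesis by (simp add: norm_prod_def)
  qed
  have nfst: "norm (fst (f z)) < 1" if "z \<in> Z" for z
  proof -
    have "norm (fst (f z)) \<le> norm w + norm (fst (f z) - w)" by (metis norm_triangle_sub)
    then show ?thesis using that e by (simp add: Z_def)
  qed
  \<comment> \<open>On \<open>Z\<close> the map \<open>f\<close> avoids the equator, so the sign
    \<open>\<sigma>\<close> of its last coordinate is continuous there.\<close>
  have sndZ: "snd (f z) \<noteq> 0" if "z \<in> Z" for z
  proof
    assume "snd (f z) = 0"
    then have "(norm (fst (f z)))\<^sup>2 = 1" using unit[of z] that by (simp add: Z_def)
    moreover have "(norm (fst (f z)))\<^sup>2 < 1\<^sup>2" using nfst[OF that] by (intro power_strict_mono) auto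
    ultimately show False by simp
  qed
  define g where "g z = h' (stereo z)" for z
  have cg: "continuous_on Z g"
  proof -
    have "continuous_on Z stereo"
      by (rule differentiable_imp_continuous_on, unfold differentiable_on_def) (use differentiable_stereo Zs(1) in blast)
    then show ?thesis unfolding g_def
      by (rule continuous_on_compose2[OF h'(1)]) (use Zs(2) in auto)
  qed
  have gw: "g z \<noteq> w" "norm (g z - w) \<le> 4 * e" if "z \<in> Z" for z
    using h'(2)[OF Zs(2)[OF that]] h'(4)[OF Zs(2)[OF that]] Zs(3)[OF that] that by (auto simp: g_def Z_def)
  have ng: "norm (g z) < 1" if "z \<in> Z" for z
    using norm_triangle_sub[of "g z" w] gw(2)[OF that] e(3) by linarith
  define \<sigma> where "\<sigma> z = snd (f z) / \<bar>snd (f z)\<bar>" for z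
  have s2: "\<sigma> z * \<sigma> z = 1" if "z \<in> Z" for z
    using sndZ[OF that] by (cases "0 < snd (f z)") (auto simp: \<sigma>_def)
  have ssn: "\<sigma> z * snd (f z) = \<bar>snd (f z)\<bar>" if "z \<in> Z" for z
    using sndZ[OF that] by (cases "0 < snd (f z)") (auto simp: \<sigma>_def)
  \<comment> \<open>The pushed value is lifted to the hemisphere that contains \<open>f z\<close>;
    for this reason the new map is never antipodal to \<open>f\<close>.\<close>
  define k where "k z = (g z, \<sigma> z * sqrt (1 - (norm (g z))\<^sup>2))" for z
  define f' where "f' z = (if z \<in> Z then k z else f z)" for z
  have cfZ: "continuous_on Z f" "continuous_on Y f" using contf continuous_on_subset YZ by blast+
  have ck: "continuous_on Z k"
    unfolding k_def \<sigma>_def using sndZ by (intro continuous_intros cg cfZ) auto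
  have eqYZ: "k z = f z" if "z \<in> Z" "z \<in> Y" for z
  proof -
    have "e \<le> norm (h (stereo z) - w)" using that Zs(3) by (simp add: Y_def)
    then have gz: "g z = fst (f z)" using h'(3)[OF Zs(2)[OF that(1)]] Zs(3)[OF that(1)] by (simp add: g_def)
    have "1 - (norm (fst (f z)))\<^sup>2 = (snd (f z))\<^sup>2" using unit[of z] that by (simp add: Z_def)
    then have "\<sigma> z * sqrt (1 - (norm (g z))\<^sup>2) = snd (f z)"
      using sndZ[OF that(1)] gz by (simp add: \<sigma>_def)
    then show ?thesis using gz by (simp add: k_def prod_eq_iff)
  qed
  have "continuous_on (Z \<union> Y) f'"
    unfolding f'_def by (rule continuous_on_cases[OF clZ ck cfZ(2)]) (use eqYZ in auto)
  then have cf': "continuous_on (sphere 0 1) f'" by (simp only: YZ)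
  have kS: "norm (k z) = 1" if "z \<in> Z" for z
  proof -
    have "(norm (g z))\<^sup>2 \<le> 1" using ng[OF that] by (simp add: power_le_one)
    then have "(norm (k z))\<^sup>2 = 1"
      unfolding k_def norm_Pair using s2[OF that] by (simp add: power_mult_distrib power2_eq_square[of "\<sigma> z"])
    then show ?thesis by (metis norm_ge_zero one_power2 power2_eq_imp_eq zero_le_one)
  qed
  have f'S: "f' ` sphere 0 1 \<subseteq> sphere 0 1" using fS kS by (auto simp: f'_def)
  have na: "f' z \<noteq> - f z" if z: "z \<in> sphere 0 1" for z
  proof (cases "z \<in> Z")
    case True
    have "snd (k z) * snd (f z) = \<bar>snd (f z)\<bar> * sqrt (1 - (norm (g z))\<^sup>2)"
      unfolding ssn[OF True, symmetric] by (simp add: k_def mult_ac)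
    also have "\<dots> > 0"
      using sndZ[OF True] ng[OF True] by (auto simp: power_less_one_iff abs_square_less_1 intro!: mult_pos_pos)
    finally have "snd (k z) * snd (f z) > 0" .
    show ?thesis
    proof
      assume "f' z = - f z"
      then have "snd (k z) = - snd (f z)" using True by (simp add: f'_def)
      then have "snd (k z) * snd (f z) = - (snd (f z))\<^sup>2" by (simp add: power2_eq_square)
      then show False using \<open>snd (k z) * snd (f z) > 0\<close> by (smt (verit) zero_le_power2)
    qed
  next
    case False
    have "f z \<in> sphere 0 1" using fS z by blast
    then have "f z \<noteq> 0" by auto
    then show ?thesis using False by (simp add: f'_def eq_neg_iff_add_eq_0 flip: scaleR_2)
  qed
  \<comment> \<open>One of the two points over \<open>w\<close>; the new map misses both.\<close>
  define y where "y = (w, sqrt (1 - (norm w)\<^sup>2))"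
  have y: "y \<in> sphere 0 1" using w1 by (simp add: y_def norm_Pair power_le_one)
  have "f' z \<noteq> y" if z: "z \<in> sphere 0 1" for z
  proof (cases "z \<in> Z")
    case True then show ?thesis using gw(1)[OF True] by (auto simp: f'_def k_def y_def)
  next
    case False
    then have "fst (f z) \<noteq> w" using z e(1) by (auto simp: Z_def)
    then show ?thesis using False by (auto simp: f'_def y_def)
  qed
  then have "\<exists>c. homotopic_with_canon (\<lambda>_. True) (sphere 0 1) (sphere 0 1) f' (\<lambda>_. c)"
    using f'S by (intro nullhomotopic_nonsurjective_spheremap[OF cf' _ y]) blast
  moreover have "homotopic_with_canon (\<lambda>_. True) (sphere 0 1) (sphere 0 1) f f'"
    by (rule homotopic_spheremaps_not_antipodal[OF contf fS cf' f'S na])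
  ultimately show ?thesis using homotopic_with_trans by blast
qed

section \<open>From the chart back to the sphere\<close>

lemma compact_subset_not_negligible:
  fixes E :: "'a::euclidean_space set"
  assumes "E \<in> sets lebesgue" "\<not> negligible E"
  shows "\<exists>C. compact C \<and> C \<subseteq> E \<and> \<not> negligible C"
proof -
  have "E = (\<Union>n. E \<inter> cball 0 (real n))"
  proof -
    have "\<exists>n. x \<in> cball 0 (real n)" for x :: 'a using real_arch_simple[of "norm x"] by auto
    then show ?thesis by blast
  qed
  then obtain n where n: "\<not> negligible (E \<inter> cball 0 (real n))"
    using assms(2) negligible_Union_nat[of "\<lambda>n. E \<inter> cball 0 (real n)"] by metis
  define E' where "E' = E \<inter> cball 0 (real n)"
  have E': "E' \<in> lmeasurable"
    unfolding E'_def using assms(1) by (subst Int_commute, intro fmeasurable_Int_fmeasurable) auto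
  then have pos: "0 < measure lebesgue E'"
    using n negligible_iff_measure[of E'] unfolding E'_def[symmetric] by (simp add: zero_less_measure_iff)
  obtain C where C: "closed C" "C \<subseteq> E'" "E' - C \<in> lmeasurable" "emeasure lebesgue (E' - C) < ennreal (measure lebesgue E')"
    using sets_lebesgue_inner_closed[of E' "measure lebesgue E'"] E' pos by (auto simp: fmeasurableD)
  have "compact C"
    using C(1,2) bounded_subset[OF bounded_cball[of 0 "real n"], of C] by (auto simp: compact_eq_bounded_closed E'_def)
  moreover have "\<not> negligible C"
  proof
    assume "negligible C"
    then have "emeasure lebesgue (E' - C) = emeasure lebesgue E'"
      using E' by (intro emeasure_Diff_null_set) (auto simp: negligible_iff_null_sets fmeasurableD)
    then show False using C(4) E' by (simp add: emeasure_eq_measure2)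
  qed
  ultimately show ?thesis using C(2) by (auto simp: E'_def)
qed

text \<open>Differentiate the constant \<open>f x \<bullet> f x\<close>. This bounds the rank from
  above.\<close>

lemma tangent_image_subset:
  fixes f :: "'a::euclidean_space \<Rightarrow> 'b::euclidean_space"
  assumes z: "z \<in> sphere 0 1" and fS: "f ` sphere 0 1 \<subseteq> sphere 0 1"
    and D: "(f has_derivative D) (at z within sphere 0 1)"
  shows "D ` tangent_space_sphere z \<subseteq> tangent_space_sphere (f z)"
proof
  fix y assume "y \<in> D ` tangent_space_sphere z"
  then obtain v where v: "v \<in> tangent_space_sphere z" "y = D v" by blast
  have 1: "((\<lambda>x. f x \<bullet> f x) has_derivative (\<lambda>v. f z \<bullet> D v + D v \<bullet> f z)) (at z within sphere 0 1)"
    by (rule has_derivative_inner[OF D D])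
  have c: "f x \<bullet> f x = 1" if "x \<in> sphere 0 1" for x
  proof -
    have "f x \<in> sphere 0 1" using fS that by blast
    then show ?thesis by (simp add: norm_eq_1)
  qed
  have 2: "((\<lambda>x. f x \<bullet> f x) has_derivative (\<lambda>v. 0)) (at z within sphere 0 1)"
    by (rule has_derivative_transform[OF z _ has_derivative_const[of 1]]) (simp add: c)
  have "f z \<bullet> D v + D v \<bullet> f z = 0"
    using has_derivative_within_sphere_unique[OF z v(1) 1 2] .
  then show "y \<in> tangent_space_sphere (f z)"
    by (simp add: tangent_space_sphere_def v(2) inner_commute)
qed

lemma dim_tangent_space_sphere:
  "z \<in> sphere 0 1 \<Longrightarrow> dim (tangent_space_sphere (z :: 'a::euclidean_space)) = DIM('a) - 1"
  unfolding tangent_space_sphere_def by (rule dim_hyperplane) auto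

text \<open>If the regular points over the cap were null, \<open>f\<close> would be nullhomotopic;
  so they contain a compact set that is not null, and \<open>C\<close> is its image on the sphere.
  The types \<open>'p\<close> and \<open>'q\<close> index the chart and the projected
  target.\<close>

lemma regular_compact_set_over_cap:
  fixes f :: "real ^ 'm \<Rightarrow> real ^ 'k"
  assumes card: "CARD('m) = CARD('p) + 1" "CARD('k) = CARD('q) + 1" "CARD('p) = CARD('q) + 1"
    and fS: "f ` sphere 0 1 \<subseteq> sphere 0 1" and lip: "L-lipschitz_on (sphere 0 1) f"
    and nnull: "\<not> (\<exists>c. homotopic_with_canon (\<lambda>_. True) (sphere 0 1) (sphere 0 1) f (\<lambda>_. c))"
    and p: "p \<in> sphere 0 1" and r: "0 < r"
    and push: "\<And>(h :: (real, 'p::{finite,wellorder}) vec \<Rightarrow> (real, 'q::{finite,wellorder}) vec) L a b w e. \<lbrakk>L-lipschitz_on UNIV h;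
        \<And>i. negligible ((\<lambda>x. x $ i) ` {x \<in> cbox a b. h x = w}); \<And>i. a $ i < b $ i;
        \<And>x. x \<in> frontier (cbox a b) \<Longrightarrow> h x \<noteq> w; 0 < e;
        negligible {x \<in> cbox a b. norm (h x - w) \<le> e \<and> \<not> (h differentiable (at x) \<and> x \<in> degenerate_set h)}\<rbrakk>
      \<Longrightarrow> pushable h (cbox a b) w e"
  shows "\<exists>C \<subseteq> sphere 0 1. compact C \<and> 0 < hausdorff_outer_measure (CARD('p)) C \<and>
    (\<forall>x\<in>C. f differentiable (at x within sphere 0 1) \<and> rank_on_sphere f x = CARD('q)) \<and> f ` C \<subseteq> ball p r"
proof -
  have "DIM(real ^ 'm) = DIM((real, 'p) vec \<times> real)" using card by simp
  then obtain I :: "real ^ 'm \<Rightarrow> (real, 'p) vec \<times> real" and I' where I: "linear I" "linear I'"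
      "\<And>x. norm (I x) = norm x" "\<And>y. norm (I' y) = norm y" "\<And>x. I' (I x) = x" "\<And>y. I (I' y) = y"
    by (rule isomorphisms_UNIV_UNIV) blast
  have "DIM(real ^ 'k) = DIM((real, 'q) vec \<times> real)" using card by simp
  then obtain O1 :: "real ^ 'k \<Rightarrow> (real, 'q) vec \<times> real" and O1' where O1: "linear O1" "linear O1'"
      "\<And>x. norm (O1 x) = norm x" "\<And>y. norm (O1' y) = norm y" "\<And>x. O1' (O1 x) = x" "\<And>y. O1 (O1' y) = y"
    by (rule isomorphisms_UNIV_UNIV) blast
  define p\<^sub>1 :: "(real, 'q) vec" where "p\<^sub>1 = axis undefined 1"
  have np1: "norm p\<^sub>1 = 1" by (simp add: p\<^sub>1_def)
  \<comment> \<open>The rotation puts \<open>p\<close> on the fold of the projection, where both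
    sheets over a small set near \<open>p\<^sub>1\<close> are close to \<open>p\<close>.\<close>
  obtain T where T: "orthogonal_transformation T" "T p = O1' (p\<^sub>1, 0)"
    using orthogonal_transformation_exists[of p "O1' (p\<^sub>1, 0)"] p by (auto simp: O1(4) norm_Pair np1)
  have T': "orthogonal_transformation (inv T)" "\<And>x. inv T (T x) = x" "\<And>x. T (inv T x) = x"
    using T(1) by (auto simp: orthogonal_transformation_inv orthogonal_transformation_inj orthogonal_transformation_surj surj_f_inv_f)
  define Q where "Q y = O1 (T y)" for y
  define Q' where "Q' y = inv T (O1' y)" for y
  have linT: "linear T" "linear (inv T)" "\<And>x. norm (T x) = norm x" "\<And>x. norm (inv T x) = norm x"
    using T(1) T'(1) by (auto simp: orthogonal_transformation)
  have Q: "linear Q" "linear Q'" "\<And>x. norm (Q x) = norm x" "\<And>y. norm (Q' y) = norm y" "\<And>x. Q' (Q x) = x" "\<And>y. Q (Q' y) = y"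
    using linear_compose[OF linT(1) O1(1)] linear_compose[OF O1(2) linT(2)]
    by (auto simp: Q_def[abs_def] Q'_def[abs_def] o_def O1 linT T')
  have Qp: "Q p = (p\<^sub>1, 0)" by (simp add: Q_def T(2) O1(6))
  have bl: "bounded_linear I" "bounded_linear I'" "bounded_linear Q" "bounded_linear Q'"
    using I Q by (simp_all add: linear_conv_bounded_linear)
  have Qdist: "dist (Q x) (Q y) = dist x y" for x y
    using Q(3)[of "x - y"] linear_diff[OF Q(1)] by (simp add: dist_norm)
  have I'dist: "dist (I' x) (I' y) = dist x y" for x y
    using I(4)[of "x - y"] linear_diff[OF I(2)] by (simp add: dist_norm)
  define F where "F z = Q (f (I' z))" for z
  have Flip: "L-lipschitz_on (sphere 0 1) F"
  proof (rule lipschitz_onI)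
    fix x y :: "(real, 'p) vec \<times> real" assume "x \<in> sphere 0 1" "y \<in> sphere 0 1"
    then have "I' x \<in> sphere 0 1" "I' y \<in> sphere 0 1" by (simp_all add: I(4))
    then have "dist (f (I' x)) (f (I' y)) \<le> L * dist (I' x) (I' y)" by (rule lipschitz_onD[OF lip])
    then show "dist (F x) (F y) \<le> L * dist x y" by (simp add: F_def Qdist I'dist)
  qed (use lip lipschitz_on_nonneg in blast)
  have FS: "F ` sphere 0 1 \<subseteq> sphere 0 1"
  proof
    fix y assume "y \<in> F ` sphere 0 1"
    then obtain z where z: "norm z = 1" "y = F z" by auto
    then have "I' z \<in> sphere 0 1" by (simp add: I(4))
    then have "f (I' z) \<in> sphere 0 1" using fS by blast
    then show "y \<in> sphere 0 1" using z by (simp add: F_def Q(3))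
  qed
  have Fnn: "\<not> (\<exists>c. homotopic_with_canon (\<lambda>_. True) (sphere 0 1) (sphere 0 1) F (\<lambda>_. c))"
  proof
    assume "\<exists>c. homotopic_with_canon (\<lambda>_. True) (sphere 0 1) (sphere 0 1) F (\<lambda>_. c)"
    then obtain c where c: "homotopic_with_canon (\<lambda>_. True) (sphere 0 1) (sphere 0 1) F (\<lambda>_. c)" by blast
    have "homotopic_with_canon (\<lambda>_. True) (sphere 0 1) (sphere 0 1) (F \<circ> I) ((\<lambda>_. c) \<circ> I)"
      by (rule homotopic_with_compose_continuous_right[OF c]) (auto simp: I(3) intro: linear_continuous_on[OF bl(1)])
    then have "homotopic_with_canon (\<lambda>_. True) (sphere 0 1) (sphere 0 1) (Q' \<circ> (F \<circ> I)) (Q' \<circ> ((\<lambda>_. c) \<circ> I))"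
      by (rule homotopic_with_compose_continuous_left) (auto simp: Q(4) intro: linear_continuous_on[OF bl(4)])
    moreover have "Q' \<circ> (F \<circ> I) = f" by (auto simp: F_def Q(5) I(5))
    moreover have "Q' \<circ> ((\<lambda>_. c) \<circ> I) = (\<lambda>_. Q' c)" by auto
    ultimately show False using nnull by metis
  qed
  \<comment> \<open>Over \<open>V\<close> the last coordinate satisfies
    \<open>s\<^sup>2 \<le> 2 * \<delta>\<close>. Together with
    \<open>\<delta>\<^sup>2 < \<delta>\<close> this puts the squared distance from \<open>p\<close>
    below \<open>3 * \<delta>\<close>, which is less than \<open>r\<^sup>2\<close>.\<close>
  define \<delta> where "\<delta> = min (1 / 2) (r\<^sup>2 / 4)"
  have \<delta>: "0 < \<delta>" "\<delta> \<le> 1 / 2" "4 * \<delta> \<le> r\<^sup>2" using r by (auto simp: \<delta>_def)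
  define V where "V = ball p\<^sub>1 \<delta> \<inter> ball 0 1"
  have V: "open V" "V \<noteq> {}" "V \<subseteq> ball 0 1"
  proof -
    have "(1 - \<delta> / 2) *\<^sub>R p\<^sub>1 \<in> V"
    proof -
      have "p\<^sub>1 - (1 - \<delta> / 2) *\<^sub>R p\<^sub>1 = (\<delta> / 2) *\<^sub>R p\<^sub>1" by (simp add: algebra_simps)
      then show ?thesis using \<delta> np1 by (simp add: V_def dist_norm)
    qed
    then show "V \<noteq> {}" by blast
  qed (auto simp: V_def)
  have near: "dist y p < r" if y: "y \<in> sphere 0 1" "fst (Q y) \<in> V" for y
  proof -
    obtain v s where vs: "Q y = (v, s)" by (metis surj_pair)
    have v: "norm (v - p\<^sub>1) < \<delta>" "norm v < 1" using y(2) by (auto simp: vs V_def dist_norm norm_minus_commute)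
    have "norm (Q y) = 1" using y(1) by (simp add: Q(3))
    then have s2: "s\<^sup>2 = 1 - (norm v)\<^sup>2" by (simp add: vs norm_Pair)
    have "1 - \<delta> < norm v" using v(1) np1 norm_triangle_sub[of p\<^sub>1 v] by (simp add: norm_minus_commute)
    then have "(1 - \<delta>)\<^sup>2 \<le> (norm v)\<^sup>2" using \<delta> by (intro power_mono) auto
    then have s2': "s\<^sup>2 \<le> 2 * \<delta>" unfolding s2 by (simp add: power2_eq_square algebra_simps) (smt (verit) zero_le_square)
    have "(norm (v - p\<^sub>1))\<^sup>2 \<le> \<delta>\<^sup>2" using v(1) by (intro power_mono) auto
    also have "\<delta>\<^sup>2 < \<delta> * 1" unfolding power2_eq_square using \<delta> by (intro mult_strict_left_mono) auto
    finally have "(norm (v - p\<^sub>1))\<^sup>2 + s\<^sup>2 < r\<^sup>2" using s2' \<delta> by linarith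
    moreover have "(dist (Q y) (Q p))\<^sup>2 = (norm (v - p\<^sub>1))\<^sup>2 + s\<^sup>2"
      unfolding vs Qp dist_Pair_Pair by (simp add: dist_norm)
    ultimately have "(dist y p)\<^sup>2 < r\<^sup>2" by (simp add: Qdist)
    then show ?thesis using r by (simp add: power_less_imp_less_base)
  qed
  define h where "h x = fst (F (stereo_inv x))" for x
  \<comment> \<open>Besides its projection \<open>h\<close> the full map is kept in the chart,
    because \<open>f\<close> itself must be differentiable at the selected points.\<close>
  define G where "G x = F (stereo_inv x)" for x
  have L0: "0 \<le> L" using lip lipschitz_on_nonneg by blast
  have Glip: "(L * 2)-lipschitz_on UNIV G"
  proof (rule lipschitz_onI)
    fix x y :: "(real, 'p) vec"
    have "dist (G x) (G y) \<le> L * dist (stereo_inv x) (stereo_inv y)"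
      unfolding G_def by (rule lipschitz_onD[OF Flip]) auto
    also have "\<dots> \<le> L * (2 * dist x y)"
      using lipschitz_onD[OF lipschitz_stereo_inv, of x y] L0 by (intro mult_left_mono) auto
    finally show "dist (G x) (G y) \<le> L * 2 * dist x y" by simp
  qed (use L0 in simp)
  have contG: "continuous_on UNIV G" using Glip lipschitz_on_continuous_on by blast
  have conth: "continuous_on UNIV h" unfolding h_def G_def[symmetric] by (intro continuous_intros contG)
  have nonneg: "\<not> negligible {x. h x \<in> V \<and> x \<notin> degenerate_set h}"
  proof
    assume neg: "negligible {x. h x \<in> V \<and> x \<notin> degenerate_set h}"
    have "\<exists>c. homotopic_with_canon (\<lambda>_. True) (sphere 0 1) (sphere 0 1) F (\<lambda>_. c)"
    proof (rule image_degenerate_chart_negligible_imp_nullhomotopic[OF card(3) Flip FS V])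
      show "negligible {x. fst (F (stereo_inv x)) \<in> V \<and> x \<notin> degenerate_set (\<lambda>x. fst (F (stereo_inv x)))}"
        using neg unfolding h_def .
    qed (rule push; blast)
    then show False using Fnn by blast
  qed
  define E where "E = {x. h x \<in> V \<and> x \<notin> degenerate_set h} - {x. \<not> G differentiable (at x)}"
  have negG: "negligible {x. \<not> G differentiable (at x)}" by (rule rademacher[OF Glip])
  have "\<not> negligible E"
  proof
    assume "negligible E"
    then have "negligible (E \<union> {x. \<not> G differentiable (at x)})" using negG by (rule negligible_Un)
    moreover have "{x. h x \<in> V \<and> x \<notin> degenerate_set h} \<subseteq> E \<union> {x. \<not> G differentiable (at x)}"
      unfolding E_def by blast
    ultimately show False using nonneg negligible_subset by blast
  qed
  moreover have "E \<in> sets lebesgue"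
  proof -
    have "open (h -` V)" using V(1) conth by (rule open_vimage)
    then have "h -` V - degenerate_set h \<in> sets borel" using borel_degenerate_set[OF conth] by auto
    moreover have "E = (h -` V - degenerate_set h) - {x. \<not> G differentiable (at x)}" by (auto simp: E_def)
    ultimately show ?thesis using negligible_imp_sets[OF negG] by (metis sets.Diff sets_completionI_sets sets_lborel)
  qed
  ultimately obtain C\<^sub>0 where C0: "compact C\<^sub>0" "C\<^sub>0 \<subseteq> E" "\<not> negligible C\<^sub>0"
    using compact_subset_not_negligible by blast
  define \<phi> where "\<phi> x = I' (stereo_inv x)" for x
  have n\<phi>: "norm (\<phi> x) = 1" for x by (simp add: \<phi>_def I(4))
  have bck: "stereo (I (\<phi> x)) = x" for x by (simp add: \<phi>_def I(6))
  have G\<phi>: "G x = Q (f (\<phi> x))" for x by (simp add: G_def F_def \<phi>_def)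
  have diff\<phi>: "\<phi> differentiable (at x)" for x
    unfolding \<phi>_def by (rule differentiable_bounded_linear[OF bl(2) differentiable_stereo_inv])
  then have cont\<phi>: "continuous_on UNIV \<phi>"
    by (simp add: continuous_on_eq_continuous_at differentiable_imp_continuous_within)
  define C where "C = \<phi> ` C\<^sub>0"
  have CS: "C \<subseteq> sphere 0 1" by (auto simp: C_def n\<phi>)
  have compC: "compact C" unfolding C_def
    by (rule compact_continuous_image[OF continuous_on_subset[OF cont\<phi> subset_UNIV] C0(1)])
  \<comment> \<open>Over a bounded part of the chart \<open>stereo\<close> is Lipschitz, so a
    Hausdorff null \<open>C\<close> would have the null image \<open>C\<^sub>0\<close>.\<close>
  have "hausdorff_outer_measure (CARD('p)) C \<noteq> 0"
  proof
    assume null: "hausdorff_outer_measure (CARD('p)) C = 0"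
    obtain b where b: "0 < b" "\<And>x. x \<in> C\<^sub>0 \<Longrightarrow> norm x \<le> b"
      using compact_imp_bounded[OF C0(1)] unfolding bounded_pos by blast
    have "negligible ((\<lambda>z. stereo (I z)) ` C)"
    proof (rule negligible_Lipschitz_image_hausdorff_null)
      show "hausdorff_outer_measure DIM((real, 'p) vec) C = 0" using null by simp
      show "0 < 1 + b\<^sup>2" using b(1) by (simp add: add_pos_nonneg)
      show "dist (stereo (I x)) (stereo (I y)) \<le> (1 + b\<^sup>2) * dist x y" if xy: "x \<in> C" "y \<in> C" for x y
      proof -
        obtain x' y' where "x' \<in> C\<^sub>0" "x = \<phi> x'" "y' \<in> C\<^sub>0" "y = \<phi> y'" using xy by (auto simp: C_def)
        then show ?thesis
          using dist_le_dist_stereo_inv[of x' b y'] b(2) by (simp add: bck) (simp add: \<phi>_def I'dist)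
      qed
    qed
    moreover have "(\<lambda>z. stereo (I z)) ` C = C\<^sub>0" by (simp add: C_def image_image bck)
    ultimately show False using C0(3) by simp
  qed
  moreover have "f differentiable (at z within sphere 0 1) \<and> rank_on_sphere f z = CARD('q)" if zC: "z \<in> C" for z
  proof -
    obtain x where x: "x \<in> C\<^sub>0" "z = \<phi> x" using zC by (auto simp: C_def)
    have zS: "z \<in> sphere 0 1" by (simp add: x n\<phi>)
    have Gx: "G differentiable (at x)" and xd: "x \<notin> degenerate_set h" using x(1) C0(2) by (auto simp: E_def)
    have sx: "snd (I z) < 1"
    proof -
      have "snd (stereo_inv x) < 1" using stereo_inv_denom[of x] by (simp add: stereo_inv_def pos_divide_less_eq)
      then show ?thesis by (simp add: x(2) \<phi>_def I(6))
    qed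
    have fdiff: "f differentiable (at z within sphere 0 1)"
    proof -
      have 1: "(\<lambda>y. stereo (I y)) differentiable (at z within sphere 0 1)"
        by (rule differentiable_compose[where f = stereo and g = I])
          (use sx differentiable_stereo[of "I z" UNIV] differentiable_bounded_linear[OF bl(1) differentiable_ident] in auto)
      have 2: "(\<lambda>y. G (stereo (I y))) differentiable (at z within sphere 0 1)"
        by (rule differentiable_compose[where f = G and g = "\<lambda>y. stereo (I y)", OF _ 1]) (simp add: x(2) bck Gx)
      have 3: "(\<lambda>y. Q' (G (stereo (I y)))) differentiable (at z within sphere 0 1)"
        by (rule differentiable_bounded_linear[OF bl(4) 2])
      \<comment> \<open>Near \<open>z\<close>, away from the pole, \<open>f\<close> is recovered on
        the sphere from \<open>G\<close> and \<open>stereo\<close>, which transfers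
        differentiability back.\<close>
      have "open {y. snd (I y) < 1}"
        by (intro open_Collect_less continuous_intros linear_continuous_on[OF bl(1)])
      then obtain d where d: "0 < d" "ball z d \<subseteq> {y. snd (I y) < 1}"
        using sx open_contains_ball by (metis mem_Collect_eq)
      show ?thesis
      proof (rule differentiable_transform_within[OF 3 d(1) zS])
        fix y assume y: "y \<in> sphere 0 1" "dist y z < d"
        have "snd (I y) \<noteq> 1" using d(2) y(2) by (auto simp: subset_iff dist_commute)
        then have "stereo_inv (stereo (I y)) = I y" using y(1) by (intro stereo_inv_stereo) (simp_all add: I(3))
        then show "Q' (G (stereo (I y))) = f y" by (simp add: G_def F_def I(5) Q(5))
      qed
    qed
    then obtain D where D: "(f has_derivative D) (at z within sphere 0 1)" by (auto simp: differentiable_def)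
    obtain P where P: "(\<phi> has_derivative P) (at x)" using diff\<phi>[of x] by (auto simp: differentiable_def)
    have "(f has_derivative D) (at (\<phi> x) within range \<phi>)"
      by (rule has_derivative_subset[of _ _ _ "sphere 0 1"]) (use D x(2) n\<phi> in auto)
    then have "((f \<circ> \<phi>) has_derivative (D \<circ> P)) (at x)"
      by (rule diff_chain_within[OF P])
    then have "((\<lambda>x. fst (Q (f (\<phi> x)))) has_derivative (\<lambda>u. fst (Q (D (P u))))) (at x)"
      by (intro has_derivative_fst bounded_linear.has_derivative[OF bl(3)]) (simp add: o_def)
    then have "(h has_derivative (\<lambda>u. fst (Q (D (P u))))) (at x)"
      by (simp add: h_def[abs_def] G_def[symmetric] G\<phi>)
    then have surj: "range (\<lambda>u. fst (Q (D (P u)))) = UNIV" using degenerate_set_iff xd by blast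
    have tang: "P u \<in> tangent_space_sphere z" for u
    proof -
      have 1: "((\<lambda>x. \<phi> x \<bullet> \<phi> x) has_derivative (\<lambda>u. \<phi> x \<bullet> P u + P u \<bullet> \<phi> x)) (at x)"
        by (rule has_derivative_inner[OF P P])
      have "(\<lambda>x. \<phi> x \<bullet> \<phi> x) = (\<lambda>x. 1)" using n\<phi> by (simp add: norm_eq_1)
      then have 2: "((\<lambda>x. \<phi> x \<bullet> \<phi> x) has_derivative (\<lambda>u. 0)) (at x)" by simp
      have "(\<lambda>u. \<phi> x \<bullet> P u + P u \<bullet> \<phi> x) = (\<lambda>u. 0)" by (rule has_derivative_unique[OF 1 2])
      then have "\<phi> x \<bullet> P u + P u \<bullet> \<phi> x = 0" by metis
      then show ?thesis by (simp add: tangent_space_sphere_def x(2) inner_commute)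
    qed
    \<comment> \<open>The projected chart map has full rank and factors through \<open>D\<close> on
      the tangent space, which bounds the rank of \<open>f\<close> from below.\<close>
    have "CARD('q) = dim (UNIV :: (real, 'q) vec set)" by simp
    also have "\<dots> = dim ((\<lambda>y. fst (Q y)) ` D ` range P)" by (simp only: surj[symmetric] image_image)
    also have "\<dots> \<le> dim (D ` range P)"
      using linear_compose[OF Q(1) linear_fst] by (intro dim_image_le) (simp add: o_def)
    also have "\<dots> \<le> dim (D ` tangent_space_sphere z)" using tang by (intro dim_subset) blast
    finally have "CARD('q) \<le> dim (D ` tangent_space_sphere z)" .
    moreover have "dim (D ` tangent_space_sphere z) \<le> dim (tangent_space_sphere (f z))"
      by (intro dim_subset tangent_image_subset[OF zS fS D])
    moreover have "f z \<in> sphere 0 1" using fS zS by blast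
    then have "dim (tangent_space_sphere (f z)) = CARD('q)"
      using card by (simp add: dim_tangent_space_sphere)
    ultimately have "rank_on_sphere f z = CARD('q)" using rank_on_sphere_eq[OF zS D] by simp
    then show ?thesis using fdiff by blast
  qed
  moreover have "f ` C \<subseteq> ball p r"
  proof
    fix y assume "y \<in> f ` C"
    then obtain x where x: "x \<in> C\<^sub>0" "y = f (\<phi> x)" by (auto simp: C_def)
    have "\<phi> x \<in> sphere 0 1" by (simp add: n\<phi>)
    then have "y \<in> sphere 0 1" using fS x(2) by blast
    moreover have "fst (Q y) \<in> V"
      using x C0(2) by (auto simp: E_def h_def G_def[symmetric] G\<phi>)
    ultimately have "dist y p < r" by (rule near)
    then show "y \<in> ball p r" by (simp add: dist_commute)
  qed
  ultimately show ?thesis using CS compC by (auto simp: zero_less_iff_neq_zero)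
qed

text \<open>Caps of radius 1 / (j + 1) around a countable dense set of centres suffice. The union of
  their compact sets is a countable union of closed sets, hence Caratheodory measurable.\<close>

lemma dense_regular_set:
  fixes f :: "real ^ 'm \<Rightarrow> real ^ 'k"
  assumes sph: "sphere (0 :: real ^ 'k) 1 \<noteq> {}"
    and cap: "\<And>p r. \<lbrakk>p \<in> sphere 0 1; 0 < r\<rbrakk> \<Longrightarrow> \<exists>C \<subseteq> sphere 0 1. compact C \<and> 0 < hausdorff_outer_measure N C \<and>
       (\<forall>x\<in>C. P x) \<and> f ` C \<subseteq> ball p r"
  shows "\<exists>A \<subseteq> sphere 0 1. A \<in> sets (hausdorff_measure N) \<and> emeasure (hausdorff_measure N) A > 0 \<and>
    (\<forall>x\<in>A. P x) \<and> sphere 0 1 \<subseteq> closure (f ` A)"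
proof -
  obtain T where T: "countable T" "T \<subseteq> sphere (0 :: real ^ 'k) 1" "sphere 0 1 \<subseteq> closure T"
    using separable by metis
  have "\<forall>p\<in>T. \<forall>j. \<exists>C \<subseteq> sphere 0 1. compact C \<and> 0 < hausdorff_outer_measure N C \<and>
       (\<forall>x\<in>C. P x) \<and> f ` C \<subseteq> ball p (1 / real (Suc j))"
  proof (intro ballI allI)
    fix p j assume "p \<in> T"
    then have "p \<in> sphere 0 1" using T(2) by blast
    moreover have "0 < 1 / real (Suc j)" by simp
    ultimately show "\<exists>C \<subseteq> sphere 0 1. compact C \<and> 0 < hausdorff_outer_measure N C \<and>
       (\<forall>x\<in>C. P x) \<and> f ` C \<subseteq> ball p (1 / real (Suc j))" by (rule cap)
  qed
  then obtain C where C: "\<And>p j. p \<in> T \<Longrightarrow> C p j \<subseteq> sphere 0 1 \<and> compact (C p j) \<and> 0 < hausdorff_outer_measure N (C p j) \<and>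
       (\<forall>x\<in>C p j. P x) \<and> f ` C p j \<subseteq> ball p (1 / real (Suc j))"
    by metis
  define A where "A = (\<Union>p\<in>T. \<Union>j. C p j)"
  have meas: "C p j \<in> sets (hausdorff_measure N)" if "p \<in> T" for p j
    using C[OF that] by (intro closed_in_sets_hausdorff_measure compact_imp_closed) blast
  have A: "A \<in> sets (hausdorff_measure N)"
    unfolding A_def using meas T(1) by (intro sets.countable_UN'' sets.countable_UN) auto
  have "T \<noteq> {}" using sph T(3) by auto
  then obtain p where p: "p \<in> T" by blast
  have "0 < emeasure (hausdorff_measure N) (C p 0)"
    using C[OF p] meas[OF p] by (simp add: emeasure_hausdorff_measure)
  also have "\<dots> \<le> emeasure (hausdorff_measure N) A"
    using p A by (intro emeasure_mono) (auto simp: A_def)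
  finally have pos: "0 < emeasure (hausdorff_measure N) A" .
  have "s \<in> closure (f ` A)" if s: "s \<in> sphere 0 1" for s
    unfolding closure_approachable
  proof (intro allI impI)
    fix e :: real assume e: "0 < e"
    then obtain q where q: "q \<in> T" "dist q s < e / 2"
      using T(3) s closure_approachable[of s T] by (meson half_gt_zero subsetD)
    obtain j where j: "1 / real (Suc j) < e / 2" using nat_approx_posE[of "e / 2"] e by auto
    have "C q j \<noteq> {}" using C[OF q(1), of j] by auto
    then obtain x where x: "x \<in> C q j" by blast
    then have "f x \<in> ball q (1 / real (Suc j))" using C[OF q(1), of j] by blast
    then have "dist (f x) s < e" using q(2) j dist_triangle[of "f x" s q] by (simp add: dist_commute)
    moreover have "x \<in> A" using x q(1) by (auto simp: A_def)
    ultimately show "\<exists>y\<in>f ` A. dist y s < e" by blast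
  qed
  moreover have "A \<subseteq> sphere 0 1" "\<forall>x\<in>A. P x" using C unfolding A_def by blast+
  ultimately show ?thesis using A pos by blast
qed

theorem theorem1p3:
  fixes n :: nat and f :: "real ^ 'm \<Rightarrow> real ^ 'k"
  assumes "n \<in> {2, 3}"
    and "CARD('m) = n + 2" and "CARD('k) = n + 1"
    and "f ` sphere 0 1 \<subseteq> sphere 0 1"
    and "\<exists>L. L-lipschitz_on (sphere 0 1) f"
    and "\<not> (\<exists>c. homotopic_with_canon (\<lambda>_. True) (sphere 0 1) (sphere 0 1) f (\<lambda>_. c))"
  shows "\<exists>A \<subseteq> sphere 0 1.
      A \<in> sets (hausdorff_measure (n + 1)) \<and>
      emeasure (hausdorff_measure (n + 1)) A > 0 \<and>
      (\<forall>x\<in>A. f differentiable (at x within sphere 0 1) \<and> rank_on_sphere f x = n) \<and>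
      sphere 0 1 \<subseteq> closure (f ` A)"
proof (rule dense_regular_set)
  show "sphere (0 :: real ^ 'k) 1 \<noteq> {}" by simp
  obtain L where L: "L-lipschitz_on (sphere 0 1) f" using assms(5) by blast
  fix p :: "real ^ 'k" and r :: real assume p: "p \<in> sphere 0 1" and r: "0 < r"
  show "\<exists>C \<subseteq> sphere 0 1. compact C \<and> 0 < hausdorff_outer_measure (n + 1) C \<and>
      (\<forall>x\<in>C. f differentiable (at x within sphere 0 1) \<and> rank_on_sphere f x = n) \<and> f ` C \<subseteq> ball p r"
  proof (cases "n = 2")
    case True
    \<comment> \<open>The numeral types 3 and 2 serve as well-ordered index types for the chart and
      its projected target.\<close>
    have "\<exists>C \<subseteq> sphere 0 1. compact C \<and> 0 < hausdorff_outer_measure (CARD(3)) C \<and>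
      (\<forall>x\<in>C. f differentiable (at x within sphere 0 1) \<and> rank_on_sphere f x = CARD(2)) \<and> f ` C \<subseteq> ball p r"
    proof (rule regular_compact_set_over_cap[OF _ _ _ assms(4) L assms(6) p r])
      fix h :: "real ^ 3 \<Rightarrow> real ^ 2" and M a b w and e :: real
      assume "M-lipschitz_on UNIV h" and K: "\<And>i. negligible ((\<lambda>x. x $ i) ` {x \<in> cbox a b. h x = w})"
        "\<And>i. a $ i < b $ i" "\<And>x. x \<in> frontier (cbox a b) \<Longrightarrow> h x \<noteq> w" "0 < e"
      then show "pushable h (cbox a b) w e"
        by (intro push_off_plane[OF _ _ _ K] lipschitz_on_continuous_on) auto
    qed (use assms(2,3) True in auto)
    then show ?thesis using True by simp
  next
    case False
    then have n: "n = 3" using assms(1) by simp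
    have "\<exists>C \<subseteq> sphere 0 1. compact C \<and> 0 < hausdorff_outer_measure (CARD(4)) C \<and>
      (\<forall>x\<in>C. f differentiable (at x within sphere 0 1) \<and> rank_on_sphere f x = CARD(3)) \<and> f ` C \<subseteq> ball p r"
    proof (rule regular_compact_set_over_cap[OF _ _ _ assms(4) L assms(6) p r])
      fix h :: "real ^ 4 \<Rightarrow> real ^ 3" and M a b w and e :: real
      assume *: "M-lipschitz_on UNIV h" "\<And>i. negligible ((\<lambda>x. x $ i) ` {x \<in> cbox a b. h x = w})"
        "\<And>i. a $ i < b $ i" "\<And>x. x \<in> frontier (cbox a b) \<Longrightarrow> h x \<noteq> w" "0 < e"
        "negligible {x \<in> cbox a b. norm (h x - w) \<le> e \<and> \<not> (h differentiable (at x) \<and> x \<in> degenerate_set h)}"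
      show "pushable h (cbox a b) w e"
        by (rule push_off_space[OF _ *]) simp
    qed (use assms(2,3) n in auto)
    then show ?thesis using n by simp
  qed
qed

end
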